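(* Let $x\notin\mathbb{Z}$ and $x>0$. Then \begin{align*} &\sum_{n=1}^{\infty}\frac{\sigma_{1/2}(n)}{\sqrt n}e^{-2\pi\sqrt{2nx}}\sin\left(\frac\pi4+2\pi\sqrt{2nx}\right)\\ &=\frac12\left\{\left(\frac{1}{\pi\sqrt x}-\frac1{\sqrt2}\right)\zeta\left(\tfrac12\right)-\frac{1}{\pi x\sqrt2}\zeta\left(-\tfrac12\right)\right\}+\frac{x}{\pi\sqrt2}\sum_{n=1}^{\infty}\frac{\sigma_{1/2}(n)}{\sqrt n}\,\frac{\sqrt{2x}-\sqrt n}{x^2+n^2}. \end{align*}
   Context: $\sigma_s(n)=\sum_{d\mid n}d^s$; $\zeta$ is the Riemann zeta function. *)

theory Defs
  imports "HOL-Complex_Analysis.Complex_Analysis"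
begin

definition divisor_sigma :: "'a::ln \<Rightarrow> nat \<Rightarrow> 'a" where
  "divisor_sigma s n = (\<Sum>d | d dvd n. of_nat d powr s)"

text \<open>
  The Riemann zeta function, as the analytic continuation of its Dirichlet series to the
  complex plane without the point 1. The value at the pole is fixed to be 0 only so
  that exactly one function satisfies the description.
\<close>

definition riemann_zeta :: "complex \<Rightarrow> complex" where
  "riemann_zeta = (THE f. f holomorphic_on - {1} \<and>
     (\<forall>s. Re s > 1 \<longrightarrow> (\<lambda>n. 1 / of_nat (Suc n) powr s) sums f s) \<and> f 1 = 0)"

end

theory Submission
  imports Defs "HOL-Probability.Distributions"
begin

text \<open>
  Write $A(t) = 1/(e^t-1) = 1/t - 1/2 + B(t)$, where $B(t) = \sum_k 2t/(t^2+4\pi^2k^2)$. Since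
  $\int_0^\infty t^{-1/2} e^{-dt-mc^2/t}\,dt = \sqrt{\pi/d}\, e^{-2c\sqrt{dm}}$ and
  $\sigma_{1/2}(n)/\sqrt n = \sum_{d \mid n} d^{-1/2}$, the integral of
  $t^{-1/2}A(t)A(c^2/t)$ is $\sqrt\pi \sum_n \sigma_{1/2}(n) n^{-1/2} e^{-2c\sqrt n}$, whereas the
  partial fractions of $B$ turn the integral of $t^{-1/2}B(t)B(c^2/t)$ into a series of rational
  functions of $c$ and $\sqrt n$. The difference of the two integrands splits into four terms whose
  integrals are Mellin transforms of $A$, $B$ and $B - 1/2$, that is, values of $\zeta$. For
  $0 < c < 2\pi$ everything is positive, so that all interchanges follow from Tonelli's theorem.
  Both sides are holomorphic in the half-plane $\mathrm{Re}\, c > 0$; the theorem is the imaginary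
  part of $e^{i\pi/4}$ times the identity at $c = 2\pi\sqrt x\, e^{-i\pi/4}$.

  The description of $\zeta$ is justified by gluing: the Mellin transform of $A$, cut off at $1$,
  gives $\zeta$ for $\mathrm{Re}\, s > -1$, and the functional equation gives it for
  $\mathrm{Re}\, s < 0$.
\<close>

section \<open>Partial fractions of the cotangent\<close>

text \<open>The integral identities are proved in \<open>ennreal\<close>, where convergence need not
  be known beforehand but subtraction is treacherous. Hence each of them is arranged with
  nonnegative terms on both sides, and the difference of the two products is grouped through B and
  1/2 - B: the elementary summands 1/t and 1/2 alone diverge against t^(-1/2). The bound 2 pi has a
  similar origin. The integral attached to a pair (j, k) is a difference of two integrals, with
  poles at 2 pi k i and i c^2/(2 pi j), and it is taken in the positive order if c^2 < 4 pi^2 j k; c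
  < 2 pi secures this for all pairs at once. The angle of the final c makes c^2 = -4 pi^2 i x
  imaginary: multiplying (4 pi^2 n + c^2)(2 pi sqrt n + c) by 2 pi sqrt n - c then yields the real
  number 16 pi^4 (n^2 + x^2). The rotation by e^(i pi/4) makes the term linear in c real, so that
  its imaginary part vanishes.\<close>

text \<open>Logarithmic differentiation of Gamma z * Gamma (1 - z) * sin (pi z) = pi gives pi cot
  (pi z) = Digamma (1 - z) - Digamma z, and the series of \<open>Digamma\<close> supplies the
  partial fractions.\<close>

lemma cot_partial_fractions_sums:
  fixes z :: complex
  assumes "z \<notin> \<int>"
  shows "(\<lambda>k. 2 * z / (z\<^sup>2 - of_nat (Suc k) ^ 2)) sums (of_real pi * cot (of_real pi * z) - 1 / z)"
proof -
  have nz: "z \<noteq> 0" using assms by auto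
  have not_int: "1 + z \<notin> \<int>" "1 - z \<notin> \<int>" "- z \<notin> \<int>"
    using assms by (metis Ints_1 Ints_diff add_diff_cancel_left' diff_diff_eq2 minus_in_Ints_iff)+
  have nz_shift: "1 - z \<noteq> 0" "1 + z \<noteq> 0"
    using not_int by (metis Ints_0)+
  have sin_nz: "sin (of_real pi * z) \<noteq> 0"
    using assms by (auto simp: sin_eq_0 mult.commute)
  have not_nonpos: "z \<notin> \<int>\<^sub>\<le>\<^sub>0" "1 - z \<notin> \<int>\<^sub>\<le>\<^sub>0"
    using assms not_int by (metis nonpos_Ints_Int)+
  have Gamma_nz: "Gamma z \<noteq> 0" "Gamma (1 - z) \<noteq> 0"
    using not_nonpos by (auto simp: Gamma_eq_zero_iff)
  \<comment> \<open>\<open>F\<close> equals pi off the integers, an open set, so its derivative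
    vanishes there; the product rule expresses the same derivative through
    \<open>Digamma\<close>.\<close>
  define F where "F = (\<lambda>z::complex. Gamma z * Gamma (1 - z) * sin (of_real pi * z))"
  have F_const: "F w = of_real pi" if "w \<in> - \<int>" for w
    using that by (auto simp: F_def Gamma_reflection_complex sin_eq_0 mult.commute)
  have "(F has_field_derivative (Gamma z * Digamma z * Gamma (1 - z) * sin (of_real pi * z)
           - Gamma z * Gamma (1 - z) * Digamma (1 - z) * sin (of_real pi * z)
           + Gamma z * Gamma (1 - z) * of_real pi * cos (of_real pi * z))) (at z)"
    unfolding F_def using not_nonpos
    by (auto intro!: derivative_eq_intros simp: algebra_simps)
  moreover have "(F has_field_derivative 0) (at z)"
  proof (rule has_field_derivative_transform_within_open[of "\<lambda>_. of_real pi"])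
    show "open (- \<int> :: complex set)" by (simp add: open_Compl closed_Ints)
  qed (use assms F_const in auto)
  ultimately have "Gamma z * Digamma z * Gamma (1 - z) * sin (of_real pi * z)
           - Gamma z * Gamma (1 - z) * Digamma (1 - z) * sin (of_real pi * z)
           + Gamma z * Gamma (1 - z) * of_real pi * cos (of_real pi * z) = 0"
    by (rule DERIV_unique)
  moreover have "sin (of_real pi * z) * cot (of_real pi * z) = cos (of_real pi * z)"
    using sin_nz by (simp add: cot_def)
  ultimately have "(Gamma z * Gamma (1 - z) * sin (of_real pi * z)) *
           (Digamma z - Digamma (1 - z) + of_real pi * cot (of_real pi * z)) = 0"
    by algebra
  hence "Digamma z - Digamma (1 - z) + of_real pi * cot (of_real pi * z) = 0"
    using sin_nz Gamma_nz by simp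
  hence refl: "of_real pi * cot (of_real pi * z) = Digamma (1 - z) - Digamma z"
    by (simp add: algebra_simps)
  have D: "(\<lambda>k. inverse (of_nat (Suc k)) - inverse (w + of_nat k)) sums (Digamma w + euler_mascheroni)"
    if "w \<noteq> 0" for w :: complex
    using summable_Digamma[OF that] by (simp add: Digamma_def summable_sums)
  \<comment> \<open>Comparing with \<open>Digamma (1 + z)\<close> instead of
    \<open>Digamma z\<close> splits off 1 / z, and the poles at k + 1 and -(k + 1) then share the
    index k.\<close>
  have "(\<lambda>k. (inverse (of_nat (Suc k)) - inverse (1 - z + of_nat k)) -
             (inverse (of_nat (Suc k)) - inverse (1 + z + of_nat k)))
          sums ((Digamma (1 - z) + euler_mascheroni) - (Digamma (1 + z) + euler_mascheroni))"
    using nz_shift by (intro sums_diff D)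
  also have "(Digamma (1 - z) + euler_mascheroni) - (Digamma (1 + z) + euler_mascheroni)
      = of_real pi * cot (of_real pi * z) - 1 / z"
    using Digamma_plus1[OF nz] by (simp add: refl add.commute)
  also have "(\<lambda>k. (inverse (of_nat (Suc k)) - inverse (1 - z + of_nat k)) -
             (inverse (of_nat (Suc k)) - inverse (1 + z + of_nat k)))
      = (\<lambda>k. 2 * z / (z\<^sup>2 - of_nat (Suc k) ^ 2))"
  proof
    fix k
    have "1 - z + of_nat k \<noteq> 0"
      using assms by (metis Ints_of_nat add.commute add_diff_eq diff_eq_eq of_nat_Suc add_0)
    moreover have "1 + z + of_nat k \<noteq> 0"
      using assms by (metis Ints_of_nat Ints_minus add.assoc add.commute add_eq_0_iff of_nat_Suc)
    moreover have "z\<^sup>2 - of_nat (Suc k) ^ 2 = - ((1 - z + of_nat k) * (1 + z + of_nat k))"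
      by (simp add: algebra_simps power2_eq_square)
    ultimately show "(inverse (of_nat (Suc k)) - inverse (1 - z + of_nat k)) -
             (inverse (of_nat (Suc k)) - inverse (1 + z + of_nat k))
      = 2 * z / (z\<^sup>2 - of_nat (Suc k) ^ 2)"
      by (simp add: divide_simps del: of_nat_Suc) (simp add: algebra_simps)
  qed
  finally show ?thesis .
qed

section \<open>The Bose kernel and its regularization\<close>

definition bose :: "real \<Rightarrow> real" where
  "bose t = 1 / (exp t - 1)"

text \<open>In the overview \<open>bose\<close> is A and this is B, that is, coth (t/2) / 2 - 1/t.
  The summand 1/2 makes it odd: it vanishes like t as t tends to 0, and it tends to 1/2 at
  infinity.\<close>

definition bose_reg :: "real \<Rightarrow> real" where
  "bose_reg t = bose t - 1 / t + 1 / 2"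

lemma bose_reg_sums:
  assumes t: "t > 0"
  shows "(\<lambda>k. 2 * t / (t\<^sup>2 + (2 * pi * real (Suc k))\<^sup>2)) sums bose_reg t"
proof -
  \<comment> \<open>On the imaginary axis the cotangent becomes coth; the scaling puts the poles in
    t at multiples of 2 pi i, and the factor i / (2 pi) below makes the terms real.\<close>
  define z where "z = \<i> * of_real (t / (2 * pi))"
  have "Im z \<noteq> 0" using t by (simp add: z_def)
  hence z: "z \<notin> \<int>" by (auto elim!: Ints_cases)
  have "(\<lambda>k. \<i> / (2 * of_real pi) * (2 * z / (z\<^sup>2 - of_nat (Suc k) ^ 2)))
          sums (\<i> / (2 * of_real pi) * (of_real pi * cot (of_real pi * z) - 1 / z))"
    by (intro sums_mult cot_partial_fractions_sums z)
  also have "(\<lambda>k. \<i> / (2 * of_real pi) * (2 * z / (z\<^sup>2 - of_nat (Suc k) ^ 2)))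
      = (\<lambda>k. complex_of_real (2 * t / (t\<^sup>2 + (2 * pi * real (Suc k))\<^sup>2)))"
  proof
    fix k
    have pos: "t\<^sup>2 + (2 * pi * real (Suc k))\<^sup>2 \<noteq> 0"
      using t by (simp add: sum_power2_eq_zero_iff)
    have "z\<^sup>2 - of_nat (Suc k) ^ 2 = - of_real ((t\<^sup>2 + (2 * pi * real (Suc k))\<^sup>2) / (4 * pi\<^sup>2))"
      by (simp add: z_def power_mult_distrib power_divide field_simps del: of_nat_Suc)
    hence "\<i> / (2 * of_real pi) * (2 * z / (z\<^sup>2 - of_nat (Suc k) ^ 2))
       = of_real (1 / (2 * pi) * 2 * (t / (2 * pi)) / ((t\<^sup>2 + (2 * pi * real (Suc k))\<^sup>2) / (4 * pi\<^sup>2)))"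
      by (simp add: z_def)
    also have "1 / (2 * pi) * 2 * (t / (2 * pi)) / ((t\<^sup>2 + (2 * pi * real (Suc k))\<^sup>2) / (4 * pi\<^sup>2))
       = 2 * t / (t\<^sup>2 + (2 * pi * real (Suc k))\<^sup>2)"
      using pos by (simp add: field_simps power2_eq_square del: of_nat_Suc)
    finally show "\<i> / (2 * of_real pi) * (2 * z / (z\<^sup>2 - of_nat (Suc k) ^ 2))
       = complex_of_real (2 * t / (t\<^sup>2 + (2 * pi * real (Suc k))\<^sup>2))" .
  qed
  also have "\<i> / (2 * of_real pi) * (of_real pi * cot (of_real pi * z) - 1 / z) = of_real (bose_reg t)"
  proof -
    have e: "exp (t / 2) * exp (t / 2) = exp t" "exp (-t/2) * exp (t / 2) = 1"
      by (simp_all flip: exp_add)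
    have e1: "exp t \<noteq> 1" using t by simp
    have e2: "exp (t / 2) - exp (-t/2) \<noteq> 0" using t by simp
    have iz: "\<i> * (of_real pi * z) = of_real (- t / 2)" by (simp add: z_def)
    have c: "cos (of_real pi * z) = of_real ((exp (- t / 2) + exp (t / 2)) / 2)"
      unfolding cos_exp_eq iz by (simp flip: exp_of_real add: iz)
    have s: "sin (of_real pi * z) = \<i> * of_real ((exp (t / 2) - exp (- t / 2)) / 2)"
      unfolding sin_exp_eq iz by (simp flip: exp_of_real add: iz field_simps)
    have "cot (of_real pi * z) = - \<i> * of_real ((exp (- t / 2) + exp (t / 2)) / (exp (t / 2) - exp (- t / 2)))"
      unfolding cot_def c s using e2 by (simp add: field_simps del: of_real_exp flip: of_real_diff)
    moreover have "\<i> / (2 * of_real pi) * (1 / z) = of_real (1 / t)"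
      using t by (simp add: z_def field_simps)
    moreover have "\<i> / (2 * of_real pi) * (of_real pi * (- \<i> * c)) = c / 2" for c
      by simp
    ultimately have "\<i> / (2 * of_real pi) * (of_real pi * cot (of_real pi * z) - 1 / z)
       = of_real ((exp (- t / 2) + exp (t / 2)) / (exp (t / 2) - exp (- t / 2)) / 2 - 1 / t)"
      unfolding right_diff_distrib by (simp only: of_real_diff of_real_divide of_real_numeral)
    also have "(exp (- t / 2) + exp (t / 2)) / (exp (t / 2) - exp (- t / 2)) / 2 - 1 / t = bose_reg t"
    proof -
      \<comment> \<open>Expanding the fraction by e^(t/2) turns coth (t/2) into (e^t + 1) / (e^t -
        1) = 1 + 2 * \<open>bose t\<close>.\<close>
      have "(exp (- t / 2) + exp (t / 2)) / (exp (t / 2) - exp (- t / 2))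
         = ((exp (- t / 2) + exp (t / 2)) * exp (t / 2)) / ((exp (t / 2) - exp (- t / 2)) * exp (t / 2))"
        by simp
      also have "\<dots> = (exp t + 1) / (exp t - 1)"
        using e by (simp add: algebra_simps)
      finally show ?thesis using e1
        by (simp add: bose_reg_def bose_def divide_simps) (simp add: algebra_simps)?
    qed
    finally show ?thesis .
  qed
  finally show ?thesis by (simp only: sums_of_real_iff)
qed

section \<open>Integrals over the half-line\<close>

text \<open>Bridge between nonnegative Lebesgue integrals and absolute integrability, the setting of
  the change of variables theorem.\<close>

lemma nn_integral_eq_iff_absolutely_integrable:
  fixes h :: "real \<Rightarrow> real"
  assumes S: "S \<in> sets borel" and nonneg: "\<And>x. x \<in> S \<Longrightarrow> 0 \<le> h x"
    and meas: "set_borel_measurable borel S h" and b: "0 \<le> b"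
  shows "(\<integral>\<^sup>+t\<in>S. ennreal (h t) \<partial>lborel) = ennreal b \<longleftrightarrow>
           h absolutely_integrable_on S \<and> integral S h = b"
proof -
  have m: "(\<lambda>t. indicator S t * h t) \<in> borel_measurable lborel"
    using meas by (simp add: set_borel_measurable_def)
  have "(\<integral>\<^sup>+t\<in>S. ennreal (h t) \<partial>lborel) = (\<integral>\<^sup>+t. ennreal (indicator S t * h t) \<partial>lborel)"
    by (intro nn_integral_cong) (auto split: split_indicator)
  also have "\<dots> = ennreal b \<longleftrightarrow>
      integrable lborel (\<lambda>t. indicator S t * h t) \<and> integral\<^sup>L lborel (\<lambda>t. indicator S t * h t) = b"
    using nonneg by (intro nn_integral_eq_integrable m b) (auto split: split_indicator)
  also have "\<dots> \<longleftrightarrow> set_integrable lborel S h \<and> set_lebesgue_integral lborel S h = b"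
    by (simp add: set_integrable_def set_lebesgue_integral_def)
  also have "\<dots> \<longleftrightarrow> h absolutely_integrable_on S \<and> integral S h = b"
  proof -
    have "set_integrable lborel S h \<longleftrightarrow> h absolutely_integrable_on S"
      unfolding set_integrable_def using m integrable_completion[of "\<lambda>t. indicator S t *\<^sub>R h t" lborel]
      by simp
    moreover have "set_lebesgue_integral lborel S h = integral S h" if "set_integrable lborel S h"
      using set_borel_integral_eq_integral(2)[OF that] .
    ultimately show ?thesis by metis
  qed
  finally show ?thesis .
qed

lemma nn_integral_change_of_variables:
  fixes f g g' :: "real \<Rightarrow> real"
  assumes S: "S \<in> sets borel" and T: "T \<in> sets borel" and bij: "bij_betw g S T"
    and der: "\<And>x. x \<in> S \<Longrightarrow> (g has_field_derivative g' x) (at x)"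
    and nonneg: "\<And>x. x \<in> T \<Longrightarrow> 0 \<le> f x"
    and meas: "set_borel_measurable borel T f" "set_borel_measurable borel S (\<lambda>x. \<bar>g' x\<bar> * f (g x))"
  shows "(\<integral>\<^sup>+t\<in>T. ennreal (f t) \<partial>lborel) = (\<integral>\<^sup>+t\<in>S. ennreal (\<bar>g' t\<bar> * f (g t)) \<partial>lborel)"
proof -
  have g: "inj_on g S" "T = g ` S"
    using bij by (auto simp: bij_betw_def)
  \<comment> \<open>Each finite value is attained by both integrals or by neither, so an infinite
    value on one side forces it on the other.\<close>
  have iff: "(\<integral>\<^sup>+t\<in>T. ennreal (f t) \<partial>lborel) = ennreal b \<longleftrightarrow>
      (\<integral>\<^sup>+t\<in>S. ennreal (\<bar>g' t\<bar> * f (g t)) \<partial>lborel) = ennreal b" if "b \<ge> 0" for b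
  proof -
    have "(\<integral>\<^sup>+t\<in>T. ennreal (f t) \<partial>lborel) = ennreal b \<longleftrightarrow> f absolutely_integrable_on T \<and> integral T f = b"
      by (rule nn_integral_eq_iff_absolutely_integrable) (use T nonneg meas that in auto)
    also have "\<dots> \<longleftrightarrow> (\<lambda>x. \<bar>g' x\<bar> * f (g x)) absolutely_integrable_on S
                   \<and> integral S (\<lambda>x. \<bar>g' x\<bar> * f (g x)) = b"
      unfolding g(2) by (rule has_absolute_integral_change_of_variables_1'[symmetric])
        (use S g der in \<open>auto intro: has_field_derivative_at_within\<close>)
    also have "\<dots> \<longleftrightarrow> (\<integral>\<^sup>+t\<in>S. ennreal (\<bar>g' t\<bar> * f (g t)) \<partial>lborel) = ennreal b"
      by (rule nn_integral_eq_iff_absolutely_integrable[symmetric]) (use S g nonneg meas that in auto)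
    finally show ?thesis .
  qed
  show ?thesis
  proof (cases "(\<integral>\<^sup>+t\<in>T. ennreal (f t) \<partial>lborel)" rule: ennreal_cases)
    case (real r)
    thus ?thesis using iff[of r] by simp
  next
    case top
    show ?thesis
    proof (cases "(\<integral>\<^sup>+t\<in>S. ennreal (\<bar>g' t\<bar> * f (g t)) \<partial>lborel)" rule: ennreal_cases)
      case (real r)
      thus ?thesis using iff[of r] by simp
    qed (use top in simp)
  qed
qed

lemma nn_integral_of_has_integral:
  fixes f :: "real \<Rightarrow> real"
  assumes "(f has_integral I) S" "\<And>x. x \<in> S \<Longrightarrow> 0 \<le> f x"
  shows "(\<integral>\<^sup>+t\<in>S. ennreal (f t) \<partial>lborel) = ennreal I"
proof -
  have "(\<integral>\<^sup>+t\<in>S. ennreal (f t) \<partial>lborel) = (\<integral>\<^sup>+t. ennreal (indicator S t * f t) \<partial>lborel)"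
    by (intro nn_integral_cong) (auto split: split_indicator)
  also have "\<dots> = ennreal I"
    by (rule nn_integral_has_integral_lebesgue) (use assms in auto)
  finally show ?thesis .
qed

lemma nn_set_integral_cmult:
  assumes "0 \<le> c" "(\<lambda>t. ennreal (f t) * indicator S t) \<in> borel_measurable M"
  shows "(\<integral>\<^sup>+t\<in>S. ennreal (c * f t) \<partial>M) = ennreal c * (\<integral>\<^sup>+t\<in>S. ennreal (f t) \<partial>M)"
proof -
  have "(\<integral>\<^sup>+t\<in>S. ennreal (c * f t) \<partial>M) = (\<integral>\<^sup>+t. ennreal c * (ennreal (f t) * indicator S t) \<partial>M)"
    using assms(1) by (intro nn_integral_cong) (simp add: ennreal_mult' mult.assoc)
  thus ?thesis using nn_integral_cmult[OF assms(2)] by simp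
qed

lemma has_integral_spike_set':
  fixes f :: "real \<Rightarrow> real"
  assumes "(f has_integral I) S" "negligible {x \<in> S - T. f x \<noteq> 0}" "T \<subseteq> S"
  shows "(f has_integral I) T"
proof -
  have "{x \<in> T - S. f x \<noteq> 0} = {}" using assms(3) by auto
  hence "negligible {x \<in> T - S. f x \<noteq> 0}" by (metis negligible_empty)
  thus ?thesis using has_integral_spike_set_eq[of S T f I] assms by simp
qed

lemma nn_integral_Gamma:
  assumes s: "s > 0" and c: "c > (0::real)"
  shows "(\<integral>\<^sup>+t\<in>{0<..}. ennreal (t powr (s - 1) * exp (- c * t)) \<partial>lborel) = ennreal (Gamma s * c powr (- s))"
proof -
  have meas: "set_borel_measurable borel {0<..} (\<lambda>x. \<bar>c\<bar> * ((c * x) powr (s - 1) * exp (- (c * x))))"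
    "set_borel_measurable borel {0<..} (\<lambda>t. t powr (s - 1) * exp (- t))"
    by (simp_all add: set_borel_measurable_def)
  have "((\<lambda>t. t powr (s - 1) * exp (- t)) has_integral Gamma s) {0<..}"
  proof (rule has_integral_spike_set'[OF Gamma_integral_real[OF s, unfolded divide_inverse exp_minus[symmetric]]])
    show "negligible {x \<in> {0..} - {0<..}. x powr (s - 1) * exp (- x) \<noteq> 0}"
      by (rule negligible_subset[of "{0}"]) auto
  qed auto
  hence "ennreal (Gamma s) = (\<integral>\<^sup>+t\<in>{0<..}. ennreal (t powr (s - 1) * exp (- t)) \<partial>lborel)"
    by (intro nn_integral_of_has_integral[symmetric]) auto
  also have "\<dots> = (\<integral>\<^sup>+t\<in>{0<..}. ennreal (\<bar>c\<bar> * ((c * t) powr (s - 1) * exp (- (c * t)))) \<partial>lborel)"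
  proof (rule nn_integral_change_of_variables)
    show "bij_betw ((*) c) {0<..} {0<..}"
      by (rule bij_betw_byWitness[where f' = "\<lambda>x. x / c"]) (use c in auto)
  qed (use meas in \<open>auto intro!: derivative_eq_intros\<close>)
  also have "\<dots> = (\<integral>\<^sup>+t. ennreal (c powr s) * (ennreal (t powr (s - 1) * exp (- c * t)) * indicator {0<..} t) \<partial>lborel)"
  proof (intro nn_integral_cong)
    fix t :: real
    have "\<bar>c\<bar> * ((c * t) powr (s - 1) * exp (- (c * t))) = c powr s * (t powr (s - 1) * exp (- c * t))" if "t > 0"
      using that c powr_add[of c 1 "s - 1"] by (simp add: powr_mult)
    hence "ennreal (\<bar>c\<bar> * ((c * t) powr (s - 1) * exp (- (c * t))))
        = ennreal (c powr s) * ennreal (t powr (s - 1) * exp (- c * t))" if "t > 0"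
      using that by (simp only: ennreal_mult' powr_ge_zero)
    thus "ennreal (\<bar>c\<bar> * ((c * t) powr (s - 1) * exp (- (c * t)))) * indicator {0<..} t
        = ennreal (c powr s) * (ennreal (t powr (s - 1) * exp (- c * t)) * indicator {0<..} t)"
      by (auto split: split_indicator)
  qed
  also have "\<dots> = ennreal (c powr s) * (\<integral>\<^sup>+t\<in>{0<..}. ennreal (t powr (s - 1) * exp (- c * t)) \<partial>lborel)"
    by (intro nn_integral_cmult) simp
  finally have eq: "ennreal (Gamma s)
      = ennreal (c powr s) * (\<integral>\<^sup>+t\<in>{0<..}. ennreal (t powr (s - 1) * exp (- c * t)) \<partial>lborel)" .
  \<comment> \<open>The scaling produced the factor \<open>c powr s\<close>; multiplying by its
    inverse isolates the integral.\<close>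
  have "ennreal (c powr (-s)) * ennreal (Gamma s)
      = ennreal (c powr (-s) * c powr s) * (\<integral>\<^sup>+t\<in>{0<..}. ennreal (t powr (s - 1) * exp (- c * t)) \<partial>lborel)"
    unfolding eq by (simp add: ennreal_mult' mult.assoc)
  also have "c powr (-s) * c powr s = 1"
    using c by (simp flip: powr_add)
  finally show ?thesis
    using s by (simp add: ennreal_mult' mult.commute)
qed

lemma nn_integral_powr_01:
  assumes "p > (0::real)"
  shows "(\<integral>\<^sup>+t\<in>{0<..1}. ennreal (t powr (p - 1)) \<partial>lborel) = ennreal (1 / p)"
proof (rule nn_integral_of_has_integral)
  have "((\<lambda>x. x powr (p - 1)) has_integral 1 / p) {0..1}"
    using has_integral_powr_from_0[of "p - 1" 1] assms by simp
  thus "((\<lambda>x. x powr (p - 1)) has_integral 1 / p) {0<..1}"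
  proof (rule has_integral_spike_set')
    show "negligible {x \<in> {0..1} - {0<..1}. x powr (p - 1) \<noteq> 0}"
      by (rule negligible_subset[of "{0}"]) auto
  qed auto
qed auto

lemma nn_integral_powr_1_inf:
  assumes "p > (0::real)"
  shows "(\<integral>\<^sup>+t\<in>{1<..}. ennreal (t powr (- p - 1)) \<partial>lborel) = ennreal (1 / p)"
proof (rule nn_integral_of_has_integral)
  have "((\<lambda>x. x powr (- p - 1)) has_integral 1 / p) {1..}"
    using has_integral_powr_to_inf[of "- p - 1" 1] assms by simp
  thus "((\<lambda>x. x powr (- p - 1)) has_integral 1 / p) {1<..}"
  proof (rule has_integral_spike_set')
    show "negligible {x \<in> {1..} - {1<..}. x powr (- p - 1) \<noteq> 0}"
      by (rule negligible_subset[of "{1}"]) auto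
  qed auto
qed auto

section \<open>Powers against rational functions\<close>

lemma Gamma_reflection_real:
  assumes "0 < p" "p < (1::real)"
  shows "Gamma p * Gamma (1 - p) = pi / sin (pi * p)"
proof -
  have "of_real (Gamma p * Gamma (1 - p)) = Gamma (complex_of_real p) * Gamma (1 - complex_of_real p)"
    using assms by (simp flip: Gamma_complex_of_real)
  also have "\<dots> = of_real (pi / sin (pi * p))"
    by (simp add: Gamma_reflection_complex flip: sin_of_real)
  finally show ?thesis by (simp only: of_real_eq_iff)
qed

text \<open>Writing 1 / (u + c) as the integral of e^(-(u + c) y) over y > 0 and interchanging the
  integrals leaves two Gamma integrals, whose constants multiply to the reflection formula.\<close>

lemma nn_integral_powr_over_linear:
  assumes p: "0 < p" "p < (1::real)" and c: "c > 0"
  shows "(\<integral>\<^sup>+u\<in>{0<..}. ennreal (u powr (p - 1) / (u + c)) \<partial>lborel) = ennreal (pi / sin (pi * p) * c powr (p - 1))"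
proof -
  \<comment> \<open>The indicators sit inside the integrand, so that Tonelli's theorem applies on
    the whole plane.\<close>
  define f :: "real \<Rightarrow> real \<Rightarrow> ennreal" where
    "f = (\<lambda>u y. ennreal (u powr (p - 1) * exp (- y * u) * exp (- c * y)) * indicator {0<..} u * indicator {0<..} y)"
  have "(\<integral>\<^sup>+u\<in>{0<..}. ennreal (u powr (p - 1) / (u + c)) \<partial>lborel) = (\<integral>\<^sup>+u. \<integral>\<^sup>+y. f u y \<partial>lborel \<partial>lborel)"
  proof (intro nn_integral_cong)
    fix u :: real
    have "(\<integral>\<^sup>+y. f u y \<partial>lborel) = ennreal (u powr (p - 1) / (u + c))" if u: "u > 0"
    proof -
      have "(\<integral>\<^sup>+y. f u y \<partial>lborel)
          = (\<integral>\<^sup>+y. ennreal (u powr (p - 1)) * (ennreal (y powr (1 - 1) * exp (- (u + c) * y)) * indicator {0<..} y) \<partial>lborel)"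
      proof (intro nn_integral_cong)
        fix y :: real
        have "exp (- y * u) * exp (- c * y) = exp (- (u + c) * y)"
          by (simp add: algebra_simps flip: exp_add)
        thus "f u y = ennreal (u powr (p - 1)) * (ennreal (y powr (1 - 1) * exp (- (u + c) * y)) * indicator {0<..} y)"
          using u unfolding f_def by (auto simp: mult.assoc ennreal_mult' split: split_indicator)
      qed
      also have "\<dots> = ennreal (u powr (p - 1)) * ennreal (Gamma 1 * (u + c) powr (-1))"
        by (subst nn_integral_cmult, simp, subst nn_integral_Gamma) (use u c in auto)
      also have "\<dots> = ennreal (u powr (p - 1) / (u + c))"
        using u c by (simp add: powr_minus divide_inverse flip: ennreal_mult')
      finally show ?thesis .
    qed
    moreover have "(\<integral>\<^sup>+y. f u y \<partial>lborel) = 0" if "\<not> u > 0"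
      using that by (simp add: f_def)
    ultimately show "ennreal (u powr (p - 1) / (u + c)) * indicator {0<..} u = (\<integral>\<^sup>+y. f u y \<partial>lborel)"
      by (auto split: split_indicator)
  qed
  also have "\<dots> = (\<integral>\<^sup>+y. \<integral>\<^sup>+u. f u y \<partial>lborel \<partial>lborel)"
    by (rule lborel_pair.Fubini'[symmetric]) (simp add: f_def)
  also have "\<dots> = (\<integral>\<^sup>+y. ennreal (Gamma p) * (ennreal (y powr (1 - p - 1) * exp (- c * y)) * indicator {0<..} y) \<partial>lborel)"
  proof (intro nn_integral_cong)
    fix y :: real
    have "(\<integral>\<^sup>+u. f u y \<partial>lborel) = ennreal (Gamma p) * (ennreal (y powr (1 - p - 1) * exp (- c * y)))" if y: "y > 0"
    proof -
      have "(\<integral>\<^sup>+u. f u y \<partial>lborel)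
          = (\<integral>\<^sup>+u. ennreal (exp (- c * y)) * (ennreal (u powr (p - 1) * exp (- y * u)) * indicator {0<..} u) \<partial>lborel)"
        using y by (intro nn_integral_cong) (auto simp: f_def ennreal_mult' mult_ac split: split_indicator)
      also have "\<dots> = ennreal (exp (- c * y)) * ennreal (Gamma p * y powr (- p))"
        unfolding nn_integral_Gamma[OF p(1) y, symmetric] by (rule nn_integral_cmult) simp
      also have "\<dots> = ennreal (Gamma p) * (ennreal (y powr (1 - p - 1) * exp (- c * y)))"
        using p by (simp add: ennreal_mult' mult_ac)
      finally show ?thesis .
    qed
    moreover have "(\<integral>\<^sup>+u. f u y \<partial>lborel) = 0" if "\<not> y > 0"
      using that by (simp add: f_def)
    ultimately show "(\<integral>\<^sup>+u. f u y \<partial>lborel)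
        = ennreal (Gamma p) * (ennreal (y powr (1 - p - 1) * exp (- c * y)) * indicator {0<..} y)"
      by (auto split: split_indicator)
  qed
  also have "\<dots> = ennreal (Gamma p) * ennreal (Gamma (1 - p) * c powr (- (1 - p)))"
    using p by (subst nn_integral_cmult, simp, subst nn_integral_Gamma[OF _ c]) auto
  also have "\<dots> = ennreal (Gamma p * Gamma (1 - p) * c powr (p - 1))"
    using p by (simp add: ennreal_mult' mult_ac)
  finally show ?thesis
    using p by (simp add: Gamma_reflection_real)
qed

text \<open>The substitution u = t^2 reduces this to the linear denominator u + a^2 with p = (s + 1)
  / 2, and sin (pi p) = cos (pi s / 2).\<close>

lemma nn_integral_powr_over_square:
  assumes s: "-1 < s" "s < (1::real)" and a: "a > 0"
  shows "(\<integral>\<^sup>+t\<in>{0<..}. ennreal (t powr s / (t\<^sup>2 + a\<^sup>2)) \<partial>lborel)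
           = ennreal (pi / (2 * cos (pi * s / 2)) * a powr (s - 1))"
proof -
  define p where "p = (s + 1) / 2"
  have p: "0 < p" "p < 1" using s by (auto simp: p_def)
  have square_powr: "(t\<^sup>2) powr (p - 1) = t powr (s - 1)" if "t > 0" for t
  proof -
    have "(t\<^sup>2) powr (p - 1) = t powr (2 * (p - 1))" using that by (simp add: powr_powr flip: powr_numeral)
    also have "2 * (p - 1) = s - 1" by (simp add: p_def field_simps)
    finally show ?thesis .
  qed
  have "pi * p = pi * s / 2 + pi / 2" by (simp add: p_def field_simps)
  hence sin_p: "sin (pi * p) = cos (pi * s / 2)" by (simp add: sin_add)
  have "ennreal (1 / 2 * (pi / sin (pi * p) * (a\<^sup>2) powr (p - 1)))
      = ennreal (1 / 2) * (\<integral>\<^sup>+u\<in>{0<..}. ennreal (u powr (p - 1) / (u + a\<^sup>2)) \<partial>lborel)"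
    unfolding nn_integral_powr_over_linear[OF p zero_less_power[OF a]] by (rule ennreal_mult') simp
  also have "\<dots> = (\<integral>\<^sup>+u\<in>{0<..}. ennreal (1 / 2 * (u powr (p - 1) / (u + a\<^sup>2))) \<partial>lborel)"
    by (intro nn_set_integral_cmult[symmetric]) auto
  also have "\<dots> = (\<integral>\<^sup>+t\<in>{0<..}. ennreal (\<bar>2 * t\<bar> * (1 / 2 * ((t\<^sup>2) powr (p - 1) / (t\<^sup>2 + a\<^sup>2)))) \<partial>lborel)"
  proof (rule nn_integral_change_of_variables)
    show "bij_betw (\<lambda>t::real. t\<^sup>2) {0<..} {0<..}"
      by (rule bij_betw_byWitness[where f' = sqrt]) auto
  qed (auto intro!: derivative_eq_intros simp: set_borel_measurable_def)
  also have "\<dots> = (\<integral>\<^sup>+t\<in>{0<..}. ennreal (t powr s / (t\<^sup>2 + a\<^sup>2)) \<partial>lborel)"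
  proof (intro nn_integral_cong)
    fix t :: real
    have "\<bar>2 * t\<bar> * (1 / 2 * ((t\<^sup>2) powr (p - 1) / (t\<^sup>2 + a\<^sup>2))) = t powr s / (t\<^sup>2 + a\<^sup>2)" if "t > 0"
    proof -
      have "(t\<^sup>2) powr (p - 1) = t powr (s - 1)"
        using that by (simp add: square_powr)
      moreover have "t * t powr (s - 1) = t powr s"
        using that by (simp add: powr_mult_base)
      moreover have "\<bar>2 * t\<bar> * (1 / 2 * (X / Y)) = t * X / Y" for X Y
        using that by simp
      ultimately show ?thesis by metis
    qed
    thus "ennreal (\<bar>2 * t\<bar> * (1 / 2 * ((t\<^sup>2) powr (p - 1) / (t\<^sup>2 + a\<^sup>2)))) * indicator {0<..} t
        = ennreal (t powr s / (t\<^sup>2 + a\<^sup>2)) * indicator {0<..} t"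
      by (auto split: split_indicator)
  qed
  also have "(a\<^sup>2) powr (p - 1) = a powr (s - 1)"
    using a by (simp add: square_powr)
  finally show ?thesis by (simp add: sin_p)
qed

text \<open>Partial fractions in t^2: (a^2 - b^2) t^2 / ((t^2 + a^2) (t^2 + b^2)) is the difference
  of a^2 / (t^2 + a^2) and b^2 / (t^2 + b^2). For b < a all parts are nonnegative, so the difference
  can be stated as the sum \<open>f t + h b t = h a t\<close>.\<close>

lemma nn_integral_powr_over_two_squares:
  assumes a: "a > 0" and b: "b > 0" and ab: "b < (a::real)"
  shows "(\<integral>\<^sup>+t\<in>{0<..}. ennreal (t powr (3/2) / ((t\<^sup>2 + a\<^sup>2) * (t\<^sup>2 + b\<^sup>2))) \<partial>lborel)
           = ennreal (pi / (sqrt 2 * (sqrt a + sqrt b) * (a + b)))"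
proof -
  define f where "f = (\<lambda>t::real. t powr (3/2) / ((t\<^sup>2 + a\<^sup>2) * (t\<^sup>2 + b\<^sup>2)))"
  define h where "h = (\<lambda>c t. c\<^sup>2 / (a\<^sup>2 - b\<^sup>2) * (t powr (-1/2) / (t\<^sup>2 + c\<^sup>2)))"
  have ab2: "a\<^sup>2 - b\<^sup>2 > 0" using assms by (simp add: power_strict_mono)
  have h_int: "(\<integral>\<^sup>+t\<in>{0<..}. ennreal (h c t) \<partial>lborel) = ennreal (pi / sqrt 2 * (sqrt c / (a\<^sup>2 - b\<^sup>2)))"
    if c: "c > 0" for c
  proof -
    have "(\<integral>\<^sup>+t\<in>{0<..}. ennreal (h c t) \<partial>lborel)
        = ennreal (c\<^sup>2 / (a\<^sup>2 - b\<^sup>2)) * (\<integral>\<^sup>+t\<in>{0<..}. ennreal (t powr (-1/2) / (t\<^sup>2 + c\<^sup>2)) \<partial>lborel)"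
      using ab2 unfolding h_def by (intro nn_set_integral_cmult) auto
    also have "\<dots> = ennreal (c\<^sup>2 / (a\<^sup>2 - b\<^sup>2) * (pi / (2 * cos (pi * (-1/2) / 2)) * c powr (-1/2 - 1)))"
      by (subst nn_integral_powr_over_square[OF _ _ c]) (simp, simp, rule ennreal_mult'[symmetric], use ab2 in simp)
    also have "cos (pi * (-1/2) / 2) = sqrt 2 / 2"
      by (simp add: cos_45)
    also have "c\<^sup>2 / (a\<^sup>2 - b\<^sup>2) * (pi / (2 * (sqrt 2 / 2)) * c powr (-1/2 - 1)) = pi / sqrt 2 * (sqrt c / (a\<^sup>2 - b\<^sup>2))"
    proof -
      have "c\<^sup>2 * c powr (-1/2 - 1) = c powr 2 * c powr (-1/2 - 1)" using c by simp
      also have "\<dots> = c powr (1/2)" unfolding powr_add[symmetric] by simp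
      also have "\<dots> = sqrt c" using c by (simp add: powr_half_sqrt)
      finally show ?thesis using ab2 by (simp add: field_simps)
    qed
    finally show ?thesis .
  qed
  have f_h: "f t + h b t = h a t" if t: "t > 0" for t
  proof -
    have pos: "t\<^sup>2 + a\<^sup>2 > 0" "t\<^sup>2 + b\<^sup>2 > 0" using t by (auto intro: add_pos_nonneg)
    have "t powr (3/2) = t\<^sup>2 * t powr (-1/2)"
      using t powr_add[of t 2 "-1/2"] by simp
    thus ?thesis
      using pos ab2 unfolding f_def h_def by (simp add: divide_simps) (simp add: algebra_simps)
  qed
  have "(\<integral>\<^sup>+t\<in>{0<..}. ennreal (f t) \<partial>lborel) + ennreal (pi / sqrt 2 * (sqrt b / (a\<^sup>2 - b\<^sup>2)))
      = (\<integral>\<^sup>+t\<in>{0<..}. ennreal (f t) \<partial>lborel) + (\<integral>\<^sup>+t\<in>{0<..}. ennreal (h b t) \<partial>lborel)"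
    by (simp add: h_int b)
  also have "\<dots> = (\<integral>\<^sup>+t. ennreal (f t) * indicator {0<..} t + ennreal (h b t) * indicator {0<..} t \<partial>lborel)"
    by (rule nn_integral_add[symmetric]) (simp_all add: f_def h_def)
  also have "\<dots> = (\<integral>\<^sup>+t\<in>{0<..}. ennreal (h a t) \<partial>lborel)"
  proof (intro nn_integral_cong)
    fix t :: real
    have "0 \<le> f t" "0 \<le> h b t" using ab2 by (simp_all add: f_def h_def)
    thus "ennreal (f t) * indicator {0<..} t + ennreal (h b t) * indicator {0<..} t = ennreal (h a t) * indicator {0<..} t"
      using f_h[of t] by (auto split: split_indicator simp flip: ennreal_plus)
  qed
  also have "\<dots> = ennreal (pi / sqrt 2 * (sqrt a / (a\<^sup>2 - b\<^sup>2)))"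
    by (simp add: h_int a)
  finally have "(\<integral>\<^sup>+t\<in>{0<..}. ennreal (f t) \<partial>lborel)
      = ennreal (pi / sqrt 2 * (sqrt a / (a\<^sup>2 - b\<^sup>2))) - ennreal (pi / sqrt 2 * (sqrt b / (a\<^sup>2 - b\<^sup>2)))"
    by (metis ennreal_add_diff_cancel_right ennreal_neq_top)
  also have "\<dots> = ennreal (pi / sqrt 2 * (sqrt a / (a\<^sup>2 - b\<^sup>2)) - pi / sqrt 2 * (sqrt b / (a\<^sup>2 - b\<^sup>2)))"
    using ab2 b by (subst ennreal_minus) auto
  \<comment> \<open>The factor sqrt a - sqrt b cancels, which leaves a closed form without a
    singularity at a = b.\<close>
  also have "pi / sqrt 2 * (sqrt a / (a\<^sup>2 - b\<^sup>2)) - pi / sqrt 2 * (sqrt b / (a\<^sup>2 - b\<^sup>2))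
      = pi / (sqrt 2 * (sqrt a + sqrt b) * (a + b))"
  proof -
    have "a\<^sup>2 - b\<^sup>2 = (sqrt a - sqrt b) * ((sqrt a + sqrt b) * (a + b))"
    proof -
      have "a - b = (sqrt a - sqrt b) * (sqrt a + sqrt b)"
        using a b by (simp add: algebra_simps)
      moreover have "a\<^sup>2 - b\<^sup>2 = (a - b) * (a + b)" by (simp add: algebra_simps power2_eq_square)
      ultimately show ?thesis by simp
    qed
    moreover have "sqrt a - sqrt b > 0" using ab by simp
    ultimately have "(sqrt a - sqrt b) / (a\<^sup>2 - b\<^sup>2) = 1 / ((sqrt a + sqrt b) * (a + b))" by simp
    hence "pi / sqrt 2 * (sqrt a / (a\<^sup>2 - b\<^sup>2)) - pi / sqrt 2 * (sqrt b / (a\<^sup>2 - b\<^sup>2))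
        = pi / sqrt 2 * (1 / ((sqrt a + sqrt b) * (a + b)))"
      by (simp only: diff_divide_distrib flip: right_diff_distrib)
    thus ?thesis by (simp add: mult.assoc)
  qed
  finally show ?thesis by (simp add: f_def)
qed

lemma nn_integral_gauss: "(\<integral>\<^sup>+v. ennreal (exp (- v\<^sup>2)) \<partial>lborel) = ennreal (sqrt pi)"
proof -
  have "has_bochner_integral lborel (\<lambda>v::real. exp (- v\<^sup>2)) (2 * (sqrt pi / 2))"
    using has_bochner_integral_even_function[OF gaussian_moment_0] by simp
  thus ?thesis
    by (simp add: has_bochner_integral_iff nn_integral_eq_integral)
qed

lemma nn_integral_inversion:
  fixes f :: "real \<Rightarrow> real"
  assumes z: "z > 0" and nonneg: "\<And>x. x > 0 \<Longrightarrow> 0 \<le> f x" and [measurable]: "f \<in> borel_measurable borel"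
  shows "(\<integral>\<^sup>+t\<in>{0<..}. ennreal (f t) \<partial>lborel) = (\<integral>\<^sup>+t\<in>{0<..}. ennreal (z / t\<^sup>2 * f (z / t)) \<partial>lborel)"
proof -
  have "(\<integral>\<^sup>+t\<in>{0<..}. ennreal (f t) \<partial>lborel) = (\<integral>\<^sup>+t\<in>{0<..}. ennreal (\<bar>- z / t\<^sup>2\<bar> * f (z / t)) \<partial>lborel)"
  proof (rule nn_integral_change_of_variables)
    show "bij_betw (\<lambda>t. z / t) {0<..} {0<..}"
      by (rule bij_betw_byWitness[where f' = "\<lambda>t. z / t"]) (use z in auto)
    show "((\<lambda>t. z / t) has_field_derivative - z / x\<^sup>2) (at x)" if "x \<in> {0<..}" for x
      using that by (auto intro!: derivative_eq_intros simp: power2_eq_square)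
  qed (use nonneg in \<open>auto simp: set_borel_measurable_def\<close>)
  thus ?thesis using z by simp
qed

text \<open>The substitution $v = \sqrt{at} - \sqrt{b/t}$ maps the half-line onto the real line; its
  derivative consists of two summands, which the inversion $t \mapsto b/(at)$ interchanges.\<close>

lemma nn_integral_exp_reciprocal:
  assumes a: "a > 0" and b: "b > (0::real)"
  shows "(\<integral>\<^sup>+t\<in>{0<..}. ennreal (t powr (-1/2) * exp (- a * t - b / t)) \<partial>lborel)
           = ennreal (sqrt (pi / a) * exp (- 2 * sqrt (a * b)))"
proof -
  define E where "E = (\<lambda>t. exp (- a * t - b / t))"
  define g where "g = (\<lambda>t. sqrt (a * t) - sqrt (b / t))"
  define g' where "g' = (\<lambda>t. sqrt a / 2 * t powr (-1/2) + sqrt b / 2 * t powr (-3/2))"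
  define P where "P = (\<integral>\<^sup>+t\<in>{0<..}. ennreal (t powr (-1/2) * E t) \<partial>lborel)"
  define Q where "Q = (\<integral>\<^sup>+t\<in>{0<..}. ennreal (t powr (-3/2) * E t) \<partial>lborel)"
  have [measurable]: "E \<in> borel_measurable borel" "g \<in> borel_measurable borel" "g' \<in> borel_measurable borel"
    by (simp_all add: E_def g_def g'_def)
  have E_pos: "E t > 0" for t by (simp add: E_def)
  \<comment> \<open>The powers t^(-1/2) and t^(-3/2) come from the two summands of
    \<open>g'\<close>; this relation makes their contributions to the Gaussian integral
    equal.\<close>
  have PQ: "P = ennreal (sqrt b / sqrt a) * Q"
  proof -
    have "P = (\<integral>\<^sup>+t\<in>{0<..}. ennreal ((b / a) / t\<^sup>2 * ((b / a / t) powr (-1/2) * E (b / a / t))) \<partial>lborel)"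
      unfolding P_def using a b E_pos by (intro nn_integral_inversion) (auto intro: less_imp_le)
    also have "\<dots> = (\<integral>\<^sup>+t\<in>{0<..}. ennreal (sqrt b / sqrt a * (t powr (-3/2) * E t)) \<partial>lborel)"
    proof (intro nn_integral_cong)
      fix t :: real
      have "(b / a) / t\<^sup>2 * ((b / a / t) powr (-1/2) * E (b / a / t)) = sqrt b / sqrt a * (t powr (-3/2) * E t)"
        if t: "t > 0"
      proof -
        have "E (b / a / t) = E t"
          using a b t by (simp add: E_def field_simps)
        moreover have "(b / a) / t\<^sup>2 * (b / a / t) powr (-1/2) = (b / a) powr (1/2) * t powr (-3/2)"
        proof -
          have "(b / a / t) powr (-1/2) = (b / a) powr (-1/2) * t powr (1/2)"
            using a b t by (simp add: powr_divide powr_minus_divide powr_mult)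
          moreover have "(b / a) * (b / a) powr (-1/2) = (b / a) powr (1/2)"
            using a b powr_mult_base[of "b / a" "-1/2"] by simp
          moreover have "t powr (1/2) / t\<^sup>2 = t powr (-3/2)"
            using t powr_diff[of t "1/2" 2] by simp
          moreover have "(b / a) / t\<^sup>2 * (X * Y) = ((b / a) * X) * (Y / t\<^sup>2)" for X Y by simp
          ultimately show ?thesis by metis
        qed
        ultimately have "(b / a) / t\<^sup>2 * ((b / a / t) powr (-1/2) * E (b / a / t))
            = (b / a) powr (1/2) * t powr (-3/2) * E t"
          by (metis mult.assoc)
        thus ?thesis using a b by (simp add: powr_half_sqrt real_sqrt_divide)
      qed
      thus "ennreal ((b / a) / t\<^sup>2 * ((b / a / t) powr (-1/2) * E (b / a / t))) * indicator {0<..} t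
          = ennreal (sqrt b / sqrt a * (t powr (-3/2) * E t)) * indicator {0<..} t"
        by (auto split: split_indicator)
    qed
    also have "\<dots> = ennreal (sqrt b / sqrt a) * Q"
      unfolding Q_def using a b by (intro nn_set_integral_cmult) auto
    finally show ?thesis .
  qed
  have "ennreal (sqrt pi) = (\<integral>\<^sup>+v\<in>UNIV. ennreal (exp (- v\<^sup>2)) \<partial>lborel)"
    using nn_integral_gauss by simp
  also have "\<dots> = (\<integral>\<^sup>+t\<in>{0<..}. ennreal (\<bar>g' t\<bar> * exp (- (g t)\<^sup>2)) \<partial>lborel)"
  proof (rule nn_integral_change_of_variables)
    show "(g has_field_derivative g' x) (at x)" if "x \<in> {0<..}" for x
    proof -
      from that have x: "x > 0" by simp
      have "((\<lambda>t. sqrt a * t powr (1/2) - sqrt b * t powr (-1/2)) has_field_derivative g' x) (at x)"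
        using x by (auto intro!: derivative_eq_intros simp: g'_def algebra_simps)
      thus ?thesis
      proof (rule has_field_derivative_transform_within_open[of _ _ _ "{0<..}"])
        show "sqrt a * t powr (1/2) - sqrt b * t powr (-1/2) = g t" if "t \<in> {0<..}" for t
          using that by (simp add: g_def real_sqrt_mult real_sqrt_divide powr_half_sqrt powr_minus_divide)
      qed (use x in auto)
    qed
    show "bij_betw g {0<..} UNIV"
    proof (rule bij_betwI')
      fix x y :: real assume xy: "x \<in> {0<..}" "y \<in> {0<..}"
      have less: "g x < g y" if "0 < x" "x < y" for x y
      proof -
        have "sqrt (a * x) < sqrt (a * y)" using that a by simp
        moreover have "b / y < b / x" using that b by (simp add: divide_strict_left_mono)
        hence "sqrt (b / y) < sqrt (b / x)" by simp
        ultimately show ?thesis unfolding g_def by linarith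
      qed
      show "g x = g y \<longleftrightarrow> x = y"
        using less[of x y] less[of y x] xy by (cases x y rule: linorder_cases) auto
    next
      fix v :: real
      \<comment> \<open>\<open>r\<close> is the square root of the preimage of v: v = g (r^2) means
        sqrt a * r - sqrt b / r = v, and this is the positive root of the resulting
        quadratic.\<close>
      define r where "r = (v + sqrt (v\<^sup>2 + 4 * sqrt a * sqrt b)) / (2 * sqrt a)"
      have "sqrt (v\<^sup>2) < sqrt (v\<^sup>2 + 4 * sqrt a * sqrt b)"
        using a b by (intro real_sqrt_less_mono) simp
      hence "r > 0" using a unfolding r_def by (intro divide_pos_pos) auto
      have sq: "(sqrt (v\<^sup>2 + 4 * sqrt a * sqrt b))\<^sup>2 = v\<^sup>2 + 4 * sqrt a * sqrt b"
        using a b by simp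
      have "2 * sqrt a * r - v = sqrt (v\<^sup>2 + 4 * sqrt a * sqrt b)"
        using a by (simp add: r_def)
      hence "(2 * sqrt a * r - v)\<^sup>2 = v\<^sup>2 + 4 * sqrt a * sqrt b" using sq by simp
      hence "sqrt a * (sqrt a * r\<^sup>2 - v * r - sqrt b) = 0"
        by algebra
      hence "sqrt a * r\<^sup>2 - v * r - sqrt b = 0" using a by simp
      hence "sqrt a * r - sqrt b / r = v"
        using \<open>r > 0\<close> by (simp add: field_simps power2_eq_square)
      hence "v = g (r\<^sup>2)" using \<open>r > 0\<close> a by (simp add: g_def real_sqrt_mult real_sqrt_divide)
      thus "\<exists>x\<in>{0<..}. v = g x" using \<open>r > 0\<close> by (intro bexI[of _ "r\<^sup>2"]) auto
    qed auto
  qed (auto simp: set_borel_measurable_def)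
  also have "\<dots> = (\<integral>\<^sup>+t. (ennreal (exp (2 * sqrt (a * b)) * (sqrt a / 2) * (t powr (-1/2) * E t)) * indicator {0<..} t
          + ennreal (exp (2 * sqrt (a * b)) * (sqrt b / 2) * (t powr (-3/2) * E t)) * indicator {0<..} t) \<partial>lborel)"
  proof (intro nn_integral_cong)
    fix t :: real
    have "\<bar>g' t\<bar> * exp (- (g t)\<^sup>2) = exp (2 * sqrt (a * b)) * (sqrt a / 2) * (t powr (-1/2) * E t)
        + exp (2 * sqrt (a * b)) * (sqrt b / 2) * (t powr (-3/2) * E t)" if t: "t > 0"
    proof -
      \<comment> \<open>Since (g t)^2 = a t + b / t - 2 sqrt (a b), the Gaussian is
        \<open>E t\<close> up to a constant factor.\<close>
      have "sqrt (a * t) * sqrt (b / t) = sqrt (a * b)"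
        using t by (simp flip: real_sqrt_mult)
      hence "- (g t)\<^sup>2 = 2 * sqrt (a * b) + (- a * t - b / t)"
        using a b t by (simp add: g_def power2_diff)
      hence "exp (- (g t)\<^sup>2) = exp (2 * sqrt (a * b)) * E t"
        unfolding E_def by (simp only: exp_add)
      moreover have "g' t \<ge> 0" using a b by (simp add: g'_def)
      ultimately show ?thesis by (simp add: g'_def algebra_simps)
    qed
    thus "ennreal (\<bar>g' t\<bar> * exp (- (g t)\<^sup>2)) * indicator {0<..} t
      = ennreal (exp (2 * sqrt (a * b)) * (sqrt a / 2) * (t powr (-1/2) * E t)) * indicator {0<..} t
          + ennreal (exp (2 * sqrt (a * b)) * (sqrt b / 2) * (t powr (-3/2) * E t)) * indicator {0<..} t"
      using a b E_pos[of t] by (auto split: split_indicator simp flip: ennreal_plus)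
  qed
  also have "\<dots> = (\<integral>\<^sup>+t\<in>{0<..}. ennreal (exp (2 * sqrt (a * b)) * (sqrt a / 2) * (t powr (-1/2) * E t)) \<partial>lborel)
      + (\<integral>\<^sup>+t\<in>{0<..}. ennreal (exp (2 * sqrt (a * b)) * (sqrt b / 2) * (t powr (-3/2) * E t)) \<partial>lborel)"
    by (rule nn_integral_add) simp_all
  also have "\<dots> = ennreal (exp (2 * sqrt (a * b)) * (sqrt a / 2)) * P
                + ennreal (exp (2 * sqrt (a * b)) * (sqrt b / 2)) * Q"
    unfolding P_def Q_def using a b by (intro arg_cong2[where f = "(+)"] nn_set_integral_cmult) auto
  also have "ennreal (exp (2 * sqrt (a * b)) * (sqrt b / 2)) * Q = ennreal (exp (2 * sqrt (a * b)) * (sqrt a / 2)) * P"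
  proof -
    have "exp (2 * sqrt (a * b)) * (sqrt b / 2) = exp (2 * sqrt (a * b)) * (sqrt a / 2) * (sqrt b / sqrt a)"
      using a by simp
    thus ?thesis using a b by (simp only: PQ ennreal_mult' mult.assoc[symmetric]) (simp add: mult.assoc flip: ennreal_mult')
  qed
  also have "ennreal (exp (2 * sqrt (a * b)) * (sqrt a / 2)) * P + ennreal (exp (2 * sqrt (a * b)) * (sqrt a / 2)) * P
      = ennreal (exp (2 * sqrt (a * b)) * sqrt a) * P"
    using a unfolding distrib_right[symmetric] by (subst ennreal_plus[symmetric]) (auto simp: mult.commute)
  finally have sqrt_pi: "ennreal (sqrt pi) = ennreal (exp (2 * sqrt (a * b)) * sqrt a) * P" .
  have "ennreal (exp (- 2 * sqrt (a * b)) / sqrt a) * ennreal (sqrt pi)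
      = ennreal (exp (- 2 * sqrt (a * b)) / sqrt a * (exp (2 * sqrt (a * b)) * sqrt a)) * P"
    unfolding sqrt_pi by (subst (2) ennreal_mult', use a in simp, rule mult.assoc[symmetric])
  also have "exp (- 2 * sqrt (a * b)) / sqrt a * (exp (2 * sqrt (a * b)) * sqrt a) = 1"
    using a by (simp flip: exp_add)
  finally have "P = ennreal (exp (- 2 * sqrt (a * b)) / sqrt a) * ennreal (sqrt pi)"
    by simp
  also have "\<dots> = ennreal (exp (- 2 * sqrt (a * b)) / sqrt a * sqrt pi)"
    by (rule ennreal_mult'[symmetric]) (use a in simp)
  also have "exp (- 2 * sqrt (a * b)) / sqrt a * sqrt pi = sqrt (pi / a) * exp (- 2 * sqrt (a * b))"
    by (simp add: real_sqrt_divide)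
  finally show ?thesis by (simp add: P_def E_def)
qed

section \<open>Mellin transforms of the Bose kernel\<close>

lemma nn_set_integral_add:
  assumes "\<And>t. t \<in> S \<Longrightarrow> 0 \<le> f t" "\<And>t. t \<in> S \<Longrightarrow> 0 \<le> g t"
    and "(\<lambda>t. ennreal (f t) * indicator S t) \<in> borel_measurable M"
    and "(\<lambda>t. ennreal (g t) * indicator S t) \<in> borel_measurable M"
  shows "(\<integral>\<^sup>+t\<in>S. ennreal (f t + g t) \<partial>M) = (\<integral>\<^sup>+t\<in>S. ennreal (f t) \<partial>M) + (\<integral>\<^sup>+t\<in>S. ennreal (g t) \<partial>M)"
proof -
  have "(\<integral>\<^sup>+t\<in>S. ennreal (f t + g t) \<partial>M)
      = (\<integral>\<^sup>+t. ennreal (f t) * indicator S t + ennreal (g t) * indicator S t \<partial>M)"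
    using assms(1,2) by (intro nn_integral_cong) (auto split: split_indicator)
  thus ?thesis using nn_integral_add[OF assms(3,4)] by simp
qed

text \<open>Monotone convergence, in the form in which the expansions of \<open>bose\<close> and
  \<open>bose_reg\<close> are used under an integral.\<close>

lemma nn_set_integral_sums:
  fixes f :: "nat \<Rightarrow> 'a \<Rightarrow> real"
  assumes "\<And>k t. t \<in> S \<Longrightarrow> 0 \<le> f k t" "\<And>t. t \<in> S \<Longrightarrow> (\<lambda>k. f k t) sums g t"
    and "\<And>k. (\<lambda>t. ennreal (f k t) * indicator S t) \<in> borel_measurable M"
  shows "(\<integral>\<^sup>+t\<in>S. ennreal (g t) \<partial>M) = (\<Sum>k. \<integral>\<^sup>+t\<in>S. ennreal (f k t) \<partial>M)"
proof -
  have "(\<integral>\<^sup>+t\<in>S. ennreal (g t) \<partial>M) = (\<integral>\<^sup>+t. (\<Sum>k. ennreal (f k t) * indicator S t) \<partial>M)"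
  proof (intro nn_integral_cong)
    fix t
    show "ennreal (g t) * indicator S t = (\<Sum>k. ennreal (f k t) * indicator S t)"
    proof (cases "t \<in> S")
      case True
      hence "(\<Sum>k. ennreal (f k t)) = ennreal (g t)"
        by (intro suminf_ennreal_eq assms)
      thus ?thesis using True by simp
    qed simp
  qed
  thus ?thesis using nn_integral_suminf[of "\<lambda>k t. ennreal (f k t) * indicator S t" M, OF assms(3)] by simp
qed

lemma nn_set_integral_cong:
  assumes "\<And>t. t \<in> S \<Longrightarrow> f t = g t"
  shows "(\<integral>\<^sup>+t\<in>S. ennreal (f t) \<partial>M) = (\<integral>\<^sup>+t\<in>S. ennreal (g t) \<partial>M)"
  using assms by (intro nn_integral_cong) (auto split: split_indicator)

lemma bose_measurable [measurable]: "bose \<in> borel_measurable borel"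
  unfolding bose_def [abs_def] by simp

lemma bose_reg_measurable [measurable]: "bose_reg \<in> borel_measurable borel"
  unfolding bose_reg_def [abs_def] by simp

lemma bose_pos: "t > 0 \<Longrightarrow> bose t > 0"
  by (simp add: bose_def)

lemma bose_le_inverse:
  assumes "t > 0"
  shows "bose t \<le> 1 / t"
proof -
  have "t \<le> exp t - 1" using exp_ge_add_one_self[of t] by linarith
  thus ?thesis using assms unfolding bose_def by (intro divide_left_mono mult_pos_pos) auto
qed

lemma bose_sums:
  assumes "t > 0"
  shows "(\<lambda>n. exp (- real (Suc n) * t)) sums bose t"
proof -
  have "(\<lambda>n. exp (- t) * exp (- t) ^ n) sums (exp (- t) * (1 / (1 - exp (- t))))"
    using assms by (intro sums_mult geometric_sums) simp
  moreover have "exp (- t) * exp (- t) ^ n = exp (- real (Suc n) * t)" for n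
    by (simp add: algebra_simps flip: exp_add exp_of_nat_mult)
  moreover have "exp (- t) * (1 / (1 - exp (- t))) = bose t"
    using assms by (simp add: bose_def exp_minus field_simps)
  ultimately show ?thesis by simp
qed

lemma bose_reg_nonneg:
  assumes "t > 0"
  shows "bose_reg t \<ge> 0"
proof -
  have "0 \<le> 2 * t / (t\<^sup>2 + (2 * pi * real (Suc k))\<^sup>2)" for k using assms by simp
  thus ?thesis using sums_le[OF _ sums_zero bose_reg_sums[OF assms]] by blast
qed

text \<open>The difference equals 1 / t - \<open>bose t\<close>, so this is the inequality e^t - 1
  >= t.\<close>

lemma half_minus_bose_reg_nonneg: "t > 0 \<Longrightarrow> 0 \<le> 1 / 2 - bose_reg t"
  using bose_le_inverse[of t] by (simp add: bose_reg_def)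

text \<open>Meaningful for s > 1. Nonnegative integrals produce the Dirichlet series in this real
  form; its relation to \<open>riemann_zeta\<close> is established later.\<close>

definition zeta_real :: "real \<Rightarrow> real" where
  "zeta_real s = (\<Sum>n. real (Suc n) powr (- s))"

lemma zeta_real_sums:
  assumes "s > 1"
  shows "(\<lambda>n. real (Suc n) powr (- s)) sums zeta_real s"
proof -
  have "summable (\<lambda>n. real n powr (- s))" using assms by (simp add: summable_real_powr_iff)
  hence "summable (\<lambda>n. real (Suc n) powr (- s))" by (subst summable_Suc_iff)
  thus ?thesis unfolding zeta_real_def by (rule summable_sums)
qed

lemma zeta_real_nonneg: "s > 1 \<Longrightarrow> zeta_real s \<ge> 0"
  using sums_le[OF _ sums_zero zeta_real_sums[of s]] by simp

lemma suminf_ennreal_zeta_real: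
  assumes "s > 1" "c \<ge> 0"
  shows "(\<Sum>n. ennreal (c * real (Suc n) powr (- s))) = ennreal (c * zeta_real s)"
  using assms by (intro suminf_ennreal_eq sums_mult zeta_real_sums) auto

lemma nn_integral_bose:
  assumes "s > 1"
  shows "(\<integral>\<^sup>+t\<in>{0<..}. ennreal (bose t * t powr (s - 1)) \<partial>lborel) = ennreal (Gamma s * zeta_real s)"
proof -
  have "(\<integral>\<^sup>+t\<in>{0<..}. ennreal (bose t * t powr (s - 1)) \<partial>lborel)
      = (\<Sum>n. \<integral>\<^sup>+t\<in>{0<..}. ennreal (exp (- real (Suc n) * t) * t powr (s - 1)) \<partial>lborel)"
    by (intro nn_set_integral_sums sums_mult2 bose_sums) auto
  also have "\<dots> = (\<Sum>n. ennreal (Gamma s * real (Suc n) powr (- s)))"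
    using assms nn_integral_Gamma[of s "real (Suc n)" for n]
    by (intro suminf_cong) (simp add: mult.commute del: of_nat_Suc)
  also have "\<dots> = ennreal (Gamma s * zeta_real s)"
    using assms by (intro suminf_ennreal_zeta_real) (auto intro!: less_imp_le Gamma_real_pos)
  finally show ?thesis .
qed

text \<open>Each partial fraction contributes a power of k. The single integrals converge for -1 < s
  < 1, their sum for s < 0; the prefactor becomes that of the functional equation once Gamma is
  divided out.\<close>

lemma nn_integral_bose_reg:
  assumes "-1 < s" "s < 0"
  shows "(\<integral>\<^sup>+t\<in>{0<..}. ennreal (bose_reg t * t powr (s - 1)) \<partial>lborel)
           = ennreal ((2 * pi) powr (s - 1) * pi / cos (pi * s / 2) * zeta_real (1 - s))"
proof -
  have cos_pos: "cos (pi * s / 2) > 0"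
    using assms mult_strict_left_mono[of "-1" s pi] mult_strict_left_mono[of s 0 pi]
    by (intro cos_gt_zero_pi) auto
  have "(\<integral>\<^sup>+t\<in>{0<..}. ennreal (bose_reg t * t powr (s - 1)) \<partial>lborel)
      = (\<Sum>k. \<integral>\<^sup>+t\<in>{0<..}. ennreal (2 * t / (t\<^sup>2 + (2 * pi * real (Suc k))\<^sup>2) * t powr (s - 1)) \<partial>lborel)"
    by (intro nn_set_integral_sums sums_mult2 bose_reg_sums) auto
  also have "\<dots> = (\<Sum>k. ennreal ((2 * pi) powr (s - 1) * pi / cos (pi * s / 2) * real (Suc k) powr (- (1 - s))))"
  proof (intro suminf_cong)
    fix k
    have "(\<integral>\<^sup>+t\<in>{0<..}. ennreal (2 * t / (t\<^sup>2 + (2 * pi * real (Suc k))\<^sup>2) * t powr (s - 1)) \<partial>lborel)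
        = (\<integral>\<^sup>+t\<in>{0<..}. ennreal (2 * (t powr s / (t\<^sup>2 + (2 * pi * real (Suc k))\<^sup>2))) \<partial>lborel)"
    proof (rule nn_set_integral_cong)
      fix t :: real assume "t \<in> {0<..}"
      hence "t powr s = t * t powr (s - 1)" by (simp add: powr_mult_base)
      thus "2 * t / (t\<^sup>2 + (2 * pi * real (Suc k))\<^sup>2) * t powr (s - 1)
          = 2 * (t powr s / (t\<^sup>2 + (2 * pi * real (Suc k))\<^sup>2))" by simp
    qed
    also have "\<dots> = ennreal 2 * (\<integral>\<^sup>+t\<in>{0<..}. ennreal (t powr s / (t\<^sup>2 + (2 * pi * real (Suc k))\<^sup>2)) \<partial>lborel)"
      by (intro nn_set_integral_cmult) auto
    also have "\<dots> = ennreal 2 * ennreal (pi / (2 * cos (pi * s / 2)) * (2 * pi * real (Suc k)) powr (s - 1))"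
      using assms by (subst nn_integral_powr_over_square) auto
    also have "\<dots> = ennreal (2 * (pi / (2 * cos (pi * s / 2)) * (2 * pi * real (Suc k)) powr (s - 1)))"
      by (rule ennreal_mult'[symmetric]) simp
    also have "2 * (pi / (2 * cos (pi * s / 2)) * (2 * pi * real (Suc k)) powr (s - 1))
        = (2 * pi) powr (s - 1) * pi / cos (pi * s / 2) * real (Suc k) powr (- (1 - s))"
      by (simp add: powr_mult)
    finally show "(\<integral>\<^sup>+t\<in>{0<..}. ennreal (2 * t / (t\<^sup>2 + (2 * pi * real (Suc k))\<^sup>2) * t powr (s - 1)) \<partial>lborel)
        = ennreal ((2 * pi) powr (s - 1) * pi / cos (pi * s / 2) * real (Suc k) powr (- (1 - s)))" .
  qed
  also have "\<dots> = ennreal ((2 * pi) powr (s - 1) * pi / cos (pi * s / 2) * zeta_real (1 - s))"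
    using assms cos_pos by (intro suminf_ennreal_zeta_real) auto
  finally show ?thesis .
qed

section \<open>The cut-off kernel\<close>

text \<open>O(t) at 0 and exponentially small at infinity, so that a single Mellin transform
  converges for Re s > -1. It differs from \<open>bose\<close> on (0, 1] and from
  \<open>bose_reg\<close> beyond 1 by 1/t - 1/2 up to sign, and the cut-off transforms of these
  powers are explicit.\<close>

definition bose_cut :: "real \<Rightarrow> real" where
  "bose_cut t = (if t \<le> 1 then bose_reg t else bose t)"

lemma bose_cut_measurable [measurable]: "bose_cut \<in> borel_measurable borel"
  unfolding bose_cut_def [abs_def] by simp

lemma bose_cut_nonneg: "t > 0 \<Longrightarrow> bose_cut t \<ge> 0"
  using bose_reg_nonneg[of t] bose_pos[of t] by (simp add: bose_cut_def)

lemma nn_set_integral_if_le_1: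
  "(\<integral>\<^sup>+t\<in>{0<..}. ennreal (if t \<le> (1::real) then f t else 0) \<partial>M) = (\<integral>\<^sup>+t\<in>{0<..1}. ennreal (f t) \<partial>M)"
  by (intro nn_integral_cong) (auto split: split_indicator)

lemma nn_set_integral_if_gt_1:
  "(\<integral>\<^sup>+t\<in>{0<..}. ennreal (if t \<le> (1::real) then 0 else f t) \<partial>M) = (\<integral>\<^sup>+t\<in>{1<..}. ennreal (f t) \<partial>M)"
  by (intro nn_integral_cong) (auto split: split_indicator)

lemma nn_integral_half_powr_01:
  assumes "p > (0::real)"
  shows "(\<integral>\<^sup>+t\<in>{0<..1}. ennreal (1 / 2 * t powr (p - 1)) \<partial>lborel) = ennreal (1 / (2 * p))"
proof -
  have "(\<integral>\<^sup>+t\<in>{0<..1}. ennreal (1 / 2 * t powr (p - 1)) \<partial>lborel) = ennreal (1 / 2) * ennreal (1 / p)"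
    unfolding nn_integral_powr_01[OF assms, symmetric] by (rule nn_set_integral_cmult) auto
  also have "\<dots> = ennreal (1 / 2 * (1 / p))" by (rule ennreal_mult'[symmetric]) simp
  finally show ?thesis by simp
qed

lemma nn_integral_half_powr_1_inf:
  assumes "p > (0::real)"
  shows "(\<integral>\<^sup>+t\<in>{1<..}. ennreal (1 / 2 * t powr (- p - 1)) \<partial>lborel) = ennreal (1 / (2 * p))"
proof -
  have "(\<integral>\<^sup>+t\<in>{1<..}. ennreal (1 / 2 * t powr (- p - 1)) \<partial>lborel) = ennreal (1 / 2) * ennreal (1 / p)"
    unfolding nn_integral_powr_1_inf[OF assms, symmetric] by (rule nn_set_integral_cmult) auto
  also have "\<dots> = ennreal (1 / 2 * (1 / p))" by (rule ennreal_mult'[symmetric]) simp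
  finally show ?thesis by simp
qed

text \<open>On (0, 1] the kernels satisfy \<open>bose_cut t\<close> + 1/t = \<open>bose t\<close> +
  1/2; the integrals of t^(s-2) and t^(s-1) / 2 over (0, 1] are the two elementary terms.\<close>

lemma nn_integral_bose_cut_gt_1:
  assumes "s > 1"
  shows "(\<integral>\<^sup>+t\<in>{0<..}. ennreal (bose_cut t * t powr (s - 1)) \<partial>lborel) + ennreal (1 / (s - 1))
       = ennreal (Gamma s * zeta_real s) + ennreal (1 / (2 * s))"
proof -
  have "(\<integral>\<^sup>+t\<in>{0<..}. ennreal (bose_cut t * t powr (s - 1)) \<partial>lborel) + ennreal (1 / (s - 1))
      = (\<integral>\<^sup>+t\<in>{0<..}. ennreal (bose_cut t * t powr (s - 1) + (if t \<le> 1 then t powr (s - 1 - 1) else 0)) \<partial>lborel)"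
    using assms nn_integral_powr_01[of "s - 1"] by (subst nn_set_integral_add)
      (auto simp: bose_cut_nonneg nn_set_integral_if_le_1)
  also have "\<dots> = (\<integral>\<^sup>+t\<in>{0<..}. ennreal (bose t * t powr (s - 1) + (if t \<le> 1 then 1 / 2 * t powr (s - 1) else 0)) \<partial>lborel)"
  proof (rule nn_set_integral_cong)
    fix t :: real assume "t \<in> {0<..}"
    hence "t powr (s - 1 - 1) = 1 / t * t powr (s - 1)" by (simp add: powr_diff power2_eq_square)
    thus "bose_cut t * t powr (s - 1) + (if t \<le> 1 then t powr (s - 1 - 1) else 0)
        = bose t * t powr (s - 1) + (if t \<le> 1 then 1 / 2 * t powr (s - 1) else 0)"
      unfolding bose_cut_def bose_reg_def by (simp add: algebra_simps)
  qed
  also have "\<dots> = ennreal (Gamma s * zeta_real s) + ennreal (1 / (2 * s))"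
    using assms by (subst nn_set_integral_add)
      (auto simp: bose_pos less_imp_le nn_set_integral_if_le_1 nn_integral_half_powr_01 nn_integral_bose
         simp del: mult_numeral_1 times_divide_eq_left)
  finally show ?thesis .
qed

text \<open>For t > 1 the relation is \<open>bose_cut t\<close> + 1/2 = \<open>bose_reg t\<close> +
  1/t. The elementary terms are the negatives of those for s > 1, so both ranges of s concern the
  same expression: the transform plus 1 / (s - 1) minus 1 / (2 s).\<close>

lemma nn_integral_bose_cut_neg:
  assumes "-1 < s" "s < 0"
  shows "(\<integral>\<^sup>+t\<in>{0<..}. ennreal (bose_cut t * t powr (s - 1)) \<partial>lborel) + ennreal (1 / (2 * (- s)))
       = ennreal ((2 * pi) powr (s - 1) * pi / cos (pi * s / 2) * zeta_real (1 - s)) + ennreal (1 / (1 - s))"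
proof -
  have "(\<integral>\<^sup>+t\<in>{0<..}. ennreal (bose_cut t * t powr (s - 1)) \<partial>lborel) + ennreal (1 / (2 * (- s)))
      = (\<integral>\<^sup>+t\<in>{0<..}. ennreal (bose_cut t * t powr (s - 1) + (if t \<le> 1 then 0 else 1 / 2 * t powr (- (- s) - 1))) \<partial>lborel)"
    using assms by (subst nn_set_integral_add)
      (auto simp: bose_cut_nonneg nn_set_integral_if_gt_1 nn_integral_half_powr_1_inf 
         simp del: minus_minus times_divide_eq_left mult_minus_right)
  also have "\<dots> = (\<integral>\<^sup>+t\<in>{0<..}. ennreal (bose_reg t * t powr (s - 1) + (if t \<le> 1 then 0 else t powr (- (1 - s) - 1))) \<partial>lborel)"
  proof (rule nn_set_integral_cong)
    fix t :: real assume "t \<in> {0<..}"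
    hence "t powr (- (1 - s) - 1) = 1 / t * t powr (s - 1)" by (simp add: powr_diff power2_eq_square)
    thus "bose_cut t * t powr (s - 1) + (if t \<le> 1 then 0 else 1 / 2 * t powr (- (- s) - 1))
        = bose_reg t * t powr (s - 1) + (if t \<le> 1 then 0 else t powr (- (1 - s) - 1))"
      unfolding bose_cut_def bose_reg_def by (simp add: algebra_simps)
  qed
  also have "\<dots> = ennreal ((2 * pi) powr (s - 1) * pi / cos (pi * s / 2) * zeta_real (1 - s)) + ennreal (1 / (1 - s))"
    using assms by (subst nn_set_integral_add)
      (auto simp: bose_reg_nonneg nn_set_integral_if_gt_1 nn_integral_powr_1_inf nn_integral_bose_reg simp del: minus_diff_eq)
  finally show ?thesis .
qed

text \<open>The two kernels add up to 1/2 on (0, 1] and to 1/t beyond, with integrals 1 and 2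
  against t^(-1/2). This is the source of the constant 3 below.\<close>

lemma nn_integral_bose_cut_half:
  "(\<integral>\<^sup>+t\<in>{0<..}. ennreal (bose_cut t * t powr (-1/2)) \<partial>lborel)
     + (\<integral>\<^sup>+t\<in>{0<..}. ennreal ((1 / 2 - bose_reg t) * t powr (-1/2)) \<partial>lborel) = 3"
proof -
  have "(\<integral>\<^sup>+t\<in>{0<..}. ennreal (bose_cut t * t powr (-1/2)) \<partial>lborel)
     + (\<integral>\<^sup>+t\<in>{0<..}. ennreal ((1 / 2 - bose_reg t) * t powr (-1/2)) \<partial>lborel)
     = (\<integral>\<^sup>+t\<in>{0<..}. ennreal (bose_cut t * t powr (-1/2) + (1 / 2 - bose_reg t) * t powr (-1/2)) \<partial>lborel)"
    by (rule nn_set_integral_add[symmetric]) (auto intro!: mult_nonneg_nonneg half_minus_bose_reg_nonneg bose_cut_nonneg)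
  also have "\<dots> = (\<integral>\<^sup>+t\<in>{0<..}. ennreal ((if t \<le> 1 then 1 / 2 * t powr (1/2 - 1) else 0)
       + (if t \<le> 1 then 0 else t powr (- (1/2) - 1))) \<partial>lborel)"
  proof (rule nn_set_integral_cong)
    fix t :: real assume "t \<in> {0<..}"
    hence "t powr (- (1/2) - 1) = 1 / t * t powr (-1/2)" unfolding powr_diff by simp
    moreover have "t powr (1/2 - 1) = t powr (-1/2)" by simp
    ultimately show "bose_cut t * t powr (-1/2) + (1 / 2 - bose_reg t) * t powr (-1/2)
        = (if t \<le> 1 then 1 / 2 * t powr (1/2 - 1) else 0) + (if t \<le> 1 then 0 else t powr (- (1/2) - 1))"
      unfolding bose_cut_def bose_reg_def by (simp add: algebra_simps)
  qed
  also have "\<dots> = ennreal (1 / (2 * (1/2))) + ennreal (1 / (1/2))"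
    by (subst nn_set_integral_add, simp, simp, simp, simp)
       (simp only: nn_set_integral_if_le_1 nn_set_integral_if_gt_1,
        subst nn_integral_half_powr_01, simp, subst nn_integral_powr_1_inf, simp_all)
  also have "\<dots> = 3" by (simp flip: ennreal_plus)
  finally show ?thesis .
qed

section \<open>Analytic continuation of the zeta function\<close>

lemma exp_mult_abs_ln_le:
  assumes "t > (0::real)" "r \<ge> 0"
  shows "exp (r * \<bar>ln t\<bar>) \<le> t powr r + t powr (- r)"
  using assms by (cases "ln t \<ge> 0") (auto simp: powr_def)

text \<open>Expanding t^(w-1) = t^(z-1) e^((w-z) ln t) and integrating termwise shows that the
  transform is a power series in w - z around every point z of the half-plane.\<close>

lemma mellin_holomorphic:
  fixes f :: "real \<Rightarrow> real"
  assumes [measurable]: "f \<in> borel_measurable borel"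
    and nonneg: "\<And>t. t > 0 \<Longrightarrow> f t \<ge> 0"
    and int: "\<And>\<sigma>. \<sigma> > \<sigma>0 \<Longrightarrow> set_integrable lborel {0<..} (\<lambda>t. f t * t powr (\<sigma> - 1))"
  shows "(\<lambda>s. \<integral>t\<in>{0<..}. complex_of_real (f t) * of_real t powr (s - 1) \<partial>lborel) holomorphic_on {s. Re s > \<sigma>0}"
    (is "?M holomorphic_on _")
proof -
  have "?M field_differentiable (at z)" if z: "Re z > \<sigma>0" for z
  proof -
    \<comment> \<open>Half the distance to the boundary, so that the transform still converges at Re
      z - r and Re z + r.\<close>
    define r where "r = (Re z - \<sigma>0) / 2"
    have r: "r > 0" "Re z - r > \<sigma>0" "Re z + r > \<sigma>0" using z by (auto simp: r_def field_simps)
    \<comment> \<open>The dominating function, from e^(r |ln t|) <= t^r + t^(-r).\<close>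
    define G where "G = (\<lambda>t. indicator {0<..} t *\<^sub>R (f t * t powr (Re z + r - 1)) + indicator {0<..} t *\<^sub>R (f t * t powr (Re z - r - 1)))"
    have G_int: "integrable lborel G"
      using int[OF r(2)] int[OF r(3)] unfolding G_def set_integrable_def by (intro Bochner_Integration.integrable_add)
    have G_bound: "f t * t powr (Re z - 1) * exp (r * \<bar>ln t\<bar>) \<le> G t" if t: "t > 0" for t
    proof -
      have "f t * t powr (Re z - 1) * exp (r * \<bar>ln t\<bar>) \<le> f t * t powr (Re z - 1) * (t powr r + t powr (- r))"
        using nonneg[OF t] t r exp_mult_abs_ln_le[OF t, of r] by (intro mult_left_mono) auto
      also have "\<dots> = G t"
        using t by (simp add: G_def algebra_simps flip: powr_add)
      finally show ?thesis .
    qed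
    \<comment> \<open>The Taylor coefficients: each derivative in s brings down a factor ln
      t.\<close>
    define a where "a = (\<lambda>n. \<integral>t\<in>{0<..}. complex_of_real (f t * ln t ^ n / fact n) * of_real t powr (z - 1) \<partial>lborel)"
    have "(\<lambda>n. a n * (w - z) ^ n) sums ?M w" if w: "w \<in> ball z r" for w
    proof -
      define F where "F = (\<lambda>n t. indicator {0<..} t *\<^sub>R (complex_of_real (f t * ln t ^ n / fact n) * of_real t powr (z - 1)) * (w - z) ^ n)"
      have [measurable]: "F n \<in> borel_measurable lborel" for n
        unfolding F_def by measurable
      have norm_w: "norm (w - z) \<le> r" using w by (simp add: dist_norm norm_minus_commute)
      have F_norm: "norm (F n t) \<le> f t * t powr (Re z - 1) * ((r * \<bar>ln t\<bar>) ^ n / fact n)" if t: "t > 0" for n t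
      proof -
        have "norm (F n t) = f t * \<bar>ln t\<bar> ^ n / fact n * t powr (Re z - 1) * norm (w - z) ^ n"
          using t nonneg[OF t] by (simp add: F_def norm_mult norm_divide norm_power norm_powr_real_powr abs_mult power_abs)
        also have "\<dots> \<le> f t * \<bar>ln t\<bar> ^ n / fact n * t powr (Re z - 1) * r ^ n"
          using nonneg[OF t] norm_w by (intro mult_left_mono power_mono) auto
        finally show ?thesis by (simp add: power_mult_distrib mult_ac)
      qed
      have exp_sums: "(\<lambda>n. (r * \<bar>ln t\<bar>) ^ n / fact n) sums exp (r * \<bar>ln t\<bar>)" for t
        using exp_converges[of "r * \<bar>ln t\<bar>"] by (simp add: divide_inverse mult.commute)
      \<comment> \<open>This one bound yields integrability of each term, absolute convergence for
        every t, and summability of the integrals.\<close>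
      have F_sum: "(\<Sum>n<N. norm (F n t)) \<le> G t" for N t
      proof (cases "t > 0")
        case True
        have "(\<Sum>n<N. norm (F n t)) \<le> (\<Sum>n<N. f t * t powr (Re z - 1) * ((r * \<bar>ln t\<bar>) ^ n / fact n))"
          by (intro sum_mono F_norm True)
        also have "\<dots> \<le> f t * t powr (Re z - 1) * exp (r * \<bar>ln t\<bar>)"
          unfolding sum_distrib_left[symmetric] using nonneg[OF True] r(1)
          by (intro mult_left_mono sum_le_suminf[OF sums_summable[OF exp_sums], unfolded sums_unique[OF exp_sums, symmetric]]) auto
        also have "\<dots> \<le> G t" by (rule G_bound[OF True])
        finally show ?thesis .
      qed (simp add: F_def G_def)
      have F_int: "integrable lborel (F n)" for n
      proof (rule Bochner_Integration.integrable_bound[OF G_int])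
        have "norm (F n t) \<le> norm (G t)" for t
          using F_sum[of t "Suc n"] sum_nonneg[of "{..<n}" "\<lambda>n. norm (F n t)"] by simp
        thus "AE t in lborel. norm (F n t) \<le> norm (G t)" by simp
      qed simp
      have "(\<lambda>n. integral\<^sup>L lborel (F n)) sums (\<integral>t. (\<Sum>n. F n t) \<partial>lborel)"
      proof (rule sums_integral[OF F_int])
        have "summable (\<lambda>n. norm (F n t))" for t
          by (rule summableI_nonneg_bounded[of _ "G t"]) (auto simp: F_sum)
        thus "AE t in lborel. summable (\<lambda>n. norm (F n t))" by simp
        show "summable (\<lambda>n. \<integral>t. norm (F n t) \<partial>lborel)"
        proof (rule summableI_nonneg_bounded)
          fix N
          have "(\<Sum>n<N. \<integral>t. norm (F n t) \<partial>lborel) = (\<integral>t. (\<Sum>n<N. norm (F n t)) \<partial>lborel)"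
            by (intro Bochner_Integration.integral_sum[symmetric] integrable_norm F_int)
          also have "\<dots> \<le> integral\<^sup>L lborel G"
            by (intro integral_mono Bochner_Integration.integrable_sum integrable_norm F_int G_int F_sum)
          finally show "(\<Sum>n<N. \<integral>t. norm (F n t) \<partial>lborel) \<le> integral\<^sup>L lborel G" .
        qed auto
      qed
      also have "(\<lambda>n. integral\<^sup>L lborel (F n)) = (\<lambda>n. a n * (w - z) ^ n)"
        unfolding a_def F_def set_lebesgue_integral_def by (intro ext integral_mult_left_zero)
      also have "(\<integral>t. (\<Sum>n. F n t) \<partial>lborel) = ?M w"
        unfolding set_lebesgue_integral_def
      proof (intro Bochner_Integration.integral_cong refl)
        fix t :: real
        show "(\<Sum>n. F n t) = indicator {0<..} t *\<^sub>R (complex_of_real (f t) * of_real t powr (w - 1))"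
        proof (cases "t > 0")
          case True
          have "(\<lambda>n. complex_of_real (f t) * of_real t powr (z - 1) * ((of_real (ln t) * (w - z)) ^ n /\<^sub>R fact n))
                 sums (complex_of_real (f t) * of_real t powr (z - 1) * exp (of_real (ln t) * (w - z)))"
            by (intro sums_mult exp_converges)
          also have "(\<lambda>n. complex_of_real (f t) * of_real t powr (z - 1) * ((of_real (ln t) * (w - z)) ^ n /\<^sub>R fact n))
                = (\<lambda>n. F n t)"
            using True by (simp add: F_def fun_eq_iff scaleR_conv_of_real power_mult_distrib divide_inverse mult_ac)
          also have "of_real (f t) * of_real t powr (z - 1) * exp (of_real (ln t) * (w - z))
             = complex_of_real (f t) * of_real t powr (w - 1)"
          proof -
            have "(z - 1) * of_real (ln t) + of_real (ln t) * (w - z) = (w - 1) * complex_of_real (ln t)"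
              by (simp add: algebra_simps)
            hence "of_real t powr (z - 1) * exp (of_real (ln t) * (w - z)) = complex_of_real t powr (w - 1)"
              using True by (simp add: powr_def Ln_of_real flip: exp_add)
            thus ?thesis by (simp add: mult.assoc)
          qed
          finally show ?thesis using True by (simp add: sums_iff)
        qed (simp add: F_def)
      qed
      finally show ?thesis .
    qed
    hence "?M holomorphic_on ball z r" by (rule power_series_holomorphic)
    thus ?thesis
      by (rule holomorphic_on_imp_differentiable_at) (use r in auto)
  qed
  thus ?thesis
    by (auto simp: holomorphic_on_def intro: field_differentiable_at_within)
qed

text \<open>The midpoint of a real interval is a limit point of the interval, so the identity
  theorem applies. This transports equalities obtained from real integrals to complex
  arguments.\<close>

lemma holomorphic_eq_on_reals_imp_eq:
  fixes f g :: "complex \<Rightarrow> complex"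
  assumes "f holomorphic_on S" "g holomorphic_on S" "open S" "connected S"
    and ab: "a < (b::real)" "\<And>x. a < x \<Longrightarrow> x < b \<Longrightarrow> of_real x \<in> S"
    and eq: "\<And>x. a < x \<Longrightarrow> x < b \<Longrightarrow> f (of_real x) = g (of_real x)"
    and "w \<in> S"
  shows "f w = g w"
proof -
  define m where "m = (a + b) / 2"
  have m: "a < m" "m < b" using ab by (auto simp: m_def)
  have "of_real m islimpt complex_of_real ` {a<..<b}"
    unfolding islimpt_approachable
  proof safe
    fix e :: real assume e: "e > 0"
    define d where "d = min (e / 2) ((b - m) / 2)"
    have d: "d > 0" "d < e" "d < b - m" using e m by (auto simp: d_def min_less_iff_disj)
    define x where "x = m + d"
    have "dist (complex_of_real x) (of_real m) = d"
      using d(1) by (simp add: x_def dist_norm)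
    hence "m < x" "x < b" "dist (complex_of_real x) (of_real m) < e"
      using d by (auto simp: x_def)
    thus "\<exists>x'\<in>complex_of_real ` {a<..<b}. x' \<noteq> of_real m \<and> dist x' (of_real m) < e"
      using m by (intro bexI[of _ "of_real x"]) auto
  qed
  have "f w - g w = 0"
  proof (rule analytic_continuation[of "\<lambda>w. f w - g w" S "complex_of_real ` {a<..<b}" "of_real m"])
    show "(\<lambda>w. f w - g w) holomorphic_on S" by (intro holomorphic_intros assms)
    show "complex_of_real ` {a<..<b} \<subseteq> S" using ab(2) by auto
    show "of_real m \<in> S" by (intro ab(2) m)
    show "f z - g z = 0" if "z \<in> complex_of_real ` {a<..<b}" for z
      using that eq by auto
  qed fact+
  thus ?thesis by simp
qed

lemma nn_integral_bose_cut_finite: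
  assumes "\<sigma> > -1"
  shows "(\<integral>\<^sup>+t\<in>{0<..}. ennreal (bose_cut t * t powr (\<sigma> - 1)) \<partial>lborel) < \<infinity>"
proof -
  \<comment> \<open>Closed forms are at hand for s < 0 and for s > 1. Exponents from these two
    ranges enclose \<sigma> and dominate t^(\<sigma> - 1) on the two sides of t = 1.\<close>
  define s1 s2 where "s1 = min \<sigma> (-1/2)" and "s2 = max \<sigma> 2"
  have s: "-1 < s1" "s1 < 0" "s1 \<le> \<sigma>" "1 < s2" "\<sigma> \<le> s2"
    using assms by (auto simp: s1_def s2_def)
  have "(\<integral>\<^sup>+t\<in>{0<..}. ennreal (bose_cut t * t powr (\<sigma> - 1)) \<partial>lborel)
      \<le> (\<integral>\<^sup>+t\<in>{0<..}. ennreal (bose_cut t * t powr (s1 - 1) + bose_cut t * t powr (s2 - 1)) \<partial>lborel)"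
  proof (rule nn_integral_mono)
    fix t :: real
    show "ennreal (bose_cut t * t powr (\<sigma> - 1)) * indicator {0<..} t
       \<le> ennreal (bose_cut t * t powr (s1 - 1) + bose_cut t * t powr (s2 - 1)) * indicator {0<..} t"
    proof (cases "t > 0")
      case True
      have "t powr (\<sigma> - 1) \<le> t powr (s1 - 1) + t powr (s2 - 1)"
      proof (cases "t \<le> 1")
        case True
        hence "t powr (\<sigma> - 1) \<le> t powr (s1 - 1)" using \<open>t > 0\<close> s by (intro powr_mono') auto
        thus ?thesis by (smt (verit) powr_ge_zero)
      next
        case False
        hence "t powr (\<sigma> - 1) \<le> t powr (s2 - 1)" using s by (intro powr_mono) auto
        thus ?thesis by (smt (verit) powr_ge_zero)
      qed
      hence "bose_cut t * t powr (\<sigma> - 1) \<le> bose_cut t * t powr (s1 - 1) + bose_cut t * t powr (s2 - 1)"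
        using bose_cut_nonneg[OF True] by (simp add: mult_left_mono flip: distrib_left)
      thus ?thesis using True by (simp add: ennreal_leI)
    qed simp
  qed
  also have "\<dots> = (\<integral>\<^sup>+t\<in>{0<..}. ennreal (bose_cut t * t powr (s1 - 1)) \<partial>lborel)
               + (\<integral>\<^sup>+t\<in>{0<..}. ennreal (bose_cut t * t powr (s2 - 1)) \<partial>lborel)"
    by (intro nn_set_integral_add) (auto intro!: mult_nonneg_nonneg bose_cut_nonneg)
  also have "\<dots> < \<infinity>"
  proof -
    have "(\<integral>\<^sup>+t\<in>{0<..}. ennreal (bose_cut t * t powr (s1 - 1)) \<partial>lborel) + ennreal (1 / (2 * (- s1))) < \<infinity>"
      by (subst nn_integral_bose_cut_neg) (use s in auto)
    moreover have "(\<integral>\<^sup>+t\<in>{0<..}. ennreal (bose_cut t * t powr (s2 - 1)) \<partial>lborel) + ennreal (1 / (s2 - 1)) < \<infinity>"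
      by (subst nn_integral_bose_cut_gt_1) (use s in auto)
    ultimately show ?thesis by simp
  qed
  finally show ?thesis .
qed

definition bose_mellin :: "complex \<Rightarrow> complex" where
  "bose_mellin s = (\<integral>t\<in>{0<..}. complex_of_real (bose_cut t) * of_real t powr (s - 1) \<partial>lborel)"

definition bose_mellin_real :: "real \<Rightarrow> real" where
  "bose_mellin_real s = (\<integral>t\<in>{0<..}. bose_cut t * t powr (s - 1) \<partial>lborel)"

lemma bose_mellin_real_nonneg: "bose_mellin_real s \<ge> 0"
  unfolding bose_mellin_real_def set_lebesgue_integral_def
  by (intro Bochner_Integration.integral_nonneg) (auto split: split_indicator intro: mult_nonneg_nonneg bose_cut_nonneg)

lemma set_integrable_bose_cut:
  assumes "s > -1"
  shows "set_integrable lborel {0<..} (\<lambda>t. bose_cut t * t powr (s - 1))"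
  unfolding set_integrable_def
proof (rule integrableI_nonneg)
  have "(\<integral>\<^sup>+t. ennreal (indicator {0<..} t *\<^sub>R (bose_cut t * t powr (s - 1))) \<partial>lborel)
      = (\<integral>\<^sup>+t\<in>{0<..}. ennreal (bose_cut t * t powr (s - 1)) \<partial>lborel)"
    by (intro nn_integral_cong) (auto split: split_indicator)
  thus "(\<integral>\<^sup>+t. ennreal (indicator {0<..} t *\<^sub>R (bose_cut t * t powr (s - 1))) \<partial>lborel) < \<infinity>"
    using nn_integral_bose_cut_finite[OF assms] by simp
qed (auto split: split_indicator intro!: mult_nonneg_nonneg bose_cut_nonneg AE_I2)

lemma nn_integral_bose_cut:
  assumes "s > -1"
  shows "(\<integral>\<^sup>+t\<in>{0<..}. ennreal (bose_cut t * t powr (s - 1)) \<partial>lborel) = ennreal (bose_mellin_real s)"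
proof -
  have "(\<integral>\<^sup>+t\<in>{0<..}. ennreal (bose_cut t * t powr (s - 1)) \<partial>lborel)
      = (\<integral>\<^sup>+t. ennreal (indicator {0<..} t *\<^sub>R (bose_cut t * t powr (s - 1))) \<partial>lborel)"
    by (intro nn_integral_cong) (auto split: split_indicator)
  also have "\<dots> = ennreal (bose_mellin_real s)"
    unfolding bose_mellin_real_def set_lebesgue_integral_def
    by (rule nn_integral_eq_integral)
       (use set_integrable_bose_cut[OF assms] in \<open>auto simp: set_integrable_def split: split_indicator
          intro!: mult_nonneg_nonneg bose_cut_nonneg AE_I2\<close>)
  finally show ?thesis .
qed

lemma bose_mellin_of_real:
  "bose_mellin (of_real s) = of_real (bose_mellin_real s)"
proof -
  have "bose_mellin (of_real s) = (\<integral>t\<in>{0<..}. complex_of_real (bose_cut t * t powr (s - 1)) \<partial>lborel)"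
    unfolding bose_mellin_def
  proof (intro set_lebesgue_integral_cong allI impI)
    fix t :: real assume "t \<in> {0<..}"
    thus "complex_of_real (bose_cut t) * of_real t powr (of_real s - 1) = of_real (bose_cut t * t powr (s - 1))"
      using powr_of_real[of t "s - 1"] by simp
  qed simp
  also have "\<dots> = of_real (bose_mellin_real s)"
    unfolding bose_mellin_real_def by (rule set_integral_complex_of_real)
  finally show ?thesis .
qed

lemma bose_mellin_holomorphic: "bose_mellin holomorphic_on {s. Re s > -1}"
  unfolding bose_mellin_def [abs_def]
  by (rule mellin_holomorphic) (auto intro: bose_cut_nonneg set_integrable_bose_cut)

lemma bose_mellin_real_gt_1:
  assumes "s > 1"
  shows "bose_mellin_real s + 1 / (s - 1) = Gamma s * zeta_real s + 1 / (2 * s)"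
proof -
  have "ennreal (bose_mellin_real s + 1 / (s - 1)) = ennreal (Gamma s * zeta_real s + 1 / (2 * s))"
    using nn_integral_bose_cut_gt_1[OF assms] nn_integral_bose_cut[of s] assms
    by (simp add: ennreal_plus bose_mellin_real_nonneg zeta_real_nonneg Gamma_real_pos less_imp_le)
  moreover have "0 \<le> bose_mellin_real s + 1 / (s - 1)"
    using assms bose_mellin_real_nonneg by (intro add_nonneg_nonneg) auto
  moreover have "0 \<le> Gamma s * zeta_real s + 1 / (2 * s)"
    using assms zeta_real_nonneg Gamma_real_pos[of s] by (intro add_nonneg_nonneg mult_nonneg_nonneg) auto
  ultimately show ?thesis by (simp only: ennreal_inj)
qed

lemma bose_mellin_real_neg:
  assumes "-1 < s" "s < 0"
  shows "bose_mellin_real s + 1 / (2 * (- s))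
       = (2 * pi) powr (s - 1) * pi / cos (pi * s / 2) * zeta_real (1 - s) + 1 / (1 - s)"
proof -
  have "cos (pi * s / 2) > 0"
    using assms mult_strict_left_mono[of "-1" s pi] mult_strict_left_mono[of s 0 pi]
    by (intro cos_gt_zero_pi) auto
  hence nonneg: "(2 * pi) powr (s - 1) * pi / cos (pi * s / 2) * zeta_real (1 - s) \<ge> 0"
    using assms by (intro mult_nonneg_nonneg divide_nonneg_nonneg zeta_real_nonneg) auto
  have "ennreal (bose_mellin_real s + 1 / (2 * (- s)))
      = ennreal ((2 * pi) powr (s - 1) * pi / cos (pi * s / 2) * zeta_real (1 - s) + 1 / (1 - s))"
    using nn_integral_bose_cut_neg[OF assms] nn_integral_bose_cut[of s] assms nonneg
    by (subst (1 2) ennreal_plus) (auto simp: bose_mellin_real_nonneg)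
  moreover have "0 \<le> bose_mellin_real s + 1 / (2 * (- s))"
    using assms bose_mellin_real_nonneg by (intro add_nonneg_nonneg) auto
  moreover have "0 \<le> (2 * pi) powr (s - 1) * pi / cos (pi * s / 2) * zeta_real (1 - s) + 1 / (1 - s)"
    using assms nonneg by (intro add_nonneg_nonneg) auto
  ultimately show ?thesis by (simp only: ennreal_inj)
qed

text \<open>For s > 1 the transform satisfies M(s) + 1/(s-1) = Gamma(s) zeta(s) + 1/(2 s); this is
  the solution for zeta. Since \<open>rGamma s\<close> / s is \<open>rGamma (s + 1)\<close>, the
  apparent pole at 0 is gone, and s = 1 is the only singularity with Re s > -1.\<close>

definition zeta_right :: "complex \<Rightarrow> complex" where
  "zeta_right s = rGamma s * (bose_mellin s + 1 / (s - 1)) - rGamma (s + 1) / 2"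

definition zeta_dirichlet :: "complex \<Rightarrow> complex" where
  "zeta_dirichlet s = (\<Sum>n. 1 / of_nat (Suc n) powr s)"

text \<open>The right side of the functional equation, usually written 2^s pi^(s-1) sin (pi s / 2)
  Gamma(1 - s) zeta(1 - s), with the Dirichlet series in place of zeta; hence meaningful for Re s <
  0.\<close>

definition zeta_left :: "complex \<Rightarrow> complex" where
  "zeta_left s = 2 * (2 * of_real pi) powr (s - 1) * sin (of_real pi * s / 2) * Gamma (1 - s) * zeta_dirichlet (1 - s)"

lemma norm_nat_powr: "norm (1 / of_nat (Suc n) powr s :: complex) = real (Suc n) powr (- Re s)"
  by (simp add: norm_divide norm_powr_real_powr powr_minus_divide del: of_nat_Suc)

lemma zeta_dirichlet_holomorphic_sums:
  "zeta_dirichlet holomorphic_on {s. Re s > 1}"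
  "Re s > 1 \<Longrightarrow> (\<lambda>n. 1 / of_nat (Suc n) powr s) sums zeta_dirichlet s"
proof -
  have op: "open {s. Re s > 1}" by (rule open_halfspace_Re_gt)
  have ex: "\<exists>d h. 0 < d \<and> summable h \<and> range h \<subseteq> \<real>\<^sub>\<ge>\<^sub>0 \<and>
      (\<forall>\<^sub>F n in sequentially. \<forall>y\<in>ball x d \<inter> {s. Re s > 1}. norm (1 / of_nat (Suc n) powr y :: complex) \<le> norm (h n :: complex))"
    if x: "x \<in> {s. Re s > 1}" for x
  proof -
    \<comment> \<open>Midway between 1 and Re x: the ball of radius Re x - \<sigma> stays in Re y >
      \<sigma>, where the real series at \<sigma> is a majorant.\<close>
    define \<sigma> where "\<sigma> = (1 + Re x) / 2"
    have \<sigma>: "1 < \<sigma>" "\<sigma> < Re x" using x by (auto simp: \<sigma>_def field_simps)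
    show ?thesis
    proof (rule exI[of _ "Re x - \<sigma>"], rule exI[of _ "\<lambda>n. complex_of_real (real (Suc n) powr (- \<sigma>))"], intro conjI)
      show "0 < Re x - \<sigma>" using \<sigma> by simp
      show "summable (\<lambda>n. complex_of_real (real (Suc n) powr (- \<sigma>)))"
        using zeta_real_sums[OF \<sigma>(1)] by (intro summable_of_real) (rule sums_summable)
      show "\<forall>\<^sub>F n in sequentially. \<forall>y\<in>ball x (Re x - \<sigma>) \<inter> {s. Re s > 1}.
          norm (1 / of_nat (Suc n) powr y :: complex) \<le> norm (complex_of_real (real (Suc n) powr (- \<sigma>)))"
      proof (intro always_eventually allI ballI)
        fix n y assume y: "y \<in> ball x (Re x - \<sigma>) \<inter> {s. Re s > 1}"
        have "Re x - Re y \<le> norm (x - y)" using complex_Re_le_cmod[of "x - y"] by simp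
        also have "\<dots> < Re x - \<sigma>" using y by (simp add: dist_norm)
        finally have "\<sigma> \<le> Re y" by simp
        hence "real (Suc n) powr (- Re y) \<le> real (Suc n) powr (- \<sigma>)" by (intro powr_mono) auto
        thus "norm (1 / of_nat (Suc n) powr y :: complex) \<le> norm (complex_of_real (real (Suc n) powr (- \<sigma>)))"
          unfolding norm_nat_powr by simp
      qed
    qed auto
  qed
  have diff: "(\<lambda>y. 1 / of_nat (Suc n) powr y :: complex) field_differentiable (at x)"
    if "x \<in> {s. Re s > 1}" for n x
  proof -
    have "(\<lambda>y. 1 / of_nat (Suc n) powr y :: complex) holomorphic_on UNIV"
      by (intro holomorphic_intros) (auto simp: powr_def simp del: of_nat_Suc)
    thus ?thesis by (rule holomorphic_on_imp_differentiable_at) auto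
  qed
  obtain g where g: "\<And>s. Re s > 1 \<Longrightarrow> (\<lambda>n. 1 / of_nat (Suc n) powr s) sums g s"
     "\<And>s. Re s > 1 \<Longrightarrow> g field_differentiable (at s)"
    using series_differentiable_comparison_complex[OF op diff ex] by (metis mem_Collect_eq)
  have eq: "zeta_dirichlet s = g s" if "Re s > 1" for s
    unfolding zeta_dirichlet_def using g(1)[OF that] by (rule sums_unique[symmetric])
  show "Re s > 1 \<Longrightarrow> (\<lambda>n. 1 / of_nat (Suc n) powr s) sums zeta_dirichlet s"
    using g(1)[of s] eq[of s] by simp
  have "g holomorphic_on {s. Re s > 1}"
    using g(2) by (auto simp: holomorphic_on_def intro: field_differentiable_at_within)
  thus "zeta_dirichlet holomorphic_on {s. Re s > 1}"
    using eq by (subst holomorphic_cong[OF refl]) auto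
qed

lemma zeta_dirichlet_of_real:
  assumes "s > 1"
  shows "zeta_dirichlet (of_real s) = of_real (zeta_real s)"
proof -
  have "(\<lambda>n. complex_of_real (real (Suc n) powr (- s))) sums of_real (zeta_real s)"
    using zeta_real_sums[OF assms] by (rule sums_of_real)
  moreover have "complex_of_real (real (Suc n) powr (- s)) = 1 / of_nat (Suc n) powr (of_real s)" for n
    using powr_of_real[of "real (Suc n)" s]
    by (simp only: of_real_of_nat_eq of_nat_0_le_iff powr_minus_divide of_real_divide of_real_1)
  ultimately have "(\<lambda>n. 1 / of_nat (Suc n) powr complex_of_real s) sums of_real (zeta_real s)"
    by simp
  thus ?thesis unfolding zeta_dirichlet_def by (rule sums_unique[symmetric])
qed

lemma zeta_right_holomorphic: "zeta_right holomorphic_on ({s. Re s > -1} - {1})"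
  unfolding zeta_right_def [abs_def]
  by (intro holomorphic_intros holomorphic_on_subset[OF bose_mellin_holomorphic]) auto

lemma zeta_left_holomorphic: "zeta_left holomorphic_on {s. Re s < 0}"
  unfolding zeta_left_def [abs_def]
proof (intro holomorphic_intros)
  show "1 - s \<notin> \<int>\<^sub>\<le>\<^sub>0" if "s \<in> {s. Re s < 0}" for s
    using that by (auto elim!: nonpos_Ints_cases simp: complex_eq_iff)
  have "zeta_dirichlet \<circ> (\<lambda>s. 1 - s) holomorphic_on {s. Re s < 0}"
    by (intro holomorphic_on_compose_gen[OF _ zeta_dirichlet_holomorphic_sums(1)] holomorphic_intros) auto
  thus "(\<lambda>s. zeta_dirichlet (1 - s)) holomorphic_on {s. Re s < 0}" by (simp add: o_def)
qed auto

lemma zeta_right_of_real_gt_1: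
  assumes "s > 1"
  shows "zeta_right (of_real s) = of_real (zeta_real s)"
proof -
  have "zeta_right (of_real s) = of_real (rGamma s * (bose_mellin_real s + 1 / (s - 1)) - rGamma (s + 1) / 2)"
    by (simp add: zeta_right_def bose_mellin_of_real flip: rGamma_complex_of_real)
  also have "rGamma s * (bose_mellin_real s + 1 / (s - 1)) - rGamma (s + 1) / 2
      = (rGamma s * Gamma s) * zeta_real s + (rGamma s / s - rGamma (s + 1)) / 2"
    unfolding bose_mellin_real_gt_1[OF assms] by (simp add: algebra_simps diff_divide_distrib)
  also have "rGamma s * Gamma s = 1"
    using Gamma_real_pos[of s] assms by (simp add: rGamma_inverse_Gamma del: Gamma_real_pos)
  also have "rGamma s / s - rGamma (s + 1) = 0"
    using assms rGamma_plus1[of s] by (simp add: field_simps)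
  finally show ?thesis by simp
qed

lemma zeta_right_eq_dirichlet:
  assumes "Re s > 1"
  shows "zeta_right s = zeta_dirichlet s"
proof (rule holomorphic_eq_on_reals_imp_eq[of zeta_right "{s. Re s > 1}" zeta_dirichlet 1 2])
  show "zeta_right holomorphic_on {s. Re s > 1}"
    by (rule holomorphic_on_subset[OF zeta_right_holomorphic]) auto
  show "connected {s. Re s > 1}" by (intro convex_connected convex_halfspace_Re_gt)
  show "zeta_dirichlet holomorphic_on {s. Re s > 1}" by (rule zeta_dirichlet_holomorphic_sums)
  show "open {s. Re s > 1}" by (rule open_halfspace_Re_gt)
  show "zeta_right (of_real x) = zeta_dirichlet (of_real x)" if "1 < x" "x < 2" for x
    using that by (simp add: zeta_right_of_real_gt_1 zeta_dirichlet_of_real)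
qed (use assms in auto)

text \<open>On the real segment the elementary terms cancel, and the reflection formula with sin (pi
  s) = 2 sin (pi s / 2) cos (pi s / 2) trades the cosine of the transform for the sine of the
  functional equation. The identity theorem extends this to the strip.\<close>

lemma zeta_right_eq_left:
  assumes "-1 < Re s" "Re s < 0"
  shows "zeta_right s = zeta_left s"
proof (rule holomorphic_eq_on_reals_imp_eq[of zeta_right "{s. Re s > -1} \<inter> {s. Re s < 0}" zeta_left "-1" 0])
  show "zeta_right holomorphic_on {s. Re s > -1} \<inter> {s. Re s < 0}"
    by (rule holomorphic_on_subset[OF zeta_right_holomorphic]) auto
  show "zeta_left holomorphic_on {s. Re s > -1} \<inter> {s. Re s < 0}"
    by (rule holomorphic_on_subset[OF zeta_left_holomorphic]) auto
  show "connected ({s. Re s > -1} \<inter> {s. Re s < 0})"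
    by (intro convex_connected convex_Int convex_halfspace_Re_gt convex_halfspace_Re_lt)
  show "open ({s. Re s > -1} \<inter> {s. Re s < 0})"
    by (intro open_Int open_halfspace_Re_gt open_halfspace_Re_lt)
  fix s :: real assume s: "-1 < s" "s < 0"
  have cos_pos: "cos (pi * s / 2) > 0"
    using s mult_strict_left_mono[of "-1" s pi] mult_strict_left_mono[of s 0 pi]
    by (intro cos_gt_zero_pi) auto
  have Gamma_pos: "Gamma (1 - s) > 0" using s by (intro Gamma_real_pos) auto
  have rGamma: "rGamma s = Gamma (1 - s) * sin (pi * s) / pi"
  proof -
    have "complex_of_real (rGamma s * rGamma (1 - s)) = of_real (sin (pi * s) / pi)"
      using rGamma_reflection_complex[of "of_real s"] sin_of_real[of "pi * s", where ?'a = complex]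
      by (simp flip: rGamma_complex_of_real)
    hence "rGamma s * rGamma (1 - s) = sin (pi * s) / pi" by (simp only: of_real_eq_iff)
    thus ?thesis using Gamma_pos by (simp add: rGamma_inverse_Gamma[of "1 - s"] field_simps)
  qed
  have "zeta_right (of_real s) = of_real (rGamma s * (bose_mellin_real s + 1 / (s - 1)) - rGamma (s + 1) / 2)"
    by (simp add: zeta_right_def bose_mellin_of_real flip: rGamma_complex_of_real)
  also have "rGamma s * (bose_mellin_real s + 1 / (s - 1)) - rGamma (s + 1) / 2
       = rGamma s * ((2 * pi) powr (s - 1) * pi / cos (pi * s / 2) * zeta_real (1 - s))"
  proof -
    have "bose_mellin_real s + 1 / (s - 1)
        = (2 * pi) powr (s - 1) * pi / cos (pi * s / 2) * zeta_real (1 - s) + 1 / (2 * s)"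
    proof -
      have "1 / (2 * (- s)) = - (1 / (2 * s))" "1 / (1 - s) = - (1 / (s - 1))"
        using s by (simp_all add: divide_simps)
      thus ?thesis using bose_mellin_real_neg[OF s] by linarith
    qed
    moreover have "rGamma s * (1 / (2 * s)) = rGamma (s + 1) / 2"
      using s rGamma_plus1[of s] by (simp add: field_simps)
    ultimately show ?thesis by (simp only: distrib_left)
  qed
  also have "\<dots> = 2 * (2 * pi) powr (s - 1) * sin (pi * s / 2) * Gamma (1 - s) * zeta_real (1 - s)"
  proof -
    have "sin (pi * s) = 2 * sin (pi * s / 2) * cos (pi * s / 2)"
      using sin_double[of "pi * s / 2"] by simp
    thus ?thesis using cos_pos by (simp add: rGamma)
  qed
  also have "complex_of_real \<dots> = zeta_left (of_real s)"
  proof -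
    have "(2 * complex_of_real pi) powr (of_real s - 1) = of_real ((2 * pi) powr (s - 1))"
      using powr_of_real[of "2 * pi" "s - 1"] by simp
    moreover have "zeta_dirichlet (1 - of_real s) = of_real (zeta_real (1 - s))"
      using zeta_dirichlet_of_real[of "1 - s"] s by simp
    moreover have "Gamma (1 - complex_of_real s) = of_real (Gamma (1 - s))"
      by (simp flip: Gamma_complex_of_real)
    moreover have "sin (of_real pi * complex_of_real s / 2) = of_real (sin (pi * s / 2))"
      by (simp flip: sin_of_real)
    ultimately show ?thesis unfolding zeta_left_def by simp
  qed
  finally show "zeta_right (of_real s) = zeta_left (of_real s)" .
qed (use assms in auto)

section \<open>Identification and special values of zeta\<close>

text \<open>The plane without 1 is connected, so the Dirichlet series on (1, 2) determines a
  holomorphic function there, and the value at 1 is prescribed. Exhibiting one such function thus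
  evaluates the description.\<close>

lemma riemann_zeta_unique:
  assumes f: "f holomorphic_on - {1}" "\<And>s. Re s > 1 \<Longrightarrow> (\<lambda>n. 1 / of_nat (Suc n) powr s) sums f s" "f 1 = 0"
  shows "riemann_zeta = f"
  unfolding riemann_zeta_def
proof (rule the_equality)
  fix g :: "complex \<Rightarrow> complex"
  assume g: "g holomorphic_on - {1} \<and> (\<forall>s. Re s > 1 \<longrightarrow> (\<lambda>n. 1 / of_nat (Suc n) powr s) sums g s) \<and> g 1 = 0"
  show "g = f"
  proof
    fix w
    show "g w = f w"
    proof (cases "w = 1")
      case False
      show ?thesis
      proof (rule holomorphic_eq_on_reals_imp_eq[of g "- {1}" f 1 2])
        show "connected (- {1 :: complex})"
          by (intro connected_punctured_universe) simp
        fix x :: real assume x: "1 < x"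
        hence "(\<lambda>n. 1 / of_nat (Suc n) powr of_real x) sums g (of_real x)" using g by simp
        moreover have "(\<lambda>n. 1 / of_nat (Suc n) powr of_real x) sums f (of_real x)" using x f(2) by simp
        ultimately show "g (of_real x) = f (of_real x)" by (rule sums_unique2)
        show "of_real x \<in> - {1 :: complex}" using x by simp
      qed (use g f False in auto)
    qed (use g f in auto)
  qed
qed (use f in auto)

text \<open>The half-planes Re s > -1 and Re s < 0 overlap in a strip on which both formulas agree,
  so the switch at Re s = -1 does not break holomorphy.\<close>

definition zeta_glued :: "complex \<Rightarrow> complex" where
  "zeta_glued s = (if s = 1 then 0 else if Re s > -1 then zeta_right s else zeta_left s)"

lemma riemann_zeta_eq: "riemann_zeta = zeta_glued"
proof (rule riemann_zeta_unique)
  have right: "zeta_glued s = zeta_right s" if "Re s > -1" "s \<noteq> 1" for s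
    using that by (simp add: zeta_glued_def)
  have left: "zeta_glued s = zeta_left s" if "Re s < 0" for s
    using that zeta_right_eq_left[of s] by (auto simp: zeta_glued_def)
  have "zeta_glued holomorphic_on ({s. Re s > -1} - {1}) \<union> {s. Re s < 0}"
  proof (rule holomorphic_on_Un)
    show "zeta_glued holomorphic_on {s. Re s > -1} - {1}"
      using zeta_right_holomorphic right by (subst holomorphic_cong[OF refl]) auto
    show "zeta_glued holomorphic_on {s. Re s < 0}"
      using zeta_left_holomorphic left by (subst holomorphic_cong[OF refl]) auto
  qed (auto intro: open_halfspace_Re_gt open_halfspace_Re_lt open_Diff)
  also have "({s. Re s > -1} - {1}) \<union> {s. Re s < 0} = - {1}" by auto
  finally show "zeta_glued holomorphic_on - {1}" .
  show "(\<lambda>n. 1 / of_nat (Suc n) powr s) sums zeta_glued s" if "Re s > 1" for s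
  proof -
    have "s \<noteq> 1" "Re s > -1" using that by auto
    hence "zeta_glued s = zeta_dirichlet s" using that by (simp add: right zeta_right_eq_dirichlet)
    thus ?thesis using zeta_dirichlet_holomorphic_sums(2)[OF that] by simp
  qed
qed (simp add: zeta_glued_def)

lemma riemann_zeta_half: "riemann_zeta (1/2) = of_real ((bose_mellin_real (1/2) - 3) / sqrt pi)"
proof -
  have rG: "rGamma (1/2 :: complex) = inverse (of_real (sqrt pi))"
    unfolding rGamma_inverse_Gamma Gamma_one_half_complex ..
  \<comment> \<open>At s = 1/2 the elementary terms are 1 / (s - 1) = -2 and, after factoring out
    \<open>rGamma (1/2)\<close>, another -1; together they give the constant -3.\<close>
  have "rGamma (1/2 + 1) = 2 * rGamma (1/2 :: complex)"
    using rGamma_plus1[of "1/2 :: complex"] by simp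
  moreover have "bose_mellin (1/2) = of_real (bose_mellin_real (1/2))"
    using bose_mellin_of_real[of "1/2"] by simp
  ultimately have "zeta_right (1/2) = rGamma (1/2) * (of_real (bose_mellin_real (1/2)) - 3)"
    unfolding zeta_right_def by (simp add: algebra_simps)
  also have "\<dots> = of_real ((bose_mellin_real (1/2) - 3) / sqrt pi)"
    unfolding rG by (simp add: field_simps)
  finally show ?thesis by (simp add: riemann_zeta_eq zeta_glued_def)
qed

lemma riemann_zeta_minus_half: "riemann_zeta (- 1/2) = of_real (- zeta_real (3/2) / (4 * pi))"
proof -
  \<comment> \<open>The point lies in the overlap, so the value can be read off from the functional
    equation.\<close>
  have "riemann_zeta (- 1/2) = zeta_left (- 1/2)"
    using zeta_right_eq_left[of "-1/2"] by (simp add: riemann_zeta_eq zeta_glued_def complex_eq_iff)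
  also have "\<dots> = of_real (2 * (2 * pi) powr (- 3/2) * sin (- pi / 4) * Gamma (3/2) * zeta_real (3/2))"
  proof -
    have "(2 * complex_of_real pi) powr (- 1/2 - 1) = of_real ((2 * pi) powr (- 3/2))"
      using powr_of_real[of "2 * pi" "- 3/2"] by simp
    moreover have "zeta_dirichlet (1 - (- 1/2)) = of_real (zeta_real (3/2))"
      using zeta_dirichlet_of_real[of "3/2"] by simp
    moreover have "Gamma (1 - (- 1/2) :: complex) = of_real (Gamma (3/2))"
      using Gamma_complex_of_real[of "3/2"] by simp
    moreover have "sin (complex_of_real pi * (- 1/2) / 2) = of_real (sin (- pi / 4))"
      using sin_of_real[of "- pi / 4", where ?'a = complex] by simp
    ultimately show ?thesis unfolding zeta_left_def by simp
  qed
  also have "2 * (2 * pi) powr (- 3/2) * sin (- pi / 4) * Gamma (3/2) * zeta_real (3/2) = - zeta_real (3/2) / (4 * pi)"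
  proof -
    have gamma: "Gamma (3/2 :: real) = sqrt pi / 2"
    proof -
      have "(1/2 :: real) \<notin> \<int>\<^sub>\<le>\<^sub>0" using nonpos_Ints_nonpos[of "1/2 :: real"] by auto
      thus ?thesis using Gamma_plus1[of "1/2 :: real"] by (simp add: Gamma_one_half_real)
    qed
    have pow: "(2 * pi) powr (- 3/2) = 1 / (2 * pi * (sqrt 2 * sqrt pi))"
    proof -
      have "(2 * pi) powr (3/2) = (2 * pi) powr (1 + 1/2)" by simp
      also have "\<dots> = 2 * pi * (sqrt 2 * sqrt pi)"
        unfolding powr_add by (simp add: powr_half_sqrt real_sqrt_mult)
      finally show ?thesis by (simp add: powr_minus_divide)
    qed
    have sin: "sin (- pi / 4) = - (sqrt 2 / 2)" by (simp add: sin_45)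
    have "2 * (1 / (2 * P * (q * p))) * (- (q / 2)) * (p / 2) * Z = - Z / (4 * P)"
      if "q \<noteq> 0" "p \<noteq> 0" "P \<noteq> 0" for P q p Z :: real
      using that by (simp add: field_simps)
    from this[of "sqrt 2" "sqrt pi" pi "zeta_real (3/2)"] show ?thesis
      unfolding gamma pow sin by simp
  qed
  finally show ?thesis .
qed

section \<open>Divisor sums\<close>

abbreviation (input) sigma_normalized :: "nat \<Rightarrow> real" where
  "sigma_normalized n \<equiv> divisor_sigma (1/2 :: real) n / sqrt (real n)"

text \<open>Pair d with n / d, since sqrt d / sqrt n = (n / d)^(-1/2). The weight then depends on
  one factor of a factorization n = d m only, as in the product integrals.\<close>

lemma sigma_normalized_eq:
  assumes "n > 0"
  shows "sigma_normalized n = (\<Sum>d | d dvd n. real d powr (-1/2))"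
proof -
  have "sigma_normalized n = (\<Sum>d | d dvd n. real d powr (1/2) / sqrt (real n))"
    by (simp add: divisor_sigma_def sum_divide_distrib)
  also have "\<dots> = (\<Sum>d | d dvd n. real d powr (-1/2))"
  proof (rule sum.reindex_bij_witness[of _ "\<lambda>d. n div d" "\<lambda>d. n div d"])
    fix d assume d: "d \<in> {d. d dvd n}"
    then obtain e where e: "n = d * e" by auto
    hence "d > 0" "e > 0" using assms by auto
    thus "n div (n div d) = d" "n div d \<in> {d. d dvd n}" using e by auto
    show "real (n div d) powr (-1/2) = real d powr (1/2) / sqrt (real n)"
      using \<open>d > 0\<close> \<open>e > 0\<close> by (simp add: e powr_half_sqrt powr_minus_divide real_sqrt_mult)
  next
    fix d assume d: "d \<in> {d. d dvd n}"
    then obtain e where e: "n = d * e" by auto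
    hence "d > 0" "e > 0" using assms by auto
    thus "n div (n div d) = d" "n div d \<in> {d. d dvd n}" using e by auto
  qed
  finally show ?thesis .
qed

lemma sigma_normalized_nonneg: "sigma_normalized n \<ge> 0"
  by (auto simp: divisor_sigma_def intro!: divide_nonneg_nonneg sum_nonneg)

text \<open>Tonelli's theorem with counting measure for one of the indices.\<close>

lemma suminf_ennreal_swap:
  fixes F :: "nat \<Rightarrow> nat \<Rightarrow> ennreal"
  shows "(\<Sum>n. \<Sum>d. F d n) = (\<Sum>d. \<Sum>n. F d n)"
  using nn_integral_suminf[of F "count_space UNIV"] by (simp add: nn_integral_count_space_nat)

text \<open>Sorts the pairs (d, m) by their product; in \<open>ennreal\<close> this rearrangement is
  valid whether or not the sums are finite.\<close>

lemma suminf_sigma_normalized: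
  fixes g :: "nat \<Rightarrow> real"
  assumes g: "\<And>n. g n \<ge> 0"
  shows "(\<Sum>n. ennreal (sigma_normalized (Suc n) * g (Suc n)))
       = (\<Sum>d. \<Sum>m. ennreal (real (Suc d) powr (-1/2) * g (Suc d * Suc m)))"
proof -
  \<comment> \<open>Non-divisors contribute zero terms, so that d ranges over all indices and the
    sums can be interchanged.\<close>
  define F where "F = (\<lambda>d n. if Suc d dvd Suc n then ennreal (real (Suc d) powr (-1/2) * g (Suc n)) else 0)"
  have "ennreal (sigma_normalized (Suc n) * g (Suc n)) = (\<Sum>d. F d n)" for n
  proof -
    have fin: "finite {d. Suc d dvd Suc n}"
      by (rule finite_subset[of _ "{..n}"]) (auto dest: dvd_imp_le)
    have "(\<Sum>d. F d n) = (\<Sum>d | Suc d dvd Suc n. F d n)"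
      by (rule suminf_finite[OF fin]) (simp add: F_def)
    also have "\<dots> = (\<Sum>d | Suc d dvd Suc n. ennreal (real (Suc d) powr (-1/2) * g (Suc n)))"
      by (intro sum.cong) (auto simp: F_def)
    also have "\<dots> = (\<Sum>d | d dvd Suc n. ennreal (real d powr (-1/2) * g (Suc n)))"
    proof (rule sum.reindex_bij_witness[of _ "\<lambda>d. d - 1" Suc])
      fix d assume "d \<in> {d. d dvd Suc n}"
      hence "d > 0" by (auto intro: Nat.gr0I)
      thus "Suc (d - 1) = d" by simp
      thus "d - 1 \<in> {d. Suc d dvd Suc n}" using \<open>d \<in> _\<close> by simp
    qed auto
    also have "\<dots> = ennreal (\<Sum>d | d dvd Suc n. real d powr (-1/2) * g (Suc n))"
      by (rule sum_ennreal) (simp add: g)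
    also have "\<dots> = ennreal (sigma_normalized (Suc n) * g (Suc n))"
      unfolding sigma_normalized_eq[OF zero_less_Suc] sum_distrib_right ..
    finally show ?thesis by simp
  qed
  hence "(\<Sum>n. ennreal (sigma_normalized (Suc n) * g (Suc n))) = (\<Sum>n. \<Sum>d. F d n)"
    by simp
  also have "\<dots> = (\<Sum>d. \<Sum>n. F d n)" by (rule suminf_ennreal_swap)
  also have "\<dots> = (\<Sum>d. \<Sum>m. ennreal (real (Suc d) powr (-1/2) * g (Suc d * Suc m)))"
  proof (rule suminf_cong)
    fix d
    \<comment> \<open>Position n stands for the integer n + 1, so the multiples of d + 1 sit at (d +
      1) (m + 1) - 1.\<close>
    define h where "h = (\<lambda>m. Suc d * Suc m - 1)"
    have h: "Suc (h m) = Suc d * Suc m" for m by (simp add: h_def)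
    have "strict_mono h"
      by (auto simp: h_def strict_mono_Suc_iff)
    moreover have "F d n = 0" if "n \<notin> range h" for n
    proof -
      have "\<not> Suc d dvd Suc n"
      proof
        assume "Suc d dvd Suc n"
        then obtain k where k: "Suc n = Suc d * k" by auto
        then obtain m where "k = Suc m" by (cases k) auto
        hence "n = h m" using k h[of m] by simp
        thus False using that by auto
      qed
      thus ?thesis by (simp add: F_def)
    qed
    ultimately have "(\<lambda>m. F d (h m)) sums (\<Sum>m. F d (h m)) \<longleftrightarrow> F d sums (\<Sum>m. F d (h m))"
      by (rule sums_mono_reindex)
    moreover have "(\<lambda>m. F d (h m)) sums (\<Sum>m. F d (h m))"
      by (rule summable_sums[OF summableI])
    ultimately have "(\<Sum>n. F d n) = (\<Sum>m. F d (h m))"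
      by (simp add: sums_iff)
    also have "\<dots> = (\<Sum>m. ennreal (real (Suc d) powr (-1/2) * g (Suc d * Suc m)))"
      by (intro suminf_cong) (simp add: F_def h del: mult_Suc mult_Suc_right)
    finally show "(\<Sum>n. F d n) = (\<Sum>m. ennreal (real (Suc d) powr (-1/2) * g (Suc d * Suc m)))" .
  qed
  finally show ?thesis .
qed

section \<open>The two product integrals as divisor series\<close>

lemma nn_integral_bose_bose:
  assumes c: "c > 0"
  shows "(\<integral>\<^sup>+t\<in>{0<..}. ennreal (t powr (-1/2) * bose t * bose (c\<^sup>2 / t)) \<partial>lborel)
       = (\<Sum>n. ennreal (sigma_normalized (Suc n) * (sqrt pi * exp (- 2 * c * sqrt (real (Suc n))))))"
proof -
  have "(\<integral>\<^sup>+t\<in>{0<..}. ennreal (t powr (-1/2) * bose t * bose (c\<^sup>2 / t)) \<partial>lborel)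
      = (\<Sum>d. \<integral>\<^sup>+t\<in>{0<..}. ennreal (t powr (-1/2) * exp (- real (Suc d) * t) * bose (c\<^sup>2 / t)) \<partial>lborel)"
    using c by (intro nn_set_integral_sums sums_mult sums_mult2 bose_sums)
      (auto intro!: mult_nonneg_nonneg less_imp_le[OF bose_pos] simp del: of_nat_Suc)
  also have "\<dots> = (\<Sum>d. \<Sum>m. \<integral>\<^sup>+t\<in>{0<..}. ennreal (t powr (-1/2) * exp (- real (Suc d) * t) * exp (- real (Suc m) * (c\<^sup>2 / t))) \<partial>lborel)"
    using c by (intro suminf_cong nn_set_integral_sums sums_mult bose_sums) (auto simp del: of_nat_Suc)
  also have "\<dots> = (\<Sum>d. \<Sum>m. ennreal (real (Suc d) powr (-1/2) * (sqrt pi * exp (- 2 * c * sqrt (real (Suc d * Suc m))))))"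
  proof (intro suminf_cong)
    fix d m
    have "(\<integral>\<^sup>+t\<in>{0<..}. ennreal (t powr (-1/2) * exp (- real (Suc d) * t) * exp (- real (Suc m) * (c\<^sup>2 / t))) \<partial>lborel)
        = (\<integral>\<^sup>+t\<in>{0<..}. ennreal (t powr (-1/2) * exp (- real (Suc d) * t - (real (Suc m) * c\<^sup>2) / t)) \<partial>lborel)"
      by (intro nn_set_integral_cong) (simp add: mult.assoc exp_add[symmetric] del: of_nat_Suc)
    \<comment> \<open>In the resulting exponential the two integers enter through their product
      alone; only the prefactor singles out the first.\<close>
    also have "\<dots> = ennreal (sqrt (pi / real (Suc d)) * exp (- 2 * sqrt (real (Suc d) * (real (Suc m) * c\<^sup>2))))"
      using c by (intro nn_integral_exp_reciprocal) auto
    also have "sqrt (real (Suc d) * (real (Suc m) * c\<^sup>2)) = c * sqrt (real (Suc d * Suc m))"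
      using c by (simp add: real_sqrt_mult of_nat_mult del: of_nat_Suc mult_Suc mult_Suc_right)
    also have "sqrt (pi / real (Suc d)) = real (Suc d) powr (-1/2) * sqrt pi"
      by (simp add: real_sqrt_divide powr_minus_divide powr_half_sqrt del: of_nat_Suc)
    finally show "(\<integral>\<^sup>+t\<in>{0<..}. ennreal (t powr (-1/2) * exp (- real (Suc d) * t) * exp (- real (Suc m) * (c\<^sup>2 / t))) \<partial>lborel)
        = ennreal (real (Suc d) powr (-1/2) * (sqrt pi * exp (- 2 * c * sqrt (real (Suc d * Suc m)))))"
      by (simp only: mult.assoc)
  qed
  also have "\<dots> = (\<Sum>n. ennreal (sigma_normalized (Suc n) * (sqrt pi * exp (- 2 * c * sqrt (real (Suc n))))))"
    by (rule suminf_sigma_normalized[symmetric]) simp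
  finally show ?thesis .
qed

text \<open>The contribution of a pair (j, k) with n = j k to the integral of t^(-1/2) B(t)
  B(c^2/t), stripped of the weight j^(-1/2) and of sqrt pi.\<close>

definition resolvent_term :: "real \<Rightarrow> nat \<Rightarrow> real" where
  "resolvent_term c n = 2 * c\<^sup>2 / ((4 * pi\<^sup>2 * real n + c\<^sup>2) * (2 * pi * sqrt (real n) + c))"

lemma resolvent_term_nonneg: "c > 0 \<Longrightarrow> resolvent_term c n \<ge> 0"
  by (simp add: resolvent_term_def)

lemma nn_integral_bose_reg_bose_reg_term:
  assumes c: "0 < c" "c < 2 * pi"
  defines "a \<equiv> \<lambda>k. 2 * pi * real (Suc k)"
  shows "(\<integral>\<^sup>+t\<in>{0<..}. ennreal (t powr (-1/2) * (2 * t / (t\<^sup>2 + (a k)\<^sup>2)) * (2 * (c\<^sup>2 / t) / ((c\<^sup>2 / t)\<^sup>2 + (a j)\<^sup>2))) \<partial>lborel)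
       = ennreal (real (Suc j) powr (-1/2) * (sqrt pi * resolvent_term c (Suc j * Suc k)))"
proof -
  define J K where "J = real (Suc j)" and "K = real (Suc k)"
  have JK: "J \<ge> 1" "K \<ge> 1" by (auto simp: J_def K_def)
  have a_JK: "a j = 2 * pi * J" "a k = 2 * pi * K" by (simp_all add: a_def J_def K_def)
  \<comment> \<open>In the variable t the second factor has its poles at i b and -i b, which leads
    to the integral over two squares.\<close>
  define b where "b = c\<^sup>2 / a j"
  have a_pos: "a i > 0" for i by (simp add: a_def)
  have b_pos: "b > 0" using c a_pos by (simp add: b_def)
  \<comment> \<open>The smallest product \<open>a k * a j\<close> is 4 pi^2, hence the bound 2 pi on
    c.\<close>
  have "c * c < (2 * pi) * (2 * pi)" using c by (intro mult_strict_mono) auto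
  also have "\<dots> \<le> (2 * pi) * (2 * pi) * (J * K)" using JK mult_mono[of 1 J 1 K] by simp
  also have "\<dots> = a k * a j" by (simp add: a_def J_def K_def)
  finally have "b < a k" using a_pos[of j] by (simp add: b_def power2_eq_square field_simps)
  have "(\<integral>\<^sup>+t\<in>{0<..}. ennreal (t powr (-1/2) * (2 * t / (t\<^sup>2 + (a k)\<^sup>2)) * (2 * (c\<^sup>2 / t) / ((c\<^sup>2 / t)\<^sup>2 + (a j)\<^sup>2))) \<partial>lborel)
      = (\<integral>\<^sup>+t\<in>{0<..}. ennreal (4 * c\<^sup>2 / (a j)\<^sup>2 * (t powr (3/2) / ((t\<^sup>2 + (a k)\<^sup>2) * (t\<^sup>2 + b\<^sup>2)))) \<partial>lborel)"
  proof (rule nn_set_integral_cong)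
    fix t :: real assume "t \<in> {0<..}"
    hence t: "t > 0" by simp
    have "(c\<^sup>2 / t)\<^sup>2 + (a j)\<^sup>2 = (a j)\<^sup>2 / t\<^sup>2 * (t\<^sup>2 + b\<^sup>2)"
      using t a_pos[of j] by (simp add: b_def power_divide field_simps)
    moreover have "t powr (3/2) = t\<^sup>2 * t powr (-1/2)"
      using t powr_add[of t 2 "-1/2"] by simp
    moreover have "p * (2 * t / X) * (2 * (c\<^sup>2 / t) / ((a j)\<^sup>2 / t\<^sup>2 * Y)) = 4 * c\<^sup>2 / (a j)\<^sup>2 * (t\<^sup>2 * p / (X * Y))" for p X Y
      using t a_pos[of j] by (simp add: field_simps)
    ultimately show "t powr (-1/2) * (2 * t / (t\<^sup>2 + (a k)\<^sup>2)) * (2 * (c\<^sup>2 / t) / ((c\<^sup>2 / t)\<^sup>2 + (a j)\<^sup>2))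
        = 4 * c\<^sup>2 / (a j)\<^sup>2 * (t powr (3/2) / ((t\<^sup>2 + (a k)\<^sup>2) * (t\<^sup>2 + b\<^sup>2)))" by metis
  qed
  also have "\<dots> = ennreal (4 * c\<^sup>2 / (a j)\<^sup>2) * (\<integral>\<^sup>+t\<in>{0<..}. ennreal (t powr (3/2) / ((t\<^sup>2 + (a k)\<^sup>2) * (t\<^sup>2 + b\<^sup>2))) \<partial>lborel)"
    by (intro nn_set_integral_cmult) auto
  also have "\<dots> = ennreal (4 * c\<^sup>2 / (a j)\<^sup>2 * (pi / (sqrt 2 * (sqrt (a k) + sqrt b) * (a k + b))))"
    unfolding nn_integral_powr_over_two_squares[OF a_pos b_pos \<open>b < a k\<close>] by (rule ennreal_mult'[symmetric]) simp
  also have "4 * c\<^sup>2 / (a j)\<^sup>2 * (pi / (sqrt 2 * (sqrt (a k) + sqrt b) * (a k + b)))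
      = real (Suc j) powr (-1/2) * (sqrt pi * resolvent_term c (Suc j * Suc k))"
  proof -
    have "a k + b = (4 * pi\<^sup>2 * (J * K) + c\<^sup>2) / (2 * pi * J)"
      using JK by (simp add: b_def a_JK field_simps power2_eq_square)
    moreover have "sqrt (a k) + sqrt b = (2 * pi * sqrt (J * K) + c) / (sqrt 2 * sqrt pi * sqrt J)"
    proof -
      have "sqrt (a k) = sqrt 2 * sqrt pi * sqrt K" by (simp add: a_def K_def real_sqrt_mult)
      moreover have "sqrt b = c / (sqrt 2 * sqrt pi * sqrt J)"
        using c by (simp add: b_def a_def J_def real_sqrt_mult real_sqrt_divide)
      moreover have "2 * pi * sqrt (J * K) = (sqrt 2 * sqrt pi * sqrt K) * (sqrt 2 * sqrt pi * sqrt J)"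
      proof -
        have "2 * pi * sqrt (J * K) = (sqrt 2 * sqrt 2) * (sqrt pi * sqrt pi) * (sqrt J * sqrt K)"
          by (simp add: real_sqrt_mult)
        thus ?thesis by (simp only: mult_ac)
      qed
      moreover have "sqrt 2 * sqrt pi * sqrt J \<noteq> 0" using JK by simp
      ultimately show ?thesis by (simp only: add_divide_distrib nonzero_mult_div_cancel_right not_False_eq_True)
    qed
    \<comment> \<open>Here p, q, r stand for sqrt pi, sqrt J and sqrt 2, so that a purely rational
      identity is left.\<close>
    moreover have "4 * c\<^sup>2 / (2 * P * (q * q))\<^sup>2 * (P / (r * (Y / (r * p * q)) * (X / (2 * P * (q * q)))))
        = 1 / q * (p * (2 * c\<^sup>2 / (X * Y)))"
      if "p > 0" "q > 0" "r > 0" "X > 0" "Y > 0" "P = p * p" for p q r X Y P :: real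
      using that by (simp add: field_simps power2_eq_square)
    from this[of "sqrt pi" "sqrt J" "sqrt 2" "4 * pi\<^sup>2 * (J * K) + c\<^sup>2" "2 * pi * sqrt (J * K) + c" pi]
    have "4 * c\<^sup>2 / (2 * pi * J)\<^sup>2 * (pi / (sqrt 2 * ((2 * pi * sqrt (J * K) + c) / (sqrt 2 * sqrt pi * sqrt J)) * ((4 * pi\<^sup>2 * (J * K) + c\<^sup>2) / (2 * pi * J))))
        = 1 / sqrt J * (sqrt pi * (2 * c\<^sup>2 / ((4 * pi\<^sup>2 * (J * K) + c\<^sup>2) * (2 * pi * sqrt (J * K) + c))))"
      using JK c by (simp add: add_nonneg_pos)
    moreover have "J powr (-1/2) = 1 / sqrt J"
      using JK by (simp add: powr_minus_divide powr_half_sqrt)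
    moreover have "resolvent_term c (Suc j * Suc k) = 2 * c\<^sup>2 / ((4 * pi\<^sup>2 * (J * K) + c\<^sup>2) * (2 * pi * sqrt (J * K) + c))"
      by (simp add: resolvent_term_def J_def K_def del: of_nat_Suc mult_Suc mult_Suc_right)
    ultimately show ?thesis by (simp only: a_JK(1) J_def[symmetric])
  qed
  finally show ?thesis .
qed

lemma nn_integral_bose_reg_bose_reg:
  assumes c: "0 < c" "c < 2 * pi"
  shows "(\<integral>\<^sup>+t\<in>{0<..}. ennreal (t powr (-1/2) * bose_reg t * bose_reg (c\<^sup>2 / t)) \<partial>lborel)
       = (\<Sum>n. ennreal (sigma_normalized (Suc n) * (sqrt pi * resolvent_term c (Suc n))))"
proof -
  have "(\<integral>\<^sup>+t\<in>{0<..}. ennreal (t powr (-1/2) * bose_reg t * bose_reg (c\<^sup>2 / t)) \<partial>lborel)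
      = (\<Sum>j. \<integral>\<^sup>+t\<in>{0<..}. ennreal (t powr (-1/2) * bose_reg t * (2 * (c\<^sup>2 / t) / ((c\<^sup>2 / t)\<^sup>2 + (2 * pi * real (Suc j))\<^sup>2))) \<partial>lborel)"
    using c by (intro nn_set_integral_sums sums_mult bose_reg_sums)
      (auto intro!: mult_nonneg_nonneg divide_nonneg_nonneg bose_reg_nonneg simp del: of_nat_Suc)
  also have "\<dots> = (\<Sum>j. \<Sum>k. \<integral>\<^sup>+t\<in>{0<..}. ennreal (t powr (-1/2) * (2 * t / (t\<^sup>2 + (2 * pi * real (Suc k))\<^sup>2)) * (2 * (c\<^sup>2 / t) / ((c\<^sup>2 / t)\<^sup>2 + (2 * pi * real (Suc j))\<^sup>2))) \<partial>lborel)"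
    using c by (intro suminf_cong nn_set_integral_sums sums_mult sums_mult2 bose_reg_sums)
      (auto intro!: mult_nonneg_nonneg divide_nonneg_nonneg simp del: of_nat_Suc)
  also have "\<dots> = (\<Sum>j. \<Sum>k. ennreal (real (Suc j) powr (-1/2) * (sqrt pi * resolvent_term c (Suc j * Suc k))))"
    unfolding nn_integral_bose_reg_bose_reg_term[OF c] ..
  also have "\<dots> = (\<Sum>n. ennreal (sigma_normalized (Suc n) * (sqrt pi * resolvent_term c (Suc n))))"
    by (rule suminf_sigma_normalized[symmetric]) (simp add: resolvent_term_nonneg c)
  finally show ?thesis .
qed

section \<open>The identity for real parameters\<close>

lemma nn_set_integral_add3:
  assumes "\<And>t. t \<in> S \<Longrightarrow> 0 \<le> f t" "\<And>t. t \<in> S \<Longrightarrow> 0 \<le> g t" "\<And>t. t \<in> S \<Longrightarrow> 0 \<le> h t"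
    and "(\<lambda>t. ennreal (f t) * indicator S t) \<in> borel_measurable M"
    and "(\<lambda>t. ennreal (g t) * indicator S t) \<in> borel_measurable M"
    and "(\<lambda>t. ennreal (h t) * indicator S t) \<in> borel_measurable M"
  shows "(\<integral>\<^sup>+t\<in>S. ennreal (f t + (g t + h t)) \<partial>M)
       = (\<integral>\<^sup>+t\<in>S. ennreal (f t) \<partial>M) + ((\<integral>\<^sup>+t\<in>S. ennreal (g t) \<partial>M) + (\<integral>\<^sup>+t\<in>S. ennreal (h t) \<partial>M))"
proof -
  have "ennreal (g t + h t) * indicator S t = ennreal (g t) * indicator S t + ennreal (h t) * indicator S t" for t
    using assms(2,3) by (auto split: split_indicator)
  hence "(\<lambda>t. ennreal (g t + h t) * indicator S t) \<in> borel_measurable M"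
    using borel_measurable_add[OF assms(5,6)] by simp
  thus ?thesis
    using assms by (simp add: nn_set_integral_add)
qed

text \<open>As the two integrals add up to 3, the second is 3 minus the transform at 1/2, that is,
  -sqrt pi * zeta(1/2). This is how zeta(1/2) enters the identity.\<close>

lemma bose_mellin_real_half_le: "bose_mellin_real (1/2) \<le> 3"
  and nn_integral_half_minus_bose_reg:
    "(\<integral>\<^sup>+t\<in>{0<..}. ennreal ((1 / 2 - bose_reg t) * t powr (-1/2)) \<partial>lborel) = ennreal (3 - bose_mellin_real (1/2))"
proof -
  let ?K = "\<integral>\<^sup>+t\<in>{0<..}. ennreal ((1 / 2 - bose_reg t) * t powr (-1/2)) \<partial>lborel"
  have "(\<integral>\<^sup>+t\<in>{0<..}. ennreal (bose_cut t * t powr (-1/2)) \<partial>lborel) = ennreal (bose_mellin_real (1/2))"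
    using nn_integral_bose_cut[of "1/2"] by simp
  hence eq: "ennreal (bose_mellin_real (1/2)) + ?K = ennreal 3"
    using nn_integral_bose_cut_half by simp
  have "ennreal (bose_mellin_real (1/2)) \<le> ennreal 3"
    unfolding eq[symmetric] by simp
  thus "bose_mellin_real (1/2) \<le> 3" by (subst (asm) ennreal_le_iff) auto
  have "?K = (ennreal (bose_mellin_real (1/2)) + ?K) - ennreal (bose_mellin_real (1/2))"
    by (simp add: ennreal_add_diff_cancel_left)
  also have "\<dots> = ennreal (3 - bose_mellin_real (1/2))"
    unfolding eq by (rule ennreal_minus[OF bose_mellin_real_nonneg])
  finally show "?K = ennreal (3 - bose_mellin_real (1/2))" .
qed

text \<open>The inversion t -> c^2 / t; the constant collects the factor c^2 of its derivative and
  c^(2 s) from the power.\<close>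

lemma nn_set_integral_powr_inversion:
  fixes f :: "real \<Rightarrow> real"
  assumes c: "c > 0" and nonneg: "\<And>t. t > 0 \<Longrightarrow> f t \<ge> 0" and [measurable]: "f \<in> borel_measurable borel"
    and I: "(\<integral>\<^sup>+t\<in>{0<..}. ennreal (f t * t powr s) \<partial>lborel) = ennreal I" "I \<ge> 0"
  shows "(\<integral>\<^sup>+t\<in>{0<..}. ennreal (f (c\<^sup>2 / t) * t powr (- 2 - s)) \<partial>lborel) = ennreal (c powr (- 2 * (s + 1)) * I)"
proof -
  have "(\<integral>\<^sup>+t\<in>{0<..}. ennreal (c powr (- 2 * (s + 1)) * (f t * t powr s)) \<partial>lborel)
      = (\<integral>\<^sup>+t\<in>{0<..}. ennreal (c\<^sup>2 / t\<^sup>2 * (c powr (- 2 * (s + 1)) * (f (c\<^sup>2 / t) * (c\<^sup>2 / t) powr s))) \<partial>lborel)"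
    using c nonneg by (intro nn_integral_inversion) (auto intro!: mult_nonneg_nonneg)
  also have "\<dots> = (\<integral>\<^sup>+t\<in>{0<..}. ennreal (f (c\<^sup>2 / t) * t powr (- 2 - s)) \<partial>lborel)"
  proof (rule nn_set_integral_cong)
    fix t :: real assume "t \<in> {0<..}"
    hence t: "t > 0" by simp
    have e1: "(c\<^sup>2 / t) powr s = c powr (2 * s) / t powr s"
      using c t by (simp add: powr_divide powr_powr flip: powr_numeral)
    have e2: "t powr (- 2 - s) = 1 / (t\<^sup>2 * t powr s)"
      using t powr_add[of t 2 s] powr_minus_divide[of t "2 + s"] by simp
    have e3: "c\<^sup>2 * c powr (- 2 * (s + 1)) * c powr (2 * s) = 1"
    proof -
      have "c\<^sup>2 * c powr (- 2 * (s + 1)) * c powr (2 * s) = c powr (2 + - 2 * (s + 1) + 2 * s)"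
        using c by (simp only: powr_add powr_numeral)
      also have "2 + - 2 * (s + 1) + 2 * s = 0" by simp
      finally show ?thesis using c by simp
    qed
    have e4: "C / T2 * (P * (F * (Q / T))) = (C * P * Q) * (F * (1 / (T2 * T)))" for C P Q F T2 T :: real
      by (simp add: divide_inverse mult_ac)
    show "c\<^sup>2 / t\<^sup>2 * (c powr (- 2 * (s + 1)) * (f (c\<^sup>2 / t) * (c\<^sup>2 / t) powr s)) = f (c\<^sup>2 / t) * t powr (- 2 - s)"
      unfolding e1 e4 e3 e2 by simp
  qed
  also have "(\<integral>\<^sup>+t\<in>{0<..}. ennreal (c powr (- 2 * (s + 1)) * (f t * t powr s)) \<partial>lborel)
      = ennreal (c powr (- 2 * (s + 1))) * ennreal I"
    unfolding I(1)[symmetric] by (intro nn_set_integral_cmult) auto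
  also have "\<dots> = ennreal (c powr (- 2 * (s + 1)) * I)"
    by (rule ennreal_mult'[symmetric]) simp
  finally show ?thesis by (rule sym)
qed

text \<open>Expanding B(t) B(z/t) leaves elementary corrections. They are grouped into four terms,
  each nonnegative and, against t^(-1/2), integrable by itself.\<close>

lemma bose_reciprocal_decomposition:
  assumes "t > 0" "z > 0"
  shows "bose t * bose (z / t) + (1 / 2 - bose_reg (z / t)) / t + bose_reg (z / t) / 2
       = bose_reg t * bose_reg (z / t) + bose t * t / z + (1 / 2 - bose_reg t) / 2"
proof -
  have "(A - 1 / t + 1 / 2) * (A' - t / z + 1 / 2) + A * t / z + (1 / 2 - (A - 1 / t + 1 / 2)) / 2
     = A * A' + (1 / 2 - (A' - t / z + 1 / 2)) / t + (A' - t / z + 1 / 2) / 2" for A A' :: real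
    using assms by (simp add: field_simps)
  thus ?thesis unfolding bose_reg_def by simp
qed

text \<open>\<open>bose_reciprocal_decomposition\<close> with z = c^2, integrated against t^(-1/2).
  The four corrections become the four terms in \<alpha> and \<beta>, which are zeta(1/2) and -4 pi
  zeta(-1/2).\<close>

lemma sigma_normalized_sums_real:
  fixes c :: real
  assumes c: "0 < c" "c < 2 * pi"
  defines "\<alpha> \<equiv> (bose_mellin_real (1/2) - 3) / sqrt pi" and "\<beta> \<equiv> zeta_real (3/2)"
  shows "summable (\<lambda>n. sigma_normalized (Suc n) * exp (- 2 * c * sqrt (real (Suc n))))"
    and "summable (\<lambda>n. sigma_normalized (Suc n) * resolvent_term c (Suc n))"
    and "(\<Sum>n. sigma_normalized (Suc n) * exp (- 2 * c * sqrt (real (Suc n))))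
       = (\<Sum>n. sigma_normalized (Suc n) * resolvent_term c (Suc n)) + \<beta> / (2 * c\<^sup>2) + \<alpha> / c - \<alpha> / 2 - c * \<beta> / (4 * pi)"
proof -
  define K where "K = 3 - bose_mellin_real (1/2)"
  have K: "K \<ge> 0" using bose_mellin_real_half_le by (simp add: K_def)
  have beta: "\<beta> \<ge> 0" unfolding \<beta>_def by (rule zeta_real_nonneg) simp
  \<comment> \<open>The transform of \<open>bose_reg\<close> at s = -1/2. Likewise K, the integral
    of (1/2 - B(t)) t^(-1/2), is -sqrt pi * \<alpha>.\<close>
  define L where "L = \<beta> / (2 * sqrt pi)"
  have L: "L \<ge> 0" using beta by (simp add: L_def)
  have L_int: "(\<integral>\<^sup>+t\<in>{0<..}. ennreal (bose_reg t * t powr (-3/2)) \<partial>lborel) = ennreal L"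
  proof -
    have "(\<integral>\<^sup>+t\<in>{0<..}. ennreal (bose_reg t * t powr (-3/2)) \<partial>lborel)
       = ennreal ((2 * pi) powr (-3/2) * pi / cos (pi / 4) * \<beta>)"
      using nn_integral_bose_reg[of "-1/2"] by (simp add: \<beta>_def)
    also have "(2 * pi) powr (-3/2) * pi / cos (pi / 4) * \<beta> = L"
    proof -
      have pow: "(2 * pi) powr (- 3/2) = 1 / (2 * pi * (sqrt 2 * sqrt pi))"
      proof -
        have "(2 * pi) powr (3/2) = (2 * pi) powr (1 + 1/2)" by simp
        also have "\<dots> = 2 * pi * (sqrt 2 * sqrt pi)"
          unfolding powr_add by (simp add: powr_half_sqrt real_sqrt_mult)
        finally show ?thesis by (simp add: powr_minus_divide)
      qed
      have "1 / (2 * P * (q * p)) * P / (q / 2) * b = b / (2 * p)" if "q > 0" "p > 0" "P > 0" "q * q = 2" for q p P b :: real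
      proof -
        have "1 / (2 * P * (q * p)) * P / (q / 2) * b = b / ((q * q) * p)" using that(1-3) by (simp add: field_simps)
        thus ?thesis using that by simp
      qed
      from this[of "sqrt 2" "sqrt pi" pi \<beta>] show ?thesis
        unfolding pow cos_45 L_def by simp
    qed
    finally show ?thesis .
  qed
  define P where "P = (\<integral>\<^sup>+t\<in>{0<..}. ennreal (t powr (-1/2) * bose t * bose (c\<^sup>2 / t)) \<partial>lborel)"
  define Q where "Q = (\<integral>\<^sup>+t\<in>{0<..}. ennreal (t powr (-1/2) * bose_reg t * bose_reg (c\<^sup>2 / t)) \<partial>lborel)"
  \<comment> \<open>Inversion with exponents -1/2 here and -3/2 in \<open>I2\<close>: the factor
    c^(-2 (s + 1)) is 1 / c and c, respectively.\<close>
  have I1: "(\<integral>\<^sup>+t\<in>{0<..}. ennreal ((1 / 2 - bose_reg (c\<^sup>2 / t)) * t powr (-3/2)) \<partial>lborel) = ennreal (K / c)"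
    using nn_set_integral_powr_inversion[OF c(1), of "\<lambda>t. 1 / 2 - bose_reg t" "-1/2" K]
      half_minus_bose_reg_nonneg nn_integral_half_minus_bose_reg K c
    by (simp add: K_def powr_minus_divide)
  have I2: "(\<integral>\<^sup>+t\<in>{0<..}. ennreal (bose_reg (c\<^sup>2 / t) * t powr (-1/2)) \<partial>lborel) = ennreal (c * L)"
    using nn_set_integral_powr_inversion[OF c(1), of bose_reg "-3/2" L] bose_reg_nonneg L_int L c
    by simp
  have I2': "(\<integral>\<^sup>+t\<in>{0<..}. ennreal (1 / 2 * (bose_reg (c\<^sup>2 / t) * t powr (-1/2))) \<partial>lborel) = ennreal (c * L / 2)"
  proof -
    have "(\<integral>\<^sup>+t\<in>{0<..}. ennreal (1 / 2 * (bose_reg (c\<^sup>2 / t) * t powr (-1/2))) \<partial>lborel) = ennreal (1 / 2) * ennreal (c * L)"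
      unfolding I2[symmetric] by (intro nn_set_integral_cmult) auto
    also have "\<dots> = ennreal (1 / 2 * (c * L))" by (rule ennreal_mult'[symmetric]) simp
    finally show ?thesis by simp
  qed
  have I3: "(\<integral>\<^sup>+t\<in>{0<..}. ennreal (1 / c\<^sup>2 * (bose t * t powr (1/2))) \<partial>lborel) = ennreal (sqrt pi * \<beta> / (2 * c\<^sup>2))"
  proof -
    have "(\<integral>\<^sup>+t\<in>{0<..}. ennreal (bose t * t powr (1/2)) \<partial>lborel) = ennreal (sqrt pi / 2 * \<beta>)"
    proof -
      have "(1/2 :: real) \<notin> \<int>\<^sub>\<le>\<^sub>0" using nonpos_Ints_nonpos[of "1/2 :: real"] by auto
      hence "Gamma (3/2 :: real) = sqrt pi / 2"
        using Gamma_plus1[of "1/2 :: real"] by (simp add: Gamma_one_half_real)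
      moreover have "(\<integral>\<^sup>+t\<in>{0<..}. ennreal (bose t * t powr (1/2)) \<partial>lborel) = ennreal (Gamma (3/2) * \<beta>)"
        using nn_integral_bose[of "3/2"] by (simp add: \<beta>_def)
      ultimately show ?thesis by (simp only:)
    qed
    hence "(\<integral>\<^sup>+t\<in>{0<..}. ennreal (1 / c\<^sup>2 * (bose t * t powr (1/2))) \<partial>lborel) = ennreal (1 / c\<^sup>2) * ennreal (sqrt pi / 2 * \<beta>)"
      by (subst nn_set_integral_cmult) auto
    also have "\<dots> = ennreal (1 / c\<^sup>2 * (sqrt pi / 2 * \<beta>))" by (rule ennreal_mult'[symmetric]) simp
    finally show ?thesis by (simp add: mult.commute)
  qed
  have I4: "(\<integral>\<^sup>+t\<in>{0<..}. ennreal (1 / 2 * ((1 / 2 - bose_reg t) * t powr (-1/2))) \<partial>lborel) = ennreal (K / 2)"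
  proof -
    have "(\<integral>\<^sup>+t\<in>{0<..}. ennreal (1 / 2 * ((1 / 2 - bose_reg t) * t powr (-1/2))) \<partial>lborel) = ennreal (1 / 2) * ennreal K"
      unfolding K_def nn_integral_half_minus_bose_reg[symmetric] by (intro nn_set_integral_cmult) auto
    also have "\<dots> = ennreal (1 / 2 * K)" by (rule ennreal_mult'[symmetric]) simp
    finally show ?thesis by simp
  qed
  have "P + (ennreal (K / c) + ennreal (c * L / 2))
      = (\<integral>\<^sup>+t\<in>{0<..}. ennreal (t powr (-1/2) * bose t * bose (c\<^sup>2 / t)
          + ((1 / 2 - bose_reg (c\<^sup>2 / t)) * t powr (-3/2) + 1 / 2 * (bose_reg (c\<^sup>2 / t) * t powr (-1/2)))) \<partial>lborel)"
    unfolding P_def I1[symmetric] I2'[symmetric] using c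
    by (intro nn_set_integral_add3[symmetric] mult_nonneg_nonneg half_minus_bose_reg_nonneg bose_reg_nonneg less_imp_le[OF bose_pos]) auto
  also have "\<dots> = (\<integral>\<^sup>+t\<in>{0<..}. ennreal (t powr (-1/2) * bose_reg t * bose_reg (c\<^sup>2 / t)
          + (1 / c\<^sup>2 * (bose t * t powr (1/2)) + 1 / 2 * ((1 / 2 - bose_reg t) * t powr (-1/2)))) \<partial>lborel)"
  proof (rule nn_set_integral_cong)
    fix t :: real assume "t \<in> {0<..}"
    hence t: "t > 0" by simp
    have pows: "t powr (-3/2) = t powr (-1/2) / t" "t powr (1/2) = t powr (-1/2) * t"
      using t powr_diff[of t "-1/2" 1] powr_mult_base[of t "-1/2"] by (simp_all add: mult.commute)
    have main: "t powr (-1/2) * (bose t * bose (c\<^sup>2 / t) + (1 / 2 - bose_reg (c\<^sup>2 / t)) / t + bose_reg (c\<^sup>2 / t) / 2)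
       = t powr (-1/2) * (bose_reg t * bose_reg (c\<^sup>2 / t) + bose t * t / c\<^sup>2 + (1 / 2 - bose_reg t) / 2)"
      using bose_reciprocal_decomposition[of t "c\<^sup>2"] t c by simp
    have m1: "p * (A * A' + X / t + B / 2) = p * A * A' + (X * (p / t) + 1 / 2 * (B * p))" for p A A' X B :: real
      using t by (simp add: field_simps)
    have m2: "p * (A * A' + X * t / c\<^sup>2 + B / 2) = p * A * A' + (1 / c\<^sup>2 * (X * (p * t)) + 1 / 2 * (B * p))" for p A A' X B :: real
      using c by (simp add: field_simps)
    show "t powr (-1/2) * bose t * bose (c\<^sup>2 / t)
          + ((1 / 2 - bose_reg (c\<^sup>2 / t)) * t powr (-3/2) + 1 / 2 * (bose_reg (c\<^sup>2 / t) * t powr (-1/2)))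
       = t powr (-1/2) * bose_reg t * bose_reg (c\<^sup>2 / t)
          + (1 / c\<^sup>2 * (bose t * t powr (1/2)) + 1 / 2 * ((1 / 2 - bose_reg t) * t powr (-1/2)))"
      unfolding pows m1[symmetric] m2[symmetric] by (rule main)
  qed
  also have "\<dots> = Q + (ennreal (sqrt pi * \<beta> / (2 * c\<^sup>2)) + ennreal (K / 2))"
    unfolding Q_def I3[symmetric] I4[symmetric] using c
    by (intro nn_set_integral_add3 mult_nonneg_nonneg half_minus_bose_reg_nonneg bose_reg_nonneg less_imp_le[OF bose_pos]) auto
  finally have PQ: "P + (ennreal (K / c) + ennreal (c * L / 2))
      = Q + (ennreal (sqrt pi * \<beta> / (2 * c\<^sup>2)) + ennreal (K / 2))" .
  \<comment> \<open>\<open>bose_reg\<close> <= 1/2 makes Q finite, and the balance \<open>PQ\<close>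
    then makes P finite. This yields convergence of both series and permits the passage to real
    numbers.\<close>
  have "Q \<le> (\<integral>\<^sup>+t\<in>{0<..}. ennreal (1 / 2 * (bose_reg (c\<^sup>2 / t) * t powr (-1/2))) \<partial>lborel)"
    unfolding Q_def
  proof (rule nn_integral_mono)
    fix t :: real
    have "t powr (-1/2) * bose_reg t * bose_reg (c\<^sup>2 / t) \<le> 1 / 2 * (bose_reg (c\<^sup>2 / t) * t powr (-1/2))" if t: "t > 0"
    proof -
      have "bose_reg t * (bose_reg (c\<^sup>2 / t) * t powr (-1/2)) \<le> 1 / 2 * (bose_reg (c\<^sup>2 / t) * t powr (-1/2))"
        using half_minus_bose_reg_nonneg[OF t] bose_reg_nonneg[of "c\<^sup>2 / t"] t c
        by (intro mult_right_mono) auto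
      thus ?thesis by (simp add: mult_ac)
    qed
    thus "ennreal (t powr (-1/2) * bose_reg t * bose_reg (c\<^sup>2 / t)) * indicator {0<..} t
        \<le> ennreal (1 / 2 * (bose_reg (c\<^sup>2 / t) * t powr (-1/2))) * indicator {0<..} t"
      by (auto split: split_indicator intro!: ennreal_leI)
  qed
  hence "Q < \<infinity>" unfolding I2' by (rule le_less_trans) simp
  then obtain q where q: "q \<ge> 0" "Q = ennreal q" by (cases Q) auto
  have "P + (ennreal (K / c) + ennreal (c * L / 2)) < \<infinity>" unfolding PQ q by simp
  hence "P < \<infinity>" by simp
  then obtain p where p: "p \<ge> 0" "P = ennreal p" by (cases P) auto
  have "ennreal (p + (K / c + c * L / 2)) = ennreal (q + (sqrt pi * \<beta> / (2 * c\<^sup>2) + K / 2))"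
    using PQ unfolding p(2) q(2) using p(1) q(1) K L beta c by (simp flip: ennreal_plus)
  hence pq: "p + (K / c + c * L / 2) = q + (sqrt pi * \<beta> / (2 * c\<^sup>2) + K / 2)"
    using p(1) q(1) K L beta c by (subst (asm) ennreal_inj) (auto intro!: add_nonneg_nonneg)
  \<comment> \<open>A series of nonnegative reals with finite sum in \<open>ennreal\<close>
    converges to that sum; the common factor sqrt pi is divided out.\<close>
  have sums_of_nn: "(\<lambda>n. sigma_normalized (Suc n) * f (Suc n)) sums (v / sqrt pi)"
    if "(\<Sum>n. ennreal (sigma_normalized (Suc n) * (sqrt pi * f (Suc n)))) = ennreal v" "v \<ge> 0" "\<And>n. f n \<ge> 0" for f v
  proof -
    have "(\<lambda>n. ennreal (sigma_normalized (Suc n) * (sqrt pi * f (Suc n)))) sums ennreal v"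
      using that(1) summable_sums[OF summableI, of "\<lambda>n. ennreal (sigma_normalized (Suc n) * (sqrt pi * f (Suc n)))"] by simp
    hence "(\<lambda>n. sigma_normalized (Suc n) * (sqrt pi * f (Suc n))) sums v"
      by (rule iffD1[OF sums_ennreal, rotated -1])
        (intro mult_nonneg_nonneg sigma_normalized_nonneg that real_sqrt_ge_zero pi_ge_zero)+
    hence "(\<lambda>n. sigma_normalized (Suc n) * (sqrt pi * f (Suc n)) / sqrt pi) sums (v / sqrt pi)"
      by (rule sums_divide)
    thus ?thesis by simp
  qed
  have s1: "(\<lambda>n. sigma_normalized (Suc n) * exp (- 2 * c * sqrt (real (Suc n)))) sums (p / sqrt pi)"
    using nn_integral_bose_bose[OF c(1)] p unfolding P_def
    by (intro sums_of_nn[of "\<lambda>n. exp (- 2 * c * sqrt (real n))"]) auto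
  have s2: "(\<lambda>n. sigma_normalized (Suc n) * resolvent_term c (Suc n)) sums (q / sqrt pi)"
    using nn_integral_bose_reg_bose_reg[OF c] q unfolding Q_def
    by (intro sums_of_nn[of "resolvent_term c"] resolvent_term_nonneg c) auto
  show "summable (\<lambda>n. sigma_normalized (Suc n) * exp (- 2 * c * sqrt (real (Suc n))))"
    "summable (\<lambda>n. sigma_normalized (Suc n) * resolvent_term c (Suc n))"
    by (rule sums_summable[OF s1], rule sums_summable[OF s2])
  have "p / sqrt pi = q / sqrt pi + \<beta> / (2 * c\<^sup>2) + \<alpha> / c - \<alpha> / 2 - c * \<beta> / (4 * pi)"
  proof -
    have "p = q + sqrt pi * \<beta> / (2 * c\<^sup>2) + K / 2 - K / c - c * L / 2" using pq by simp
    hence "p / sqrt pi = q / sqrt pi + sqrt pi * \<beta> / (2 * c\<^sup>2) / sqrt pi + K / 2 / sqrt pi - K / c / sqrt pi - c * L / 2 / sqrt pi"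
      by (simp only: add_divide_distrib diff_divide_distrib)
    moreover have "K / sqrt pi = - \<alpha>" by (simp add: K_def \<alpha>_def minus_divide_left)
    hence "K / y / sqrt pi = - \<alpha> / y" for y by (metis divide_divide_eq_left mult.commute)
    hence "K / 2 / sqrt pi = - \<alpha> / 2" "K / c / sqrt pi = - \<alpha> / c" by blast+
    moreover have "sqrt pi * \<beta> / (2 * c\<^sup>2) / sqrt pi = \<beta> / (2 * c\<^sup>2)" by simp
    moreover have "c * L / 2 / sqrt pi = c * \<beta> / (4 * pi)" by (simp add: L_def)
    ultimately show ?thesis by simp
  qed
  thus "(\<Sum>n. sigma_normalized (Suc n) * exp (- 2 * c * sqrt (real (Suc n))))
       = (\<Sum>n. sigma_normalized (Suc n) * resolvent_term c (Suc n)) + \<beta> / (2 * c\<^sup>2) + \<alpha> / c - \<alpha> / 2 - c * \<beta> / (4 * pi)"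
    using sums_unique[OF s1] sums_unique[OF s2] by simp
qed

section \<open>Continuation to the half-plane\<close>

text \<open>For Re c > 0 the square of c is real only if c is real, and then it is positive.\<close>

lemma of_real_square_plus_square_nonzero:
  assumes "Re c > 0" "a \<ge> 0"
  shows "complex_of_real a + c\<^sup>2 \<noteq> 0"
proof
  assume "complex_of_real a + c\<^sup>2 = 0"
  hence "Re c * Im c = 0" "a + ((Re c)\<^sup>2 - (Im c)\<^sup>2) = 0"
    by (auto simp: complex_eq_iff power2_eq_square)
  moreover have "(Re c)\<^sup>2 > 0" using assms by simp
  ultimately show False using assms by auto
qed

text \<open>The Weierstrass test with local majorants. The bound is asked for large n only, because
  the majorant of \<open>rat_term\<close> is valid from an index depending on the size of z.\<close>

lemma series_holomorphic_halfplane: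
  fixes f :: "nat \<Rightarrow> complex \<Rightarrow> complex"
  assumes hol: "\<And>n. f n holomorphic_on {c. Re c > 0}"
    and bound: "\<And>z. Re z > 0 \<Longrightarrow> \<exists>d h. 0 < d \<and> summable h \<and> (\<forall>n. h n \<ge> (0::real)) \<and>
        (\<forall>\<^sub>F n in sequentially. \<forall>y. norm (y - z) < d \<longrightarrow> Re y > 0 \<longrightarrow> norm (f n y) \<le> h n)"
  shows "(\<lambda>c. \<Sum>n. f n c) holomorphic_on {c. Re c > 0}"
    and "Re c > 0 \<Longrightarrow> (\<lambda>n. f n c) sums (\<Sum>n. f n c)"
proof -
  have op: "open {c::complex. Re c > 0}" by (rule open_halfspace_Re_gt)
  have diff: "f n field_differentiable (at x)" if "x \<in> {c. Re c > 0}" for n x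
    using hol op that by (rule holomorphic_on_imp_differentiable_at)
  have ex: "\<exists>d h. 0 < d \<and> summable h \<and> range h \<subseteq> \<real>\<^sub>\<ge>\<^sub>0 \<and>
      (\<forall>\<^sub>F n in sequentially. \<forall>y\<in>ball x d \<inter> {c. Re c > 0}. norm (f n y) \<le> norm (h n :: complex))"
    if "x \<in> {c. Re c > 0}" for x
  proof -
    have Re_x: "Re x > 0" using that by simp
    obtain d h where dh: "0 < d" "summable h" "\<And>n. h n \<ge> (0::real)"
      "\<forall>\<^sub>F n in sequentially. \<forall>y. norm (y - x) < d \<longrightarrow> Re y > 0 \<longrightarrow> norm (f n y) \<le> h n"
      using bound[OF Re_x] by blast
    show ?thesis
    proof (rule exI[of _ d], rule exI[of _ "\<lambda>n. complex_of_real (h n)"], intro conjI)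
      show "summable (\<lambda>n. complex_of_real (h n))" using dh(2) by (rule summable_of_real)
      show "\<forall>\<^sub>F n in sequentially. \<forall>y\<in>ball x d \<inter> {c. Re c > 0}. norm (f n y) \<le> norm (complex_of_real (h n))"
        using dh(4) by eventually_elim (auto simp: dist_norm norm_minus_commute dh(3))
    qed (use dh in auto)
  qed
  obtain g where g: "\<And>c. Re c > 0 \<Longrightarrow> (\<lambda>n. f n c) sums g c"
     "\<And>c. Re c > 0 \<Longrightarrow> g field_differentiable (at c)"
    using series_differentiable_comparison_complex[OF op diff ex] by (metis mem_Collect_eq)
  have eq: "(\<Sum>n. f n c) = g c" if "Re c > 0" for c
    using g(1)[OF that] by (rule sums_unique[symmetric])
  show "Re c > 0 \<Longrightarrow> (\<lambda>n. f n c) sums (\<Sum>n. f n c)"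
    using g(1)[of c] eq[of c] by simp
  have "g holomorphic_on {c. Re c > 0}"
    using g(2) by (auto simp: holomorphic_on_def intro: field_differentiable_at_within)
  thus "(\<lambda>c. \<Sum>n. f n c) holomorphic_on {c. Re c > 0}"
    using eq by (subst holomorphic_cong[OF refl]) auto
qed

definition exp_term :: "nat \<Rightarrow> complex \<Rightarrow> complex" where
  "exp_term n c = of_real (sigma_normalized (Suc n)) * exp (- 2 * c * of_real (sqrt (real (Suc n))))"

definition rat_term :: "nat \<Rightarrow> complex \<Rightarrow> complex" where
  "rat_term n c = of_real (sigma_normalized (Suc n)) *
     (2 * c\<^sup>2 / ((of_real (4 * pi\<^sup>2 * real (Suc n)) + c\<^sup>2) * (of_real (2 * pi * sqrt (real (Suc n))) + c)))"

lemma exp_series_holomorphic_sums: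
  "(\<lambda>c. \<Sum>n. exp_term n c) holomorphic_on {c. Re c > 0}"
  "Re c > 0 \<Longrightarrow> (\<lambda>n. exp_term n c) sums (\<Sum>n. exp_term n c)"
proof -
  have hol: "exp_term n holomorphic_on {c. Re c > 0}" for n
    unfolding exp_term_def [abs_def] by (intro holomorphic_intros)
  have bound: "\<exists>d h. 0 < d \<and> summable h \<and> (\<forall>n. h n \<ge> (0::real)) \<and>
        (\<forall>\<^sub>F n in sequentially. \<forall>y. norm (y - z) < d \<longrightarrow> Re y > 0 \<longrightarrow> norm (exp_term n y) \<le> h n)"
    if z: "Re z > 0" for z
  proof -
    \<comment> \<open>On the ball Re y >= Re z / 2, so the series at the real parameter \<sigma>
      dominates; the minimum with 1 keeps \<sigma> below 2 pi, where convergence is known.\<close>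
    define \<sigma> where "\<sigma> = min (Re z / 2) 1"
    have \<sigma>: "0 < \<sigma>" "\<sigma> \<le> Re z / 2" "\<sigma> < 2 * pi" using z pi_gt3 by (auto simp: \<sigma>_def)
    show ?thesis
    proof (rule exI[of _ "Re z / 2"], rule exI[of _ "\<lambda>n. sigma_normalized (Suc n) * exp (- 2 * \<sigma> * sqrt (real (Suc n)))"], intro conjI allI)
      show "0 < Re z / 2" using z by simp
      show "summable (\<lambda>n. sigma_normalized (Suc n) * exp (- 2 * \<sigma> * sqrt (real (Suc n))))"
        using \<sigma> by (intro sigma_normalized_sums_real)
      show "0 \<le> sigma_normalized (Suc n) * exp (- 2 * \<sigma> * sqrt (real (Suc n)))" for n
        by (intro mult_nonneg_nonneg sigma_normalized_nonneg) simp
      show "\<forall>\<^sub>F n in sequentially. \<forall>y. norm (y - z) < Re z / 2 \<longrightarrow> Re y > 0 \<longrightarrow>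
          norm (exp_term n y) \<le> sigma_normalized (Suc n) * exp (- 2 * \<sigma> * sqrt (real (Suc n)))"
      proof (intro always_eventually allI impI)
        fix n y assume y: "norm (y - z) < Re z / 2"
        have "Re z - Re y \<le> norm (y - z)"
          using complex_Re_le_cmod[of "z - y"] by (simp add: norm_minus_commute)
        hence "\<sigma> \<le> Re y" using y \<sigma> by linarith
        hence "- 2 * Re y * sqrt (real (Suc n)) \<le> - 2 * \<sigma> * sqrt (real (Suc n))"
          by (intro mult_right_mono) auto
        hence "sigma_normalized (Suc n) * exp (- 2 * Re y * sqrt (real (Suc n)))
            \<le> sigma_normalized (Suc n) * exp (- 2 * \<sigma> * sqrt (real (Suc n)))"
          by (intro mult_left_mono sigma_normalized_nonneg) (simp only: exp_le_cancel_iff)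
        moreover have "Re (- 2 * y * of_real (sqrt (real (Suc n)))) = - 2 * Re y * sqrt (real (Suc n))"
          by (simp del: of_nat_Suc)
        ultimately show "norm (exp_term n y) \<le> sigma_normalized (Suc n) * exp (- 2 * \<sigma> * sqrt (real (Suc n)))"
          unfolding exp_term_def norm_mult norm_exp_eq_Re norm_of_real abs_of_nonneg[OF sigma_normalized_nonneg] by metis
      qed
    qed
  qed
  show "(\<lambda>c. \<Sum>n. exp_term n c) holomorphic_on {c. Re c > 0}"
    by (rule series_holomorphic_halfplane(1)[OF hol bound])
  show "Re c > 0 \<Longrightarrow> (\<lambda>n. exp_term n c) sums (\<Sum>n. exp_term n c)"
    by (rule series_holomorphic_halfplane(2)[OF hol bound])
qed

text \<open>For bounded c and large n both denominators are at least half of those at c = 1, so a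
  multiple of the real series at 1 is a majorant.\<close>

lemma rat_series_holomorphic_sums:
  "(\<lambda>c. \<Sum>n. rat_term n c) holomorphic_on {c. Re c > 0}"
  "Re c > 0 \<Longrightarrow> (\<lambda>n. rat_term n c) sums (\<Sum>n. rat_term n c)"
proof -
  have nz: "of_real (4 * pi\<^sup>2 * real (Suc n)) + c\<^sup>2 \<noteq> 0" "of_real (2 * pi * sqrt (real (Suc n))) + c \<noteq> 0"
    if "Re c > 0" for n c
  proof -
    show "of_real (4 * pi\<^sup>2 * real (Suc n)) + c\<^sup>2 \<noteq> 0"
      by (rule of_real_square_plus_square_nonzero[OF that]) simp
    have "Re (of_real (2 * pi * sqrt (real (Suc n))) + c) > 0" using that by (simp add: add_nonneg_pos)
    thus "of_real (2 * pi * sqrt (real (Suc n))) + c \<noteq> 0" by (metis less_irrefl zero_complex.sel(1))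
  qed
  have hol: "rat_term n holomorphic_on {c. Re c > 0}" for n
    unfolding rat_term_def [abs_def] by (intro holomorphic_intros) (use nz in auto)
  have bound: "\<exists>d h. 0 < d \<and> summable h \<and> (\<forall>n. h n \<ge> (0::real)) \<and>
        (\<forall>\<^sub>F n in sequentially. \<forall>y. norm (y - z) < d \<longrightarrow> Re y > 0 \<longrightarrow> norm (rat_term n y) \<le> h n)"
    if z: "Re z > 0" for z
  proof -
    define R where "R = norm z + 1"
    show ?thesis
    proof (rule exI[of _ 1], rule exI[of _ "\<lambda>n. 4 * R\<^sup>2 * (sigma_normalized (Suc n) * resolvent_term 1 (Suc n))"], intro conjI allI)
      show "summable (\<lambda>n. 4 * R\<^sup>2 * (sigma_normalized (Suc n) * resolvent_term 1 (Suc n)))"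
        using pi_gt3 by (intro summable_mult sigma_normalized_sums_real) auto
      show "0 \<le> 4 * R\<^sup>2 * (sigma_normalized (Suc n) * resolvent_term 1 (Suc n))" for n
        by (intro mult_nonneg_nonneg sigma_normalized_nonneg resolvent_term_nonneg) auto
      show "\<forall>\<^sub>F n in sequentially. \<forall>y. norm (y - z) < 1 \<longrightarrow> Re y > 0 \<longrightarrow>
          norm (rat_term n y) \<le> 4 * R\<^sup>2 * (sigma_normalized (Suc n) * resolvent_term 1 (Suc n))"
        \<comment> \<open>From this index on 4 pi^2 (n + 1) >= 2 R^2 + 1, whence 4 pi^2 (n + 1) -
          R^2 is at least half of 4 pi^2 (n + 1) + 1.\<close>
        using eventually_ge_at_top[of "nat \<lceil>2 * R\<^sup>2 + 1\<rceil>"]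
      proof eventually_elim
        case (elim n)
        hence "2 * R\<^sup>2 + 1 \<le> real (Suc n)" by linarith
        moreover have "1 \<le> pi\<^sup>2" using power_mono[of 1 pi 2] pi_gt3 by simp
        hence "1 * real (Suc n) \<le> 4 * pi\<^sup>2 * real (Suc n)" by (intro mult_right_mono) linarith+
        ultimately have n: "2 * R\<^sup>2 + 1 \<le> 4 * pi\<^sup>2 * real (Suc n)" by (metis mult_1 order_trans)
        show ?case
        proof (intro allI impI)
          fix y assume y: "norm (y - z) < 1" "Re y > 0"
          have "norm y \<le> norm (y - z) + norm z" using norm_triangle_ineq[of "y - z" z] by simp
          hence yR: "norm y \<le> R" using y by (simp add: R_def)
          hence yR2: "norm (y\<^sup>2) \<le> R\<^sup>2" by (simp add: norm_power power_mono)
          have b1: "(4 * pi\<^sup>2 * real (Suc n) + 1\<^sup>2) / 2 \<le> norm (of_real (4 * pi\<^sup>2 * real (Suc n)) + y\<^sup>2)"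
          proof -
            have "norm (complex_of_real (4 * pi\<^sup>2 * real (Suc n))) - norm (y\<^sup>2) \<le> norm (of_real (4 * pi\<^sup>2 * real (Suc n)) + y\<^sup>2)"
              by (rule norm_diff_ineq)
            moreover have "norm (complex_of_real (4 * pi\<^sup>2 * real (Suc n))) = 4 * pi\<^sup>2 * real (Suc n)"
              unfolding norm_of_real by simp
            ultimately have "4 * pi\<^sup>2 * real (Suc n) - R\<^sup>2 \<le> norm (of_real (4 * pi\<^sup>2 * real (Suc n)) + y\<^sup>2)"
              using yR2 by (metis diff_left_mono order_trans)
            moreover have "(N + 1\<^sup>2) / 2 \<le> M" if "2 * r + 1 \<le> N" "N - r \<le> M" for N r M :: real
              using that by simp
            ultimately show ?thesis using n by blast
          qed
          have b2: "(2 * pi * sqrt (real (Suc n)) + 1) / 2 \<le> norm (of_real (2 * pi * sqrt (real (Suc n))) + y)"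
          proof -
            have "1 * 1 \<le> 2 * pi * sqrt (real (Suc n))" using pi_gt3 by (intro mult_mono) auto
            hence "1 \<le> 2 * pi * sqrt (real (Suc n))" by (simp only: mult_1)
            moreover have "2 * pi * sqrt (real (Suc n)) + Re y \<le> norm (of_real (2 * pi * sqrt (real (Suc n))) + y)"
              using complex_Re_le_cmod[of "of_real (2 * pi * sqrt (real (Suc n))) + y"] by simp
            moreover have "(P + 1) / 2 \<le> M" if "1 \<le> P" "P + r \<le> M" "0 < r" for P r M :: real
              using that by simp
            ultimately show ?thesis using y(2) by blast
          qed
          have "norm (2 * y\<^sup>2 / ((of_real (4 * pi\<^sup>2 * real (Suc n)) + y\<^sup>2) * (of_real (2 * pi * sqrt (real (Suc n))) + y)))
              = 2 * norm (y\<^sup>2) / (norm (of_real (4 * pi\<^sup>2 * real (Suc n)) + y\<^sup>2) * norm (of_real (2 * pi * sqrt (real (Suc n))) + y))"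
            by (simp add: norm_divide norm_mult)
          also have "\<dots> \<le> 2 * R\<^sup>2 / ((4 * pi\<^sup>2 * real (Suc n) + 1\<^sup>2) / 2 * ((2 * pi * sqrt (real (Suc n)) + 1) / 2))"
            using b1 b2 yR2 by (intro frac_le mult_mono mult_pos_pos) (auto simp: add_nonneg_pos)
          also have "\<dots> = 4 * R\<^sup>2 * resolvent_term 1 (Suc n)"
            by (simp add: resolvent_term_def)
          finally have "norm (2 * y\<^sup>2 / ((of_real (4 * pi\<^sup>2 * real (Suc n)) + y\<^sup>2) * (of_real (2 * pi * sqrt (real (Suc n))) + y)))
              \<le> 4 * R\<^sup>2 * resolvent_term 1 (Suc n)" .
          hence "sigma_normalized (Suc n) * norm (2 * y\<^sup>2 / ((of_real (4 * pi\<^sup>2 * real (Suc n)) + y\<^sup>2) * (of_real (2 * pi * sqrt (real (Suc n))) + y)))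
              \<le> sigma_normalized (Suc n) * (4 * R\<^sup>2 * resolvent_term 1 (Suc n))"
            by (intro mult_left_mono sigma_normalized_nonneg)
          moreover have "4 * R\<^sup>2 * (r * t) = r * (4 * R\<^sup>2 * t)" for r t by simp
          ultimately show "norm (rat_term n y) \<le> 4 * R\<^sup>2 * (sigma_normalized (Suc n) * resolvent_term 1 (Suc n))"
            unfolding rat_term_def norm_mult[of "of_real _"] norm_of_real abs_of_nonneg[OF sigma_normalized_nonneg]
            by (simp only:)
        qed
      qed
    qed auto
  qed
  show "(\<lambda>c. \<Sum>n. rat_term n c) holomorphic_on {c. Re c > 0}"
    by (rule series_holomorphic_halfplane(1)[OF hol bound])
  show "Re c > 0 \<Longrightarrow> (\<lambda>n. rat_term n c) sums (\<Sum>n. rat_term n c)"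
    by (rule series_holomorphic_halfplane(2)[OF hol bound])
qed

text \<open>Agreement on the real interval (0, 1) already determines both holomorphic sides, which
  lifts the bound 2 pi on c.\<close>

lemma voronoi_complex:
  assumes "Re c > 0"
  shows "(\<Sum>n. exp_term n c) = (\<Sum>n. rat_term n c) + of_real (zeta_real (3/2)) / (2 * c\<^sup>2)
     + of_real ((bose_mellin_real (1/2) - 3) / sqrt pi) / c - of_real ((bose_mellin_real (1/2) - 3) / sqrt pi) / 2
     - c * of_real (zeta_real (3/2)) / (4 * of_real pi)"
    (is "?F c = ?G c")
proof (rule holomorphic_eq_on_reals_imp_eq[of ?F "{c. Re c > 0}" ?G 0 1])
  show "?F holomorphic_on {c. Re c > 0}" by (rule exp_series_holomorphic_sums)
  show "?G holomorphic_on {c. Re c > 0}"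
    by (intro holomorphic_intros rat_series_holomorphic_sums) auto
  show "open {c::complex. Re c > 0}" by (rule open_halfspace_Re_gt)
  show "connected {c::complex. Re c > 0}" by (intro convex_connected convex_halfspace_Re_gt)
  fix c :: real assume c: "0 < c" "c < 1"
  show "of_real c \<in> {c. Re c > 0}" using c by simp
  have c2: "c < 2 * pi" using c pi_gt3 by simp
  note S = sigma_normalized_sums_real[OF c(1) c2]
  have "exp_term n (of_real c) = of_real (sigma_normalized (Suc n) * exp (- 2 * c * sqrt (real (Suc n))))" for n
    by (simp add: exp_term_def exp_of_real[symmetric] del: of_nat_Suc)
  hence F: "?F (of_real c) = of_real (\<Sum>n. sigma_normalized (Suc n) * exp (- 2 * c * sqrt (real (Suc n))))"
    unfolding suminf_of_real[OF S(1)] by simp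
  have "rat_term n (of_real c) = of_real (sigma_normalized (Suc n) * resolvent_term c (Suc n))" for n
    by (simp add: rat_term_def resolvent_term_def del: of_nat_Suc)
  hence G: "(\<Sum>n. rat_term n (of_real c)) = of_real (\<Sum>n. sigma_normalized (Suc n) * resolvent_term c (Suc n))"
    unfolding suminf_of_real[OF S(2)] by simp
  show "?F (of_real c) = ?G (of_real c)"
    unfolding F G S(3) by simp
qed (use assms in auto)

section \<open>Imaginary parts on the ray arg c = -pi/4\<close>

lemma Im_complex_of_real_mult: "Im (of_real r * z) = r * Im z"
  by simp

lemma Im_complex_of_real_mult_cis: "Im (of_real r * cis t) = r * sin t"
  by simp

text \<open>Here c = 2 pi sqrt x * e^(-i pi/4), so the exponent is -v + i v with v = 2 pi sqrt (2 (n
  + 1) x): decay and oscillation have the same rate, and the rotation adds pi/4 to the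
  phase.\<close>

lemma Im_cis_exp_term:
  assumes "x > 0"
  defines "c \<equiv> of_real (2 * pi * sqrt (x / 2)) * (1 - \<i>)"
  shows "Im (cis (pi / 4) * exp_term n c) = sigma_normalized (Suc n)
           * exp (- 2 * pi * sqrt (2 * real (Suc n) * x)) * sin (pi / 4 + 2 * pi * sqrt (2 * real (Suc n) * x))"
proof -
  define v where "v = 2 * pi * sqrt (2 * real (Suc n) * x)"
  have "sqrt (2 * real (Suc n) * x) = 2 * (sqrt (x / 2) * sqrt (real (Suc n)))"
  proof -
    have "2 * real (Suc n) * x = 2\<^sup>2 * (x / 2 * real (Suc n))" by simp
    thus ?thesis by (simp only: real_sqrt_mult real_sqrt_abs abs_numeral)
  qed
  hence v: "v = 4 * pi * (sqrt (x / 2) * sqrt (real (Suc n)))" by (simp add: v_def)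
  have "Re (- 2 * c * of_real (sqrt (real (Suc n)))) = - v" "Im (- 2 * c * of_real (sqrt (real (Suc n)))) = v"
    by (simp_all add: c_def v del: of_nat_Suc)
  hence e: "exp (- 2 * c * of_real (sqrt (real (Suc n)))) = of_real (exp (- v)) * cis v"
    by (subst exp_eq_polar) (simp only:)
  have "cis (pi / 4) * exp_term n c = of_real (sigma_normalized (Suc n) * exp (- v)) * cis (pi / 4 + v)"
    unfolding exp_term_def e cis_mult[symmetric] of_real_mult by (simp only: mult_ac)
  hence "Im (cis (pi / 4) * exp_term n c) = sigma_normalized (Suc n) * exp (- v) * sin (pi / 4 + v)"
    by (simp only: Im_complex_of_real_mult_cis)
  thus ?thesis by (simp add: v_def)
qed

text \<open>With c = 2 pi w and s = sqrt (n + 1) the denominator is 8 pi^3 (s^2 + w^2) (s + w). As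
  w^2 = -i x, expanding by s - w makes it real: s^4 - w^4 = (n + 1)^2 + x^2.\<close>

lemma Im_cis_rat_term:
  assumes x: "x > 0"
  defines "c \<equiv> of_real (2 * pi * sqrt (x / 2)) * (1 - \<i>)"
  shows "Im (cis (pi / 4) * rat_term n c) = x / (pi * sqrt 2)
           * (sigma_normalized (Suc n) * ((sqrt (2 * x) - sqrt (real (Suc n))) / (x\<^sup>2 + (real (Suc n))\<^sup>2)))"
proof -
  define y where "y = sqrt (x / 2)"
  define s where "s = sqrt (real (Suc n))"
  define w where "w = of_real y * (1 - \<i>)"
  have y: "y > 0" "y\<^sup>2 = x / 2" using x by (simp_all add: y_def)
  have s: "s \<ge> 0" "s\<^sup>2 = real (Suc n)" by (simp_all add: s_def del: of_nat_Suc)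
  have c: "c = 2 * of_real pi * w" by (simp add: c_def w_def y_def)
  have w2: "w\<^sup>2 = - \<i> * of_real x"
  proof -
    have "w\<^sup>2 = of_real (y\<^sup>2) * (1 - \<i>)\<^sup>2" by (simp add: w_def power_mult_distrib)
    also have "(1 - \<i>)\<^sup>2 = - 2 * \<i>" by (simp add: power2_diff)
    finally show ?thesis by (simp add: y)
  qed
  define D where "D = (of_real (s\<^sup>2) + w\<^sup>2) * (of_real s + w)"
  have "D * (of_real s - w) = (of_real (s\<^sup>2))\<^sup>2 - (w\<^sup>2)\<^sup>2"
    by (simp add: D_def power2_eq_square algebra_simps)
  also have "\<dots> = of_real ((s\<^sup>2)\<^sup>2 + x\<^sup>2)"
    by (simp add: w2 power_mult_distrib)
  finally have Dw: "D * (of_real s - w) = of_real ((s\<^sup>2)\<^sup>2 + x\<^sup>2)" .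
  have pos: "(s\<^sup>2)\<^sup>2 + x\<^sup>2 > 0" using x by (simp add: add_nonneg_pos)
  hence "D \<noteq> 0" using Dw by (metis mult_zero_left of_real_eq_0_iff less_irrefl)
  have "2 * c\<^sup>2 / ((of_real (4 * pi\<^sup>2 * real (Suc n)) + c\<^sup>2) * (of_real (2 * pi * sqrt (real (Suc n))) + c))
      = w\<^sup>2 / (of_real pi * D)"
  proof -
    have e1: "(of_real (4 * pi\<^sup>2 * real (Suc n)) + c\<^sup>2) * (of_real (2 * pi * sqrt (real (Suc n))) + c)
        = (8 * of_real pi ^ 3) * D"
      unfolding s_def[symmetric] unfolding s(2)[symmetric] c D_def
      by (simp add: power2_eq_square power3_eq_cube algebra_simps)
    have e2: "2 * c\<^sup>2 = 8 * of_real pi ^ 2 * w\<^sup>2"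
      by (simp add: c power_mult_distrib)
    have e3: "8 * P ^ 2 * W / (8 * P ^ 3 * D) = W / (P * D)" if "P \<noteq> 0" for P W :: complex
      using that \<open>D \<noteq> 0\<close> by (simp add: field_simps power2_eq_square power3_eq_cube)
    show ?thesis unfolding e1 e2 by (rule e3) simp
  qed
  also have "w\<^sup>2 / (of_real pi * D) = w\<^sup>2 * (of_real s - w) / of_real (pi * ((s\<^sup>2)\<^sup>2 + x\<^sup>2))"
  proof -
    have "of_real s - w \<noteq> 0" using Dw pos by (metis mult_zero_right of_real_eq_0_iff less_irrefl)
    thus ?thesis unfolding of_real_mult Dw[symmetric] by (simp add: mult.assoc[symmetric])
  qed
  finally have rat: "rat_term n c = of_real (sigma_normalized (Suc n)) * (w\<^sup>2 * (of_real s - w) / of_real (pi * ((s\<^sup>2)\<^sup>2 + x\<^sup>2)))"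
    unfolding rat_term_def by (simp only:)
  have cis: "cis (pi / 4) = of_real (1 / sqrt 2) * (1 + \<i>)"
    by (simp add: complex_eq_iff cos_45 sin_45 real_div_sqrt field_simps)
  have "cis (pi / 4) * rat_term n c
      = of_real (sigma_normalized (Suc n) / (sqrt 2 * (pi * ((s\<^sup>2)\<^sup>2 + x\<^sup>2)))) * ((1 + \<i>) * w\<^sup>2 * (of_real s - w))"
    unfolding rat cis by (simp add: mult_ac)
  also have "Im \<dots> = sigma_normalized (Suc n) / (sqrt 2 * (pi * ((s\<^sup>2)\<^sup>2 + x\<^sup>2))) * Im ((1 + \<i>) * w\<^sup>2 * (of_real s - w))"
    by (rule Im_complex_of_real_mult)
  \<comment> \<open>(1 + i) w^2 = (1 - i) x and w = (1 - i) y, where (1 - i)^2 = -2 i.\<close>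
  also have "Im ((1 + \<i>) * w\<^sup>2 * (of_real s - w)) = x * (2 * y - s)"
    unfolding w2 by (simp add: w_def algebra_simps)
  also have "2 * y = sqrt (2 * x)"
  proof -
    have "(2 * y)\<^sup>2 = 2 * x" using y by (simp add: power_mult_distrib)
    thus ?thesis using y by (metis real_sqrt_unique mult_nonneg_nonneg less_imp_le zero_le_numeral)
  qed
  also have "sigma_normalized (Suc n) / (sqrt 2 * (pi * ((s\<^sup>2)\<^sup>2 + x\<^sup>2))) * (x * (sqrt (2 * x) - s))
      = x / (pi * sqrt 2) * (sigma_normalized (Suc n) * ((sqrt (2 * x) - s) / (x\<^sup>2 + (s\<^sup>2)\<^sup>2)))"
    by (simp add: mult_ac add.commute)
  finally show ?thesis unfolding s(2) by (simp only: s_def)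
qed

theorem corollary5p5:
  fixes x :: real
  assumes "x \<notin> \<int>" and "x > 0"
  defines "a \<equiv> (\<lambda>n::nat. divisor_sigma (1/2 :: real) n / sqrt (real n)
                 * exp (- 2 * pi * sqrt (2 * real n * x))
                 * sin (pi / 4 + 2 * pi * sqrt (2 * real n * x)))"
      and "b \<equiv> (\<lambda>n::nat. divisor_sigma (1/2 :: real) n / sqrt (real n)
                 * ((sqrt (2 * x) - sqrt (real n)) / (x\<^sup>2 + (real n)\<^sup>2)))"
  shows "summable (\<lambda>n. a (Suc n)) \<and> summable (\<lambda>n. b (Suc n)) \<and>
    complex_of_real (\<Sum>n. a (Suc n)) =
      1 / 2 * (complex_of_real (1 / (pi * sqrt x) - 1 / sqrt 2) * riemann_zeta (1 / 2)
               - complex_of_real (1 / (pi * x * sqrt 2)) * riemann_zeta (- 1 / 2))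
      + complex_of_real (x / (pi * sqrt 2) * (\<Sum>n. b (Suc n)))"
proof -
  note x = \<open>x > 0\<close>
  define y where "y = sqrt (x / 2)"
  define c where "c = of_real (2 * pi * sqrt (x / 2)) * (1 - \<i>)"
  define \<alpha> where "\<alpha> = (bose_mellin_real (1/2) - 3) / sqrt pi"
  define \<beta> where "\<beta> = zeta_real (3/2)"
  define F where "F = (\<Sum>n. exp_term n c)"
  define G where "G = (\<Sum>n. rat_term n c)"
  have y: "y > 0" "y\<^sup>2 = x / 2" "sqrt x = sqrt 2 * y"
    using x by (simp_all add: y_def flip: real_sqrt_mult)
  have c_y: "c = of_real (2 * pi * y) * (1 - \<i>)" by (simp add: c_def y_def)
  have Re_c: "Re c > 0" using y by (simp add: c_y)
  have cis: "cis (pi / 4) = of_real (1 / sqrt 2) * (1 + \<i>)"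
    by (simp add: complex_eq_iff cos_45 sin_45 real_div_sqrt field_simps)
  have a_sums: "(\<lambda>n. a (Suc n)) sums Im (cis (pi / 4) * F)"
    using sums_Im[OF sums_mult[OF exp_series_holomorphic_sums(2)[OF Re_c], of "cis (pi / 4)"]]
    unfolding F_def c_def Im_cis_exp_term[OF x] a_def .
  have "(\<lambda>n. x / (pi * sqrt 2) * b (Suc n)) sums Im (cis (pi / 4) * G)"
    using sums_Im[OF sums_mult[OF rat_series_holomorphic_sums(2)[OF Re_c], of "cis (pi / 4)"]]
    unfolding G_def c_def Im_cis_rat_term[OF x] b_def .
  \<comment> \<open>Dividing by the nonzero prefactor recovers the convergence of the series of b
    itself.\<close>
  from sums_mult[OF this, of "pi * sqrt 2 / x"]
  have b_sums: "(\<lambda>n. b (Suc n)) sums (pi * sqrt 2 / x * Im (cis (pi / 4) * G))"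
    using x by simp
  have "cis (pi / 4) * F = cis (pi / 4) * G + of_real (\<beta> / 2) * (cis (pi / 4) / c\<^sup>2) + of_real \<alpha> * (cis (pi / 4) / c)
      - of_real (\<alpha> / 2) * cis (pi / 4) - of_real (\<beta> / (4 * pi)) * (cis (pi / 4) * c)"
    unfolding F_def G_def voronoi_complex[OF Re_c] \<alpha>_def[symmetric] \<beta>_def[symmetric]
    by (simp add: algebra_simps)
  hence "Im (cis (pi / 4) * F) = Im (cis (pi / 4) * G) + \<beta> / 2 * Im (cis (pi / 4) / c\<^sup>2) + \<alpha> * Im (cis (pi / 4) / c)
      - \<alpha> / 2 * Im (cis (pi / 4)) - \<beta> / (4 * pi) * Im (cis (pi / 4) * c)"
    by (simp only: plus_complex.sel minus_complex.sel Im_complex_of_real_mult)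
  \<comment> \<open>\<open>cis (pi / 4)\<close> cancels the argument -pi/4 of c, so the term of the
    identity that grows with c drops out.\<close>
  also have "Im (cis (pi / 4) * c) = 0"
    unfolding cis c_y by simp
  also have "Im (cis (pi / 4)) = 1 / sqrt 2"
    unfolding cis by simp
  \<comment> \<open>This quotient has argument pi/2; the quotient by the square of c, treated next,
    has argument 3 pi/4, whence its extra factor 1 / sqrt 2.\<close>
  also have "Im (cis (pi / 4) / c) = 1 / (2 * pi * sqrt x)"
  proof -
    have "cis (pi / 4) = \<i> * of_real (1 / (2 * pi * sqrt x)) * c"
      using y x unfolding cis c_y y(3) by (simp add: complex_eq_iff)
    moreover have "c \<noteq> 0" using Re_c by auto
    ultimately have "cis (pi / 4) / c = \<i> * of_real (1 / (2 * pi * sqrt x))" by simp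
    thus ?thesis by simp
  qed
  also have "Im (cis (pi / 4) / c\<^sup>2) = 1 / (4 * sqrt 2 * pi\<^sup>2 * x)"
  proof -
    have "c\<^sup>2 = of_real ((2 * pi * y)\<^sup>2) * (1 - \<i>)\<^sup>2" by (simp add: c_y power_mult_distrib)
    also have "(1 - \<i>)\<^sup>2 = - 2 * \<i>" by (simp add: power2_diff)
    finally have c2: "c\<^sup>2 = - (of_real (4 * pi\<^sup>2 * x) * \<i>)" by (simp add: power_mult_distrib y)
    have "cis (pi / 4) = (\<i> - 1) * of_real (1 / (4 * sqrt 2 * pi\<^sup>2 * x)) * c\<^sup>2"
      using x unfolding cis c2 by (simp add: complex_eq_iff)
    moreover have "c\<^sup>2 \<noteq> 0" using Re_c by auto
    ultimately have "cis (pi / 4) / c\<^sup>2 = (\<i> - 1) * of_real (1 / (4 * sqrt 2 * pi\<^sup>2 * x))" by simp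
    thus ?thesis by simp
  qed
  also have "Im (cis (pi / 4) * G) = x / (pi * sqrt 2) * (\<Sum>n. b (Suc n))"
    using sums_unique[OF b_sums, symmetric] x by simp
  finally have "(\<Sum>n. a (Suc n)) = 1 / 2 * ((1 / (pi * sqrt x) - 1 / sqrt 2) * \<alpha>
      - 1 / (pi * x * sqrt 2) * (- \<beta> / (4 * pi))) + x / (pi * sqrt 2) * (\<Sum>n. b (Suc n))"
    unfolding sums_unique[OF a_sums, symmetric]
    by (simp add: algebra_simps power2_eq_square diff_divide_distrib)
  \<comment> \<open>Both zeta values are real, so the equation between real numbers just obtained
    embeds into \<open>complex\<close> term by term.\<close>
  moreover have "riemann_zeta (1 / 2) = of_real \<alpha>" "riemann_zeta (- 1 / 2) = of_real (- \<beta> / (4 * pi))"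
    unfolding \<alpha>_def \<beta>_def by (rule riemann_zeta_half riemann_zeta_minus_half)+
  ultimately have "complex_of_real (\<Sum>n. a (Suc n)) =
      1 / 2 * (complex_of_real (1 / (pi * sqrt x) - 1 / sqrt 2) * riemann_zeta (1 / 2)
               - complex_of_real (1 / (pi * x * sqrt 2)) * riemann_zeta (- 1 / 2))
      + complex_of_real (x / (pi * sqrt 2) * (\<Sum>n. b (Suc n)))"
    by (simp only: of_real_add of_real_diff of_real_mult of_real_divide of_real_1 of_real_numeral)
  thus ?thesis using a_sums b_sums by (simp only: sums_summable conj_absorb simp_thms)
qed

end
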